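(* Any inner NC rational function is NC Blaschke; that is, if $\Theta\in\mathbb{H}^\infty_d$ is inner and is an NC rational function, then $\Theta$ is NC Blaschke.
   Context: Fock space. Fix an integer $d\ge1$. $\mathbb{F}^d$ is the free monoid of words in the letters $1,\dots,d$; for $\alpha=i_1\cdots i_n$ put $|\alpha|=n$, $\mathfrak{z}^\alpha=\mathfrak{z}_{i_1}\cdots\mathfrak{z}_{i_n}$, $X^\alpha=X_{i_1}\cdots X_{i_n}$. $\mathbb{H}^2_d$ is the Hilbert space of formal power series $f=\sum_\alpha\hat f_\alpha\mathfrak{z}^\alpha$ in noncommuting variables with $\sum_\alpha|\hat f_\alpha|^2<\infty$. $L_k$ is left multiplication by $\mathfrak{z}_k$. $\mathbb{B}^d_n$ is the set of $d$-tuples $X$ of $n\times n$ complex matrices with $\|\sum_jX_jX_j^*\|<1$; $\mathbb{B}^d_\infty$ is the set of such strict row contractions on a fixed separable infinite-dimensional Hilbert space (denoted $\mathbb{C}^\infty$). For $Z$ in any of these, $f(Z)=\sum_{k\ge0}\sum_{|\alpha|=k}\hat f_\alpha Z^\alpha$. $\mathbb{H}^\infty_d$ is the WOT-closed unital algebra generated by $L_1,\dots,L_d$, identified via $F(L)\mapsto F=F(L)1$ with the left multipliers of $\mathbb{H}^2_d$. $\Theta\in\mathbb{H}^\infty_d$ is inner if $\Theta(L)$ is an isometry. For $f\in\mathbb{H}^2_d$, $\mathrm{Sing}_n(f)=\{(Z,y)\in\mathbb{B}^d_n\times(\mathbb{C}^n\setminus\{0\}):y^*f(Z)=0\}$ and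 $\mathrm{Sing}(f)=\bigsqcup_{n\in\mathbb{N}\cup\{\infty\}}\mathrm{Sing}_n(f)$. An inner $\Theta$ is NC Blaschke if $\mathrm{Ran}(\Theta(L))=\{h\in\mathbb{H}^2_d: y^*h(Z)=0\ \forall(Z,y)\in\mathrm{Sing}(\Theta)\}$. NC rational functions. An NC rational expression is a syntactically valid combination of $\mathfrak{z}_1,\dots,\mathfrak{z}_d$, complex scalars, $+,\cdot,{}^{-1}$ and parentheses; its domain is the set of $d$-tuples of matrices (of any common finite size) where it can be evaluated. An NC rational function is an equivalence class of expressions with nonempty domain, where two expressions are equivalent if their domains intersect and they agree on the intersection; its domain is the union of the domains of representatives. An NC rational function regular at $0$ is identified with its power series at $0$. *)

theory Defs
  imports
    "HOL-Analysis.Analysis"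
    "Jordan_Normal_Form.Matrix"
    "Jordan_Normal_Form.Gauss_Jordan_Elimination"
    "Jordan_Normal_Form.Schur_Decomposition"
begin

section \<open>The complex Hilbert spaces of square-summable families\<close>

text \<open>The Fock space is \<open>'d list ell2\<close> (words over a finite nonempty alphabet \<open>'d\<close> with
  \<open>CARD('d) = d\<close>), and the fixed separable infinite-dimensional Hilbert space is \<open>nat ell2\<close>.
  The library has no complex Hilbert spaces, so \<open>'i ell2\<close> is made a \<^class>\<open>real_inner\<close> space
  with inner product \<open>Re (cinner x y)\<close> (which induces the usual norm); complex scalars are
  the operators \<open>cscale c\<close>.\<close>

typedef 'i ell2 = "{x :: 'i \<Rightarrow> complex. (\<lambda>i. (cmod (x i))\<^sup>2) summable_on UNIV}"
  morphisms coeff Abs_ell2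
  by (rule exI[of _ "\<lambda>_. 0"]) simp

setup_lifting type_definition_ell2

lemma coeff_square_summable: "(\<lambda>i. (cmod (coeff x i))\<^sup>2) summable_on UNIV"
  using coeff[of x] by simp

lemma ell2_mult_abs_summable:
  assumes "(\<lambda>i. (cmod (x i))\<^sup>2) summable_on UNIV" "(\<lambda>i. (cmod (y i))\<^sup>2) summable_on UNIV"
  shows "(\<lambda>i. norm (cnj (x i) * y i)) summable_on UNIV"
proof (rule summable_on_comparison_test)
  show "(\<lambda>i. (cmod (x i))\<^sup>2 + (cmod (y i))\<^sup>2) summable_on UNIV"
    by (rule summable_on_add[OF assms])
  show "cmod (cnj (x i) * y i) \<le> (cmod (x i))\<^sup>2 + (cmod (y i))\<^sup>2" for i
  proof -
    have "0 \<le> cmod (x i) * cmod (y i)" by simp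
    then show ?thesis
      using sum_squares_bound[of "cmod (x i)" "cmod (y i)"] by (simp only: norm_mult complex_mod_cnj)
  qed
qed simp

lemma ell2_add_summable:
  assumes "(\<lambda>i. (cmod (x i))\<^sup>2) summable_on UNIV" "(\<lambda>i. (cmod (y i))\<^sup>2) summable_on UNIV"
  shows "(\<lambda>i. (cmod (x i + y i))\<^sup>2) summable_on UNIV"
proof (rule summable_on_comparison_test)
  show "(\<lambda>i. 2 * ((cmod (x i))\<^sup>2 + (cmod (y i))\<^sup>2)) summable_on UNIV"
    by (intro summable_on_cmult_right summable_on_add assms)
  show "(cmod (x i + y i))\<^sup>2 \<le> 2 * ((cmod (x i))\<^sup>2 + (cmod (y i))\<^sup>2)" for i
  proof -
    have "(cmod (x i + y i))\<^sup>2 \<le> (cmod (x i) + cmod (y i))\<^sup>2"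
      by (simp add: norm_triangle_ineq power_mono)
    also have "\<dots> \<le> 2 * ((cmod (x i))\<^sup>2 + (cmod (y i))\<^sup>2)"
      using sum_squares_bound[of "cmod (x i)" "cmod (y i)"] by (simp add: power2_sum)
    finally show ?thesis .
  qed
qed simp

lemma ell2_scale_summable:
  assumes "(\<lambda>i. (cmod (x i))\<^sup>2) summable_on UNIV"
  shows "(\<lambda>i. (cmod (c * x i))\<^sup>2) summable_on UNIV"
  using summable_on_cmult_right[OF assms, of "(cmod c)\<^sup>2"]
  by (simp add: norm_mult power_mult_distrib)

text \<open>Conjugate-linear in the first argument, so that \<open>cinner y x\<close> is \<open>y\<^sup>* x\<close>.\<close>

definition cinner :: "'i ell2 \<Rightarrow> 'i ell2 \<Rightarrow> complex" where
  "cinner x y = (\<Sum>\<^sub>\<infinity>i. cnj (coeff x i) * coeff y i)"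

instantiation ell2 :: (type) real_inner
begin

lift_definition zero_ell2 :: "'a ell2" is "\<lambda>_. 0" by simp

lift_definition plus_ell2 :: "'a ell2 \<Rightarrow> 'a ell2 \<Rightarrow> 'a ell2" is "\<lambda>x y i. x i + y i"
  by (rule ell2_add_summable)

lift_definition uminus_ell2 :: "'a ell2 \<Rightarrow> 'a ell2" is "\<lambda>x i. - x i" by simp

lift_definition minus_ell2 :: "'a ell2 \<Rightarrow> 'a ell2 \<Rightarrow> 'a ell2" is "\<lambda>x y i. x i - y i"
  subgoal for x y using ell2_add_summable[of x "\<lambda>i. - y i"] by simp
  done

lift_definition scaleR_ell2 :: "real \<Rightarrow> 'a ell2 \<Rightarrow> 'a ell2" is "\<lambda>r x i. of_real r * x i"
  by (rule ell2_scale_summable)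

definition inner_ell2 :: "'a ell2 \<Rightarrow> 'a ell2 \<Rightarrow> real" where
  "inner_ell2 x y = Re (cinner x y)"

definition norm_ell2 :: "'a ell2 \<Rightarrow> real" where
  "norm_ell2 x = sqrt (\<Sum>\<^sub>\<infinity>i. (cmod (coeff x i))\<^sup>2)"

definition dist_ell2 :: "'a ell2 \<Rightarrow> 'a ell2 \<Rightarrow> real" where
  "dist_ell2 x y = norm (x - y)"

definition sgn_ell2 :: "'a ell2 \<Rightarrow> 'a ell2" where
  "sgn_ell2 x = inverse (norm x) *\<^sub>R x"

definition uniformity_ell2 :: "('a ell2 \<times> 'a ell2) filter" where
  "uniformity_ell2 = (INF e\<in>{0<..}. principal {(x, y). dist x y < e})"

definition open_ell2 :: "'a ell2 set \<Rightarrow> bool" where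
  "open_ell2 U = (\<forall>x\<in>U. eventually (\<lambda>(x', y). x' = x \<longrightarrow> y \<in> U) uniformity)"

lemma cinner_summable: "(\<lambda>i. cnj (coeff x i) * coeff y i) summable_on UNIV"
  by (rule abs_summable_summable[OF ell2_mult_abs_summable[OF coeff_square_summable coeff_square_summable]])

lemma inner_ell2_alt: "inner x y = (\<Sum>\<^sub>\<infinity>i. Re (cnj (coeff x i) * coeff y i))" for x y :: "'a ell2"
  unfolding inner_ell2_def cinner_def by (rule infsum_Re[OF cinner_summable, symmetric])

lemma inner_ell2_summable: "(\<lambda>i. Re (cnj (coeff x i) * coeff y i)) summable_on UNIV"
  by (rule summable_on_Re[OF cinner_summable])

lemma inner_ell2_self: "inner x x = (\<Sum>\<^sub>\<infinity>i. (cmod (coeff x i))\<^sup>2)" for x :: "'a ell2"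
  unfolding inner_ell2_alt by (rule infsum_cong) (simp add: cmod_power2; simp add: power2_eq_square)

instance
proof
  fix x y z :: "'a ell2" and r s :: real
  show "inner x y = inner y x"
    unfolding inner_ell2_alt by (rule infsum_cong) (simp add: algebra_simps)
  show "inner (x + y) z = inner x z + inner y z"
    unfolding inner_ell2_alt infsum_add[OF inner_ell2_summable inner_ell2_summable, symmetric]
    by (rule infsum_cong) (simp add: plus_ell2.rep_eq algebra_simps)
  show "inner (r *\<^sub>R x) y = r * inner x y"
    unfolding inner_ell2_alt infsum_cmult_right[OF inner_ell2_summable, symmetric]
    by (rule infsum_cong) (simp add: scaleR_ell2.rep_eq algebra_simps)
  show "0 \<le> inner x x"
    unfolding inner_ell2_self by (intro infsum_nonneg) simp
  show "inner x x = 0 \<longleftrightarrow> x = 0"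
  proof
    assume "inner x x = 0"
    then have "(cmod (coeff x i))\<^sup>2 = 0" for i
      by (intro nonneg_infsum_le_0D[OF _ coeff_square_summable]) (auto simp: inner_ell2_self)
    then show "x = 0" by (simp add: coeff_inject[symmetric] zero_ell2.rep_eq fun_eq_iff)
  qed (simp add: inner_ell2_self zero_ell2.rep_eq)
  show "norm x = sqrt (inner x x)"
    by (simp add: inner_ell2_self norm_ell2_def)
  show "x + y + z = x + (y + z)" "x + y = y + x" "0 + x = x" "- x + x = 0" "x - y = x + - y"
    by (transfer, simp add: algebra_simps)+
  show "r *\<^sub>R (x + y) = r *\<^sub>R x + r *\<^sub>R y" "(r + s) *\<^sub>R x = r *\<^sub>R x + s *\<^sub>R x"
    "r *\<^sub>R s *\<^sub>R x = (r * s) *\<^sub>R x" "1 *\<^sub>R x = x"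
    by (transfer, simp add: algebra_simps)+
qed (simp_all only: dist_ell2_def sgn_ell2_def uniformity_ell2_def open_ell2_def)

end

lift_definition unit_ell2 :: "'i \<Rightarrow> 'i ell2" is "\<lambda>k i. if i = k then 1 else 0"
  by (rule finite_nonzero_values_imp_summable_on) (rule finite_subset[of _ "{_}"], auto)

lift_definition cscale_fun :: "complex \<Rightarrow> 'i ell2 \<Rightarrow> 'i ell2" is "\<lambda>c x i. c * x i"
  by (rule ell2_scale_summable)

lemma norm_cscale_fun: "norm (cscale_fun c x) = cmod c * norm x"
  by (simp add: norm_ell2_def cscale_fun.rep_eq norm_mult power_mult_distrib
      infsum_cmult_right[OF coeff_square_summable] real_sqrt_mult)

lift_definition cscale :: "complex \<Rightarrow> 'i ell2 \<Rightarrow>\<^sub>L 'i ell2" is cscale_fun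
proof -
  fix c :: complex
  show "bounded_linear (cscale_fun c :: 'i ell2 \<Rightarrow> _)"
  proof (rule bounded_linear_intro[where K = "cmod c"])
    show "cscale_fun c (x + y) = cscale_fun c x + cscale_fun c y" for x y :: "'i ell2"
      by transfer (simp add: algebra_simps)
    show "cscale_fun c (r *\<^sub>R x) = r *\<^sub>R cscale_fun c x" for r and x :: "'i ell2"
      by transfer (simp add: algebra_simps)
  qed (simp add: norm_cscale_fun)
qed

definition clinear_op :: "('i ell2 \<Rightarrow>\<^sub>L 'i ell2) \<Rightarrow> bool" where
  "clinear_op A \<longleftrightarrow> (\<forall>c. A o\<^sub>L cscale c = cscale c o\<^sub>L A)"

text \<open>Meaningful only for complex-linear \<open>A\<close>, where the adjoint exists by Riesz representation.\<close>

definition cadjoint :: "('i ell2 \<Rightarrow>\<^sub>L 'i ell2) \<Rightarrow> ('i ell2 \<Rightarrow>\<^sub>L 'i ell2)" where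
  "cadjoint A = (THE B. \<forall>x y. cinner (blinfun_apply A x) y = cinner x (blinfun_apply B y))"

definition weak_operator_topology :: "('i ell2 \<Rightarrow>\<^sub>L 'i ell2) topology" where
  "weak_operator_topology =
     pullback_topology UNIV (\<lambda>A (y, x). cinner y (blinfun_apply A x)) euclidean"


section \<open>Fock space and its left multiplier algebra\<close>

type_synonym 'd fock = "'d list ell2"
type_synonym 'd fock_op = "'d list ell2 \<Rightarrow>\<^sub>L 'd list ell2"

definition vacuum :: "'d fock" where
  "vacuum = unit_ell2 []"

lemma lshift_infsum:
  fixes f :: "'d list \<Rightarrow> complex" and k :: 'd
  defines "g \<equiv> \<lambda>w. case w of [] \<Rightarrow> 0 | i # v \<Rightarrow> if i = k then f v else 0"
  shows "(\<lambda>w. (cmod (g w))\<^sup>2) summable_on UNIV \<longleftrightarrow> (\<lambda>w. (cmod (f w))\<^sup>2) summable_on UNIV"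
    and "(\<Sum>\<^sub>\<infinity>w. (cmod (g w))\<^sup>2) = (\<Sum>\<^sub>\<infinity>w. (cmod (f w))\<^sup>2)"
proof -
  have zero: "(cmod (g w))\<^sup>2 = 0" if "w \<notin> range ((#) k)" for w
    using that by (cases w) (auto simp: g_def)
  have inj: "inj ((#) k)" by (simp add: inj_def)
  have comp: "(\<lambda>w. (cmod (g w))\<^sup>2) \<circ> (#) k = (\<lambda>w. (cmod (f w))\<^sup>2)"
    by (simp add: g_def fun_eq_iff)
  have "(\<lambda>w. (cmod (g w))\<^sup>2) summable_on UNIV
      \<longleftrightarrow> (\<lambda>w. (cmod (g w))\<^sup>2) summable_on range ((#) k)"
    by (rule summable_on_cong_neutral) (use zero in auto)
  also have "\<dots> \<longleftrightarrow> (\<lambda>w. (cmod (f w))\<^sup>2) summable_on UNIV"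
    using summable_on_reindex[OF inj, of "\<lambda>w. (cmod (g w))\<^sup>2"] by (simp only: comp)
  finally show "(\<lambda>w. (cmod (g w))\<^sup>2) summable_on UNIV
      \<longleftrightarrow> (\<lambda>w. (cmod (f w))\<^sup>2) summable_on UNIV" .
  have "(\<Sum>\<^sub>\<infinity>w. (cmod (g w))\<^sup>2) = infsum (\<lambda>w. (cmod (g w))\<^sup>2) (range ((#) k))"
    by (rule infsum_cong_neutral) (use zero in auto)
  also have "\<dots> = (\<Sum>\<^sub>\<infinity>w. (cmod (f w))\<^sup>2)"
    using infsum_reindex[OF inj, of "\<lambda>w. (cmod (g w))\<^sup>2"] by (simp only: comp)
  finally show "(\<Sum>\<^sub>\<infinity>w. (cmod (g w))\<^sup>2) = (\<Sum>\<^sub>\<infinity>w. (cmod (f w))\<^sup>2)" .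
qed

lift_definition lshift_fun :: "'d \<Rightarrow> 'd fock \<Rightarrow> 'd fock" is
  "\<lambda>k f w. case w of [] \<Rightarrow> 0 | i # v \<Rightarrow> if i = k then f v else 0"
  by (simp add: lshift_infsum)

lift_definition lshift :: "'d \<Rightarrow> 'd fock_op" is lshift_fun
proof -
  fix k :: 'd
  show "bounded_linear (lshift_fun k)"
  proof (rule bounded_linear_intro[where K = 1])
    show "lshift_fun k (x + y) = lshift_fun k x + lshift_fun k y" for x y
      by transfer (auto simp: fun_eq_iff split: list.split)
    show "lshift_fun k (r *\<^sub>R x) = r *\<^sub>R lshift_fun k x" for r x
      by transfer (auto simp: fun_eq_iff split: list.split)
    show "norm (lshift_fun k x) \<le> norm x * 1" for x
      by (simp add: norm_ell2_def lshift_fun.rep_eq lshift_infsum)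
  qed
qed

definition unital_op_algebra :: "('i ell2 \<Rightarrow>\<^sub>L 'i ell2) set \<Rightarrow> bool" where
  "unital_op_algebra \<A> \<longleftrightarrow>
     id_blinfun \<in> \<A> \<and>
     (\<forall>c. \<forall>A\<in>\<A>. cscale c o\<^sub>L A \<in> \<A>) \<and>
     (\<forall>A\<in>\<A>. \<forall>B\<in>\<A>. A + B \<in> \<A> \<and> A o\<^sub>L B \<in> \<A>)"

text \<open>Elements of \<open>Hinf\<close> are the operators \<open>F(L)\<close>; the power series \<open>F\<close> identified with
  \<open>F(L)\<close> is \<open>symbol (F(L)) = F(L) 1\<close>.\<close>

definition Hinf :: "'d fock_op set" where
  "Hinf = (\<lambda>\<A>. unital_op_algebra \<A> \<and> closedin weak_operator_topology \<A>) hull (range lshift)"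

definition symbol :: "'d fock_op \<Rightarrow> 'd fock" where
  "symbol F = blinfun_apply F vacuum"

definition nc_inner :: "'d fock_op \<Rightarrow> bool" where
  "nc_inner F \<longleftrightarrow> F \<in> Hinf \<and> (\<forall>x. norm (blinfun_apply F x) = norm x)"


section \<open>Row contractions and evaluation of power series\<close>

text \<open>Matrices carry no norm in the library; \<open>mat_norm\<close> is the Euclidean operator norm.\<close>

definition cvec_norm :: "complex vec \<Rightarrow> real" where
  "cvec_norm v = L2_set (\<lambda>i. cmod (vec_index v i)) {..<dim_vec v}"

definition mat_norm :: "complex mat \<Rightarrow> real" where
  "mat_norm A = (SUP v\<in>{v \<in> carrier_vec (dim_col A). cvec_norm v \<le> 1}. cvec_norm (A *\<^sub>v v))"

definition mat_tuples :: "nat \<Rightarrow> ('d \<Rightarrow> complex mat) set" where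
  "mat_tuples n = {X. \<forall>j. X j \<in> carrier_mat n n}"

definition row_ball :: "nat \<Rightarrow> ('d::finite \<Rightarrow> complex mat) set" where
  "row_ball n = {X \<in> mat_tuples n.
     mat_norm (mat n n (\<lambda>ik. \<Sum>j\<in>UNIV. (X j * mat_adjoint (X j)) $$ ik)) < 1}"

definition row_ball_inf :: "('d::finite \<Rightarrow> nat ell2 \<Rightarrow>\<^sub>L nat ell2) set" where
  "row_ball_inf = {Z. (\<forall>j. clinear_op (Z j)) \<and> norm (\<Sum>j\<in>UNIV. Z j o\<^sub>L cadjoint (Z j)) < 1}"

definition mat_word :: "nat \<Rightarrow> ('d \<Rightarrow> complex mat) \<Rightarrow> 'd list \<Rightarrow> complex mat" where
  "mat_word n X \<alpha> = foldr (\<lambda>j A. X j * A) \<alpha> (1\<^sub>m n)"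

definition op_word :: "('d \<Rightarrow> 'i ell2 \<Rightarrow>\<^sub>L 'i ell2) \<Rightarrow> 'd list \<Rightarrow> 'i ell2 \<Rightarrow>\<^sub>L 'i ell2" where
  "op_word Z \<alpha> = foldr (\<lambda>j A. Z j o\<^sub>L A) \<alpha> id_blinfun"

text \<open>\<open>hom_eval n f X m\<close> is the matrix of the degree-\<open>m\<close> homogeneous part of \<open>f\<close> at \<open>X\<close>;
  series of matrices are summed entrywise.\<close>

definition hom_eval ::
    "nat \<Rightarrow> ('d::finite list \<Rightarrow> complex) \<Rightarrow> ('d \<Rightarrow> complex mat) \<Rightarrow> nat \<Rightarrow> complex mat" where
  "hom_eval n f X m =
     mat n n (\<lambda>ik. \<Sum>\<alpha>\<in>{\<alpha>. length \<alpha> = m}. f \<alpha> * mat_word n X \<alpha> $$ ik)"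

definition series_eval ::
    "nat \<Rightarrow> ('d::finite list \<Rightarrow> complex) \<Rightarrow> ('d \<Rightarrow> complex mat) \<Rightarrow> complex mat" where
  "series_eval n f X = mat n n (\<lambda>ik. \<Sum>m. hom_eval n f X m $$ ik)"

definition series_eval_inf ::
    "('d::finite list \<Rightarrow> complex) \<Rightarrow> ('d \<Rightarrow> 'i ell2 \<Rightarrow>\<^sub>L 'i ell2) \<Rightarrow> 'i ell2 \<Rightarrow>\<^sub>L 'i ell2" where
  "series_eval_inf f Z = (\<Sum>m. \<Sum>\<alpha>\<in>{\<alpha>. length \<alpha> = m}. cscale (f \<alpha>) o\<^sub>L op_word Z \<alpha>)"


section \<open>Singularity space and NC Blaschke inner functions\<close>

text \<open>\<open>y\<^sup>* A = 0\<close>: as a row vector at finite levels, as the functional \<open>x \<mapsto> y\<^sup>* (A x)\<close>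
  at the infinite level.\<close>

definition left_null :: "complex vec \<Rightarrow> complex mat \<Rightarrow> bool" where
  "left_null y A \<longleftrightarrow> mat_of_row (conjugate y) * A = 0\<^sub>m 1 (dim_col A)"

definition left_null_inf :: "'i ell2 \<Rightarrow> ('i ell2 \<Rightarrow>\<^sub>L 'i ell2) \<Rightarrow> bool" where
  "left_null_inf y A \<longleftrightarrow> (\<forall>x. cinner y (blinfun_apply A x) = 0)"

definition Sing :: "nat \<Rightarrow> 'd::finite fock \<Rightarrow> (('d \<Rightarrow> complex mat) \<times> complex vec) set" where
  "Sing n f = {(Z, y). Z \<in> row_ball n \<and> y \<in> carrier_vec n \<and> y \<noteq> 0\<^sub>v n \<and>
     left_null y (series_eval n (coeff f) Z)}"

definition Sing_inf :: "'d::finite fock \<Rightarrow> (('d \<Rightarrow> nat ell2 \<Rightarrow>\<^sub>L nat ell2) \<times> nat ell2) set" where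
  "Sing_inf f = {(Z, y). Z \<in> row_ball_inf \<and> y \<noteq> 0 \<and>
     left_null_inf y (series_eval_inf (coeff f) Z)}"

definition nc_blaschke :: "'d::finite fock_op \<Rightarrow> bool" where
  "nc_blaschke \<Theta> \<longleftrightarrow> nc_inner \<Theta> \<and>
     range (blinfun_apply \<Theta>) =
       {h. (\<forall>n\<ge>1. \<forall>(Z, y)\<in>Sing n (symbol \<Theta>). left_null y (series_eval n (coeff h) Z)) \<and>
           (\<forall>(Z, y)\<in>Sing_inf (symbol \<Theta>). left_null_inf y (series_eval_inf (coeff h) Z))}"


section \<open>NC rational functions\<close>

datatype 'd nc_expr =
    Var 'd
  | Const complex
  | Add "'d nc_expr" "'d nc_expr"
  | Mult "'d nc_expr" "'d nc_expr"
  | Inv "'d nc_expr"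

primrec nc_eval :: "nat \<Rightarrow> ('d \<Rightarrow> complex mat) \<Rightarrow> 'd nc_expr \<Rightarrow> complex mat option" where
  "nc_eval n X (Var j) = Some (X j)"
| "nc_eval n X (Const c) = Some (c \<cdot>\<^sub>m 1\<^sub>m n)"
| "nc_eval n X (Add r s) =
     Option.bind (nc_eval n X r) (\<lambda>A. Option.bind (nc_eval n X s) (\<lambda>B. Some (A + B)))"
| "nc_eval n X (Mult r s) =
     Option.bind (nc_eval n X r) (\<lambda>A. Option.bind (nc_eval n X s) (\<lambda>B. Some (A * B)))"
| "nc_eval n X (Inv r) = Option.bind (nc_eval n X r) mat_inverse"

text \<open>The size \<open>0\<close> is excluded: there every expression evaluates, and all of them agree.\<close>

definition nc_dom :: "'d nc_expr \<Rightarrow> (nat \<times> ('d \<Rightarrow> complex mat)) set" where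
  "nc_dom r = {(n, X). 1 \<le> n \<and> X \<in> mat_tuples n \<and> nc_eval n X r \<noteq> None}"

definition nc_equiv :: "('d nc_expr \<times> 'd nc_expr) set" where
  "nc_equiv = {(r, s). nc_dom r \<inter> nc_dom s \<noteq> {} \<and>
     (\<forall>(n, X)\<in>nc_dom r \<inter> nc_dom s. nc_eval n X r = nc_eval n X s)}"

definition nc_rat_functions :: "'d nc_expr set set" where
  "nc_rat_functions = {r. nc_dom r \<noteq> {}} // nc_equiv"

definition nc_rat_dom :: "'d nc_expr set \<Rightarrow> (nat \<times> ('d \<Rightarrow> complex mat)) set" where
  "nc_rat_dom \<rr> = (\<Union>r\<in>\<rr>. nc_dom r)"

definition nc_zero_point :: "nat \<times> ('d \<Rightarrow> complex mat)" where
  "nc_zero_point = (1, \<lambda>_. 0\<^sub>m 1 1)"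

text \<open>\<open>f\<close> is the power series of \<open>r\<close> at \<open>0\<close> if, at every matrix size, the homogeneous
  expansion of \<open>f\<close> converges to \<open>r\<close> on a neighbourhood of the zero tuple.\<close>

definition nc_power_series :: "'d::finite nc_expr \<Rightarrow> ('d list \<Rightarrow> complex) \<Rightarrow> bool" where
  "nc_power_series r f \<longleftrightarrow>
     (\<forall>n\<ge>1. \<exists>\<epsilon>>0. \<forall>X\<in>mat_tuples n. (\<forall>j. mat_norm (X j) < \<epsilon>) \<longrightarrow>
        (\<exists>A. nc_eval n X r = Some A \<and>
          (\<forall>i<n. \<forall>k<n. (\<lambda>m. hom_eval n f X m $$ (i, k)) sums (A $$ (i, k)))))"

text \<open>The power series of a class is computed from any representative defined at \<open>0\<close>; one
  exists exactly if the class is regular at \<open>0\<close>.\<close>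

definition nc_rational :: "('d::finite list \<Rightarrow> complex) \<Rightarrow> bool" where
  "nc_rational f \<longleftrightarrow>
     (\<exists>\<rr>\<in>nc_rat_functions. nc_zero_point \<in> nc_rat_dom \<rr> \<and>
        (\<exists>r\<in>\<rr>. nc_zero_point \<in> nc_dom r \<and> nc_power_series r f))"

end

theory Submission
  imports Defs "HOL-Library.Function_Algebras"
begin

text \<open>
  Why a rational inner \<open>\<Theta>\<close> is NC Blaschke. Write \<open>\<theta> = \<Theta> 1\<close>; every element of the multiplier
  algebra acts on coefficients by convolution with its symbol (\<open>Hinf_apply\<close>).

  \<^emph>\<open>The range of \<open>\<Theta>\<close> vanishes on the singular points.\<close> At a strict row contraction \<open>Z\<close> the numbers
  \<open>y\<^sup>* Z\<^sup>\<alpha> v\<close> are square-summable over all words \<open>\<alpha>\<close>, so \<open>h \<mapsto> y\<^sup>* h(Z) v\<close> is a continuous functional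
  on the Fock space. If \<open>y\<^sup>* \<theta>(Z) = 0\<close>, it kills every \<open>\<theta> z\<^sup>\<beta>\<close>, because right multiplication by
  a word only replaces \<open>v\<close> by \<open>Z\<^sup>\<beta> v\<close>; by continuity it kills \<open>\<Theta> g\<close> for every \<open>g\<close>
  (\<open>kernel_annihilates_range\<close>).

  \<^emph>\<open>Conversely, the points \<open>r L\<close> with \<open>r < 1\<close> already detect the range.\<close> Let \<open>h\<close> vanish on the
  singular points of \<open>\<theta>\<close>. If \<open>y\<close> is orthogonal to the range of \<open>\<theta>(r L)\<close>, then \<open>(r L, y)\<close> is a
  singular point at the infinite level, so \<open>y\<close> is orthogonal to \<open>h(r L) 1 = h\<^sub>r\<close>, the dilation
  \<open>h\<^sub>r(z) = h(r z)\<close>. Hence \<open>h\<^sub>r\<close> lies in the closure of the range of \<open>\<theta>(r L)\<close>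
  (\<open>dilation_in_closure_range\<close>). As \<open>r\<close> tends to \<open>1\<close>, \<open>h\<^sub>r\<close> tends to \<open>h\<close>. If moreover \<open>\<theta>(r L)\<close> tends
  to \<open>\<Theta>\<close> in operator norm, approximate preimages of \<open>h\<^sub>r\<close> stay bounded because \<open>\<Theta>\<close> is isometric, and
  \<open>h\<close> is in the closure of the range of \<open>\<Theta>\<close>, which is closed (\<open>mem_range_if_Sing_inf\<close>).

  \<^emph>\<open>Rationality gives the norm convergence.\<close> The operator norm of the homogeneous part of degree
  \<open>m\<close> of \<open>\<theta>(L)\<close> is at most its \<open>\<ell>\<^sup>2\<close> norm, so it suffices that these \<open>\<ell>\<^sup>2\<close> norms are summable over
  \<open>m\<close>. The right translates \<open>\<alpha> \<mapsto> \<theta>(\<alpha> \<gamma>)\<close> of a rational series span a finite-dimensional space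
  (\<open>nc_rational_finite_rank\<close>). In the Fock space, the energy of a vector in degrees at least \<open>m\<close>
  tends to \<open>0\<close>, uniformly on the unit ball of a finite-dimensional space. So for some \<open>m\<close> at most a
  quarter of the energy of each translate of \<open>\<theta>\<close> survives in degrees at least \<open>m\<close>; since
  tails of translates are again sums over translates, this iterates to geometric decay
  (\<open>finite_rank_summable_hom_norm\<close>).
\<close>

section \<open>Hilbert space geometry of square-summable families\<close>

lemmas coeff_simps [simp] = plus_ell2.rep_eq minus_ell2.rep_eq uminus_ell2.rep_eq
  zero_ell2.rep_eq scaleR_ell2.rep_eq unit_ell2.rep_eq

lemma coeff_cscale [simp]: "coeff (blinfun_apply (cscale c) x) i = c * coeff x i"
  by (simp add: cscale.rep_eq cscale_fun.rep_eq)

lemma ell2_eqI: "(\<And>i. coeff x i = coeff y i) \<Longrightarrow> x = y"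
  by (simp add: coeff_inject[symmetric] fun_eq_iff)

lemma coeff_sum [simp]: "coeff (sum f A) i = (\<Sum>a\<in>A. coeff (f a) i)"
  by (induction A rule: infinite_finite_induct) auto

lemma norm_cscale [simp]: "norm (blinfun_apply (cscale c) x) = cmod c * norm x"
  by (simp add: cscale.rep_eq norm_cscale_fun)

lemma norm_ell2_squared: "(norm x)\<^sup>2 = (\<Sum>\<^sub>\<infinity>i. (cmod (coeff x i))\<^sup>2)"
  unfolding norm_ell2_def by (intro real_sqrt_pow2 infsum_nonneg) simp

lemma sum_coeff_le_norm_squared:
  "finite F \<Longrightarrow> (\<Sum>i\<in>F. (cmod (coeff x i))\<^sup>2) \<le> (norm x)\<^sup>2"
  unfolding norm_ell2_squared by (intro finite_sum_le_infsum coeff_square_summable) auto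

lemma coeff_le_norm: "cmod (coeff x i) \<le> norm x"
  using sum_coeff_le_norm_squared[of "{i}" x] by (simp add: power2_le_iff_abs_le)

lemma square_summableI:
  fixes f :: "'i \<Rightarrow> complex"
  assumes "\<And>F. finite F \<Longrightarrow> (\<Sum>i\<in>F. (cmod (f i))\<^sup>2) \<le> C"
  shows "(\<lambda>i. (cmod (f i))\<^sup>2) summable_on UNIV"
  by (rule nonneg_bdd_above_summable_on) (auto intro!: bdd_aboveI[of _ C] assms)

lemma norm_ell2_leI:
  assumes "\<And>F. finite F \<Longrightarrow> (\<Sum>i\<in>F. (cmod (coeff x i))\<^sup>2) \<le> C\<^sup>2" "0 \<le> C"
  shows "norm x \<le> C"
proof -
  have "(norm x)\<^sup>2 \<le> C\<^sup>2"
    unfolding norm_ell2_squared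
    by (rule infsum_le_finite_sums[OF coeff_square_summable]) (use assms in auto)
  with assms(2) show ?thesis by (simp add: power2_le_iff_abs_le)
qed

lemma bounded_linear_coeff: "bounded_linear (\<lambda>x. coeff x i)"
  by (rule bounded_linear_intro[where K = 1]) (auto simp: coeff_le_norm scaleR_conv_of_real)

lemma cinner_add_right: "cinner x (y + z) = cinner x y + cinner x z"
  unfolding cinner_def infsum_add[OF cinner_summable cinner_summable, symmetric]
  by (simp add: algebra_simps)

lemma cinner_cscale_right: "cinner x (blinfun_apply (cscale c) y) = c * cinner x y"
  unfolding cinner_def infsum_cmult_right[OF cinner_summable, symmetric]
  by (simp add: algebra_simps)

lemma cinner_commute: "cinner y x = cnj (cinner x y)"
  unfolding cinner_def infsum_cnj[symmetric] by (simp add: algebra_simps)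

lemma cinner_cscale_left: "cinner (blinfun_apply (cscale c) x) y = cnj c * cinner x y"
  by (subst (1 2) cinner_commute) (simp add: cinner_cscale_right)

lemma cinner_self: "cinner x x = complex_of_real ((norm x)\<^sup>2)"
proof (rule complex_eqI)
  show "Re (cinner x x) = Re (complex_of_real ((norm x)\<^sup>2))"
    by (simp add: power2_norm_eq_inner inner_ell2_def)
  show "Im (cinner x x) = Im (complex_of_real ((norm x)\<^sup>2))"
    using arg_cong[OF cinner_commute[of x x], of Im] by (simp del: of_real_power)
qed

text \<open>
  The real inner product is the real part of the complex one, so the real Cauchy-Schwarz
  inequality applies once the second vector is rotated by a phase that makes \<open>cinner x y\<close> real.
\<close>

lemma cinner_Cauchy_Schwarz: "cmod (cinner x y) \<le> norm x * norm y"
proof -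
  obtain u where u: "cmod u = 1" "u * cinner x y = complex_of_real (cmod (cinner x y))"
  proof (cases "cinner x y = 0")
    case False
    let ?z = "cinner x y"
    have "cnj ?z * ?z = (complex_of_real (cmod ?z))\<^sup>2"
      by (simp only: of_real_power[symmetric] complex_norm_square mult.commute)
    with False show ?thesis
      by (intro that[of "cnj ?z / complex_of_real (cmod ?z)"])
        (auto simp: norm_divide power2_eq_square)
  qed (use that[of 1] in auto)
  have "cmod (cinner x y) = inner x (blinfun_apply (cscale u) y)"
    by (simp add: inner_ell2_def cinner_cscale_right u)
  also have "\<dots> \<le> norm x * norm (blinfun_apply (cscale u) y)"
    by (rule norm_cauchy_schwarz)
  finally show ?thesis by (simp add: u)
qed

lemma scaleR_eq_cscale: "r *\<^sub>R x = blinfun_apply (cscale (of_real r)) x"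
  by (rule ell2_eqI) simp

lemma bounded_linear_cinner: "bounded_linear (cinner y)"
  by (rule bounded_linear_intro[where K = "norm y"])
    (simp_all add: cinner_add_right scaleR_eq_cscale cinner_cscale_right scaleR_conv_of_real
      cinner_Cauchy_Schwarz mult.commute,
     metis cinner_Cauchy_Schwarz mult.commute)

lemma cinner_unit: "cinner (unit_ell2 i) x = coeff x i"
proof -
  have "cinner (unit_ell2 i) x = (\<Sum>\<^sub>\<infinity>j\<in>{i}. coeff x j)"
    unfolding cinner_def by (rule infsum_cong_neutral) auto
  then show ?thesis by simp
qed

lemma cinner_ext: "(\<And>x. cinner x y = cinner x z) \<Longrightarrow> y = z"
  by (rule ell2_eqI) (metis cinner_unit)

text \<open>
  A Cauchy sequence converges in every coordinate; bounds on finite partial sums of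
  squares pass to the coordinatewise limit, which is therefore square-summable and a norm limit.
\<close>

instance ell2 :: (type) complete_space
proof
  fix X :: "nat \<Rightarrow> 'a ell2"
  assume X: "Cauchy X"
  have "convergent (\<lambda>n. coeff (X n) i)" for i
    by (intro Cauchy_convergent bounded_linear.Cauchy[OF bounded_linear_coeff X])
  then obtain l where l: "\<And>i. (\<lambda>n. coeff (X n) i) \<longlonglongrightarrow> l i"
    unfolding convergent_def by metis
  have close: "\<exists>N. \<forall>n\<ge>N. \<forall>F. finite F \<longrightarrow> (\<Sum>i\<in>F. (cmod (coeff (X n) i - l i))\<^sup>2) \<le> e\<^sup>2"
    if e: "e > 0" for e :: real
  proof -
    obtain N where N: "\<And>m n. m \<ge> N \<Longrightarrow> n \<ge> N \<Longrightarrow> norm (X m - X n) < e"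
      using X e unfolding Cauchy_iff by blast
    have "(\<Sum>i\<in>F. (cmod (coeff (X n) i - l i))\<^sup>2) \<le> e\<^sup>2" if F: "finite F" and n: "n \<ge> N" for F n
    proof (rule LIMSEQ_le_const2)
      show "(\<lambda>m. \<Sum>i\<in>F. (cmod (coeff (X n) i - coeff (X m) i))\<^sup>2)
          \<longlonglongrightarrow> (\<Sum>i\<in>F. (cmod (coeff (X n) i - l i))\<^sup>2)"
        by (intro tendsto_intros l)
      have "(\<Sum>i\<in>F. (cmod (coeff (X n) i - coeff (X m) i))\<^sup>2) \<le> e\<^sup>2" if "m \<ge> N" for m
      proof -
        have "(\<Sum>i\<in>F. (cmod (coeff (X n - X m) i))\<^sup>2) \<le> (norm (X n - X m))\<^sup>2"
          by (rule sum_coeff_le_norm_squared[OF F])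
        also have "\<dots> \<le> e\<^sup>2" using N[OF n that] by (intro power_mono) auto
        finally show ?thesis by simp
      qed
      then show "\<exists>N. \<forall>m\<ge>N. (\<Sum>i\<in>F. (cmod (coeff (X n) i - coeff (X m) i))\<^sup>2) \<le> e\<^sup>2" by blast
    qed
    then show ?thesis by blast
  qed
  obtain N where "\<And>F. finite F \<Longrightarrow> (\<Sum>i\<in>F. (cmod (coeff (X N) i - l i))\<^sup>2) \<le> 1\<^sup>2"
    using close[of 1] by auto
  then have "(\<lambda>i. (cmod (coeff (X N) i - l i))\<^sup>2) summable_on UNIV" by (rule square_summableI)
  then have D: "coeff (Abs_ell2 (\<lambda>i. coeff (X N) i - l i)) i = coeff (X N) i - l i" for i
    by (simp add: Abs_ell2_inverse)
  define L where "L = X N - Abs_ell2 (\<lambda>i. coeff (X N) i - l i)"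
  have L: "coeff L i = l i" for i by (simp add: L_def D)
  have "X \<longlonglongrightarrow> L"
  proof (rule LIMSEQ_I)
    fix e :: real assume e: "e > 0"
    obtain M where M: "\<And>n F. n \<ge> M \<Longrightarrow> finite F \<Longrightarrow> (\<Sum>i\<in>F. (cmod (coeff (X n) i - l i))\<^sup>2) \<le> (e/2)\<^sup>2"
      using close[of "e/2"] e by auto
    have "norm (X n - L) < e" if "n \<ge> M" for n
    proof -
      have "norm (X n - L) \<le> e/2"
        by (rule norm_ell2_leI) (use M[OF that] e in \<open>auto simp: L\<close>)
      with e show ?thesis by simp
    qed
    then show "\<exists>no. \<forall>n\<ge>no. norm (X n - L) < e" by blast
  qed
  then show "convergent X" by (auto simp: convergent_def)
qed

instance ell2 :: (type) banach ..

lemma unit_expansion: "((\<lambda>i. blinfun_apply (cscale (coeff x i)) (unit_ell2 i)) has_sum x) UNIV"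
  unfolding has_sum_def tendsto_iff eventually_finite_subsets_at_top
proof (intro allI impI)
  fix e :: real assume e: "e > 0"
  let ?g = "\<lambda>i. (cmod (coeff x i))\<^sup>2"
  have "(?g has_sum (norm x)\<^sup>2) UNIV"
    unfolding norm_ell2_squared by (intro has_sum_infsum coeff_square_summable)
  then obtain F0 where F0: "finite F0"
      "\<And>F. finite F \<Longrightarrow> F0 \<subseteq> F \<Longrightarrow> dist (sum ?g F) ((norm x)\<^sup>2) < e\<^sup>2"
    unfolding has_sum_def tendsto_iff eventually_finite_subsets_at_top
    using e by (meson zero_less_power subset_UNIV)
  show "\<exists>X. finite X \<and> X \<subseteq> UNIV \<and> (\<forall>Y. finite Y \<and> X \<subseteq> Y \<and> Y \<subseteq> UNIV \<longrightarrow>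
      dist (\<Sum>i\<in>Y. blinfun_apply (cscale (coeff x i)) (unit_ell2 i)) x < e)"
  proof (intro exI[of _ F0] conjI allI impI F0(1) subset_UNIV)
    fix F assume F: "finite F \<and> F0 \<subseteq> F \<and> F \<subseteq> UNIV"
    let ?s = "\<Sum>i\<in>F. blinfun_apply (cscale (coeff x i)) (unit_ell2 i)"
    have s: "coeff ?s j = (if j \<in> F then coeff x j else 0)" for j
      using F by (simp add: if_distrib cong: if_cong)
    have "(norm (x - ?s))\<^sup>2 = infsum ?g (UNIV - F)"
      unfolding norm_ell2_squared by (rule infsum_cong_neutral) (auto simp: s simp del: coeff_sum)
    also have "\<dots> = (norm x)\<^sup>2 - sum ?g F"
      using F by (subst infsum_Diff) (auto simp: coeff_square_summable norm_ell2_squared)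
    also have "\<dots> < e\<^sup>2" using F0(2)[of F] F by (auto simp: dist_real_def)
    finally have "norm (x - ?s) < e" using e by (simp add: power_less_imp_less_base)
    then show "dist ?s x < e" by (simp add: dist_norm norm_minus_commute)
  qed
qed

text \<open>
  Only real linearity is available from \<open>bounded_linear\<close>, hence the complex
  multiples of the unit vectors in the hypothesis.
\<close>

lemma bounded_linear_eq_0_if_units:
  fixes \<phi> :: "'i ell2 \<Rightarrow> 'b::{real_normed_vector}"
  assumes "bounded_linear \<phi>" "\<And>c i. \<phi> (blinfun_apply (cscale c) (unit_ell2 i)) = 0"
  shows "\<phi> x = 0"
proof -
  have "((\<lambda>i. \<phi> (blinfun_apply (cscale (coeff x i)) (unit_ell2 i))) has_sum \<phi> x) UNIV"
    using has_sum_bounded_linear[OF assms(1) unit_expansion[of x]] by (simp add: o_def)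
  then have "((\<lambda>i::'i. 0) has_sum \<phi> x) UNIV" by (simp add: assms(2))
  then show ?thesis using has_sum_unique[OF _ has_sum_0] by blast
qed

text \<open>
  The nearest point
  of \<open>S\<close> exists by completeness: the parallelogram law makes every minimizing sequence Cauchy,
  and the difference between \<open>x\<close> and its nearest point is orthogonal to \<open>S\<close>.
\<close>

lemma orthogonal_separation:
  fixes S :: "'a::{real_inner, complete_space} set"
  assumes S: "real_vector.subspace S" "closed S" and x: "x \<notin> S"
  obtains y where "\<And>s. s \<in> S \<Longrightarrow> inner y s = 0" "inner y x \<noteq> 0"
proof -
  define d where "d = infdist x S"
  have ne: "S \<noteq> {}" using real_vector.subspace_0[OF S(1)] by blast
  have dle: "d \<le> norm (x - s)" if "s \<in> S" for s
    unfolding d_def dist_norm[symmetric] by (rule infdist_le[OF that])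
  have d0: "d \<ge> 0" by (simp add: d_def infdist_nonneg)
  have "\<exists>s\<in>S. norm (x - s) < d + 1 / Suc n" for n :: nat
  proof -
    have "infdist x S < d + 1 / Suc n" by (simp add: d_def)
    then show ?thesis
      unfolding infdist_notempty[OF ne] dist_norm by (subst (asm) cINF_less_iff) (use ne in \<open>auto intro!: bdd_belowI[of _ 0]\<close>)
  qed
  then obtain s where s: "\<And>n. s n \<in> S" "\<And>n::nat. norm (x - s n) < d + 1 / Suc n" by metis
  \<comment> \<open>the midpoint of \<open>s m\<close> and \<open>s n\<close> is in \<open>S\<close>, so it is at distance at least \<open>d\<close> from \<open>x\<close>\<close>
  have bnd: "(norm (s m - s n))\<^sup>2 \<le> (8 * d + 4) / Suc N" if "m \<ge> N" "n \<ge> N" for m n N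
  proof -
    let ?q = "1 / real (Suc N)"
    have q: "norm (x - s k) \<le> d + ?q" if "k \<ge> N" for k
    proof -
      have "1 / real (Suc k) \<le> ?q" using that by (intro divide_left_mono) auto
      with s(2)[of k] show ?thesis by simp
    qed
    have sq: "(norm (x - s k))\<^sup>2 \<le> (d + ?q)\<^sup>2" if "k \<ge> N" for k
      using q[OF that] by (intro power_mono) auto
    have "(1/2) *\<^sub>R (s m + s n) \<in> S" by (intro real_vector.subspace_scale real_vector.subspace_add S(1) s(1))
    from dle[OF this] have "(2 * d)\<^sup>2 \<le> (2 * norm (x - (1/2) *\<^sub>R (s m + s n)))\<^sup>2"
      using d0 by (intro power_mono) auto
    also have "2 * norm (x - (1/2) *\<^sub>R (s m + s n)) = norm ((x - s m) + (x - s n))"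
    proof -
      have "(x - s m) + (x - s n) = 2 *\<^sub>R (x - (1/2) *\<^sub>R (s m + s n))"
        by (simp add: scaleR_diff_right scaleR_2 algebra_simps)
      then show ?thesis by simp
    qed
    finally have a: "4 * d\<^sup>2 \<le> (norm ((x - s m) + (x - s n)))\<^sup>2" by (simp add: power_mult_distrib)
    have "(norm ((x - s m) + (x - s n)))\<^sup>2 + (norm ((x - s m) - (x - s n)))\<^sup>2
        = 2 * (norm (x - s m))\<^sup>2 + 2 * (norm (x - s n))\<^sup>2"
      by (simp add: power2_norm_eq_inner inner_simps inner_commute)
    with a sq[OF that(1)] sq[OF that(2)] have "(norm ((x - s m) - (x - s n)))\<^sup>2 \<le> 4 * (d + ?q)\<^sup>2 - 4 * d\<^sup>2"
      by linarith
    also have "\<dots> = 8 * d * ?q + 4 * ?q * ?q" by (simp add: power2_eq_square algebra_simps)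
    also have "\<dots> \<le> 8 * d * ?q + 4 * ?q" by (intro add_left_mono mult_left_le) auto
    also have "\<dots> = (8 * d + 4) / Suc N"
      by (simp only: add_divide_distrib mult_1_right times_divide_eq_right)
    finally show ?thesis by (simp add: norm_minus_commute)
  qed
  have "Cauchy s"
    unfolding Cauchy_iff
  proof (intro allI impI)
    fix e :: real assume e: "e > 0"
    have "(\<lambda>N. (8 * d + 4) / real (Suc N)) \<longlonglongrightarrow> 0"
      using LIMSEQ_Suc[OF lim_const_over_n[of "8 * d + 4"]] by simp
    then have "\<forall>\<^sub>F N in sequentially. (8 * d + 4) / real (Suc N) < e\<^sup>2"
      by (rule order_tendstoD(2)) (use e in simp)
    then obtain N where N: "(8 * d + 4) / real (Suc N) < e\<^sup>2"
      unfolding eventually_sequentially by blast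
    have "norm (s m - s n) < e" if "m \<ge> N" "n \<ge> N" for m n
    proof (rule power_less_imp_less_base)
      show "(norm (s m - s n))\<^sup>2 < e\<^sup>2" by (rule order_le_less_trans[OF bnd[OF that] N])
    qed (use e in simp)
    then show "\<exists>M. \<forall>m\<ge>M. \<forall>n\<ge>M. norm (s m - s n) < e" by blast
  qed
  then obtain t where t: "s \<longlonglongrightarrow> t" using Cauchy_convergent convergent_def by blast
  have tS: "t \<in> S" using closed_sequentially[OF S(2)] s(1) t by blast
  define y where "y = x - t"
  have "(\<lambda>n. d + 1 / real (Suc n)) \<longlonglongrightarrow> d + 0"
    using LIMSEQ_Suc[OF lim_const_over_n[of "1::real"]] by (intro tendsto_add tendsto_const) simp
  then have yd: "norm y \<le> d"
    unfolding y_def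
    by (intro LIMSEQ_le[where X = "\<lambda>n. norm (x - s n)" and Y = "\<lambda>n. d + 1 / real (Suc n)"] tendsto_intros t)
      (use s(2) in \<open>auto intro: less_imp_le\<close>)
  have orth: "inner y v = 0" if v: "v \<in> S" for v
  proof (rule ccontr)
    assume nz: "inner y v \<noteq> 0"
    then have v0: "inner v v > 0" by auto
    \<comment> \<open>moving from the nearest point along \<open>v\<close> by this step would decrease the distance\<close>
    define c where "c = inner y v / inner v v"
    have "norm y \<le> norm (x - (t + c *\<^sub>R v))"
      using yd dle[OF real_vector.subspace_add[OF S(1) tS real_vector.subspace_scale[OF S(1) v, of c]]] by linarith
    then have "(norm y)\<^sup>2 \<le> (norm (y - c *\<^sub>R v))\<^sup>2"
      by (intro power_mono) (simp_all add: y_def diff_diff_add)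
    also have "\<dots> = (norm y)\<^sup>2 - (inner y v)\<^sup>2 / inner v v"
    proof -
      have "(norm (y - c *\<^sub>R v))\<^sup>2 = inner y y - 2 * c * inner y v + c * c * inner v v"
        by (simp add: power2_norm_eq_inner inner_diff_left inner_diff_right inner_commute[of v y] algebra_simps)
      also have "\<dots> = inner y y - (inner y v)\<^sup>2 / inner v v"
        using v0 by (simp add: c_def power2_eq_square)
      finally show ?thesis by (simp add: power2_norm_eq_inner)
    qed
    finally show False using nz v0 by (simp add: divide_le_0_iff)
  qed
  have "inner y x = inner y y + inner y t" by (simp add: y_def inner_simps)
  also have "\<dots> = inner y y" using orth[OF tS] by simp
  also have "\<dots> \<noteq> 0" using tS x by (auto simp: y_def)
  finally show thesis using that orth by blast
qed

lemma clinear_op_apply: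
  "clinear_op A \<Longrightarrow> blinfun_apply A (blinfun_apply (cscale c) x) = blinfun_apply (cscale c) (blinfun_apply A x)"
  unfolding clinear_op_def by (metis blinfun_apply_blinfun_compose)

text \<open>
  The adjoint of \<open>A\<close> at \<open>y\<close> has the coordinates \<open>\<langle>A e\<^sub>i, y\<rangle>\<close>. They are square-summable
  because testing \<open>A\<close> on the finite truncation \<open>x\<close> of this very family gives
  \<open>\<parallel>x\<parallel>\<^sup>2 = \<langle>y, A x\<rangle> \<le> \<parallel>A\<parallel> \<parallel>x\<parallel> \<parallel>y\<parallel>\<close>.
\<close>

lemma adjoint_exists:
  assumes A: "clinear_op A"
  shows "\<exists>B. \<forall>x y. cinner (blinfun_apply A x) y = cinner x (blinfun_apply B y)"
proof -
  define b where "b y i = cinner (blinfun_apply A (unit_ell2 i)) y" for y i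
  have bound: "(\<Sum>i\<in>F. (cmod (b y i))\<^sup>2) \<le> (norm A * norm y)\<^sup>2" if F: "finite F" for F y
  proof -
    define q where "q = (\<Sum>i\<in>F. (cmod (b y i))\<^sup>2)"
    have q0: "q \<ge> 0" unfolding q_def by (intro sum_nonneg) auto
    define x where "x = (\<Sum>i\<in>F. blinfun_apply (cscale (b y i)) (unit_ell2 i))"
    have xc: "coeff x j = (if j \<in> F then b y j else 0)" for j
      using F by (simp add: x_def if_distrib cong: if_cong)
    have nx: "(norm x)\<^sup>2 = q"
    proof -
      have "(norm x)\<^sup>2 = infsum (\<lambda>i. (cmod (b y i))\<^sup>2) F"
        unfolding norm_ell2_squared by (rule infsum_cong_neutral) (auto simp: xc)
      then show ?thesis using F by (simp add: q_def)
    qed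
    have "cinner y (blinfun_apply A x) = (\<Sum>i\<in>F. b y i * cinner y (blinfun_apply A (unit_ell2 i)))"
      unfolding x_def blinfun.sum_right linear_sum[OF bounded_linear.linear[OF bounded_linear_cinner]]
      by (simp add: clinear_op_apply[OF A] cinner_cscale_right)
    also have "\<dots> = (\<Sum>i\<in>F. complex_of_real ((cmod (b y i))\<^sup>2))"
      by (intro sum.cong refl) (simp add: b_def complex_norm_square cinner_commute[of y] del: of_real_power)
    finally have "cinner y (blinfun_apply A x) = complex_of_real q" by (simp add: q_def)
    then have "q = cmod (cinner y (blinfun_apply A x))" using q0 by simp
    also have "\<dots> \<le> norm y * norm (blinfun_apply A x)" by (rule cinner_Cauchy_Schwarz)
    also have "\<dots> \<le> norm y * (norm A * norm x)" by (intro mult_left_mono norm_blinfun) auto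
    finally have "(norm x)\<^sup>2 \<le> (norm A * norm y) * norm x" by (simp add: nx mult_ac)
    then have "norm x \<le> norm A * norm y"
      by (cases "norm x = 0") (simp_all add: power2_eq_square mult_le_cancel_right)
    then have "(norm x)\<^sup>2 \<le> (norm A * norm y)\<^sup>2" by (intro power_mono) auto
    then show ?thesis by (simp add: nx q_def)
  qed
  define B where "B y = Abs_ell2 (b y)" for y
  have B: "coeff (B y) i = b y i" for y i
    unfolding B_def by (subst Abs_ell2_inverse) (auto intro!: square_summableI bound)
  have "bounded_linear B"
  proof (rule bounded_linear_intro[where K = "norm A"])
    show "B (x + y) = B x + B y" for x y by (rule ell2_eqI) (simp add: B b_def cinner_add_right)
    show "B (r *\<^sub>R x) = r *\<^sub>R B x" for r x
      by (rule ell2_eqI) (simp add: B b_def scaleR_eq_cscale cinner_cscale_right)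
    show "norm (B x) \<le> norm x * norm A" for x
      by (rule norm_ell2_leI) (use bound[of _ x] in \<open>auto simp: B mult.commute\<close>)
  qed
  moreover have "cinner (blinfun_apply A x) y = cinner x (B y)" for x y
  proof -
    have "((\<lambda>i. cinner y (blinfun_apply A (blinfun_apply (cscale (coeff x i)) (unit_ell2 i))))
        has_sum cinner y (blinfun_apply A x)) UNIV"
      using has_sum_bounded_linear[OF bounded_linear_compose[OF bounded_linear_cinner[of y]
        blinfun.bounded_linear_right[of A]] unit_expansion[of x]] by (simp add: o_def)
    also have "(\<lambda>i. cinner y (blinfun_apply A (blinfun_apply (cscale (coeff x i)) (unit_ell2 i))))
        = (\<lambda>i. cnj (coeff (B y) i) * coeff x i)"
      by (simp add: fun_eq_iff clinear_op_apply[OF A] cinner_cscale_right B b_def cinner_commute[of y "blinfun_apply A _"])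
    finally have "cinner y (blinfun_apply A x) = cinner (B y) x"
      unfolding cinner_def[of "B y"] by (simp add: infsumI)
    then show ?thesis
      by (simp add: cinner_commute[of y "blinfun_apply A x"] cinner_commute[of "B y" x] complex_cnj_cancel_iff)
  qed
  ultimately show ?thesis
    by (intro exI[of _ "Blinfun B"]) (simp add: bounded_linear_Blinfun_apply)
qed

lemma cadjoint_eqI:
  assumes "\<And>x y. cinner (blinfun_apply A x) y = cinner x (blinfun_apply B y)"
  shows "cadjoint A = B"
  unfolding cadjoint_def
proof (rule the_equality)
  fix C assume "\<forall>x y. cinner (blinfun_apply A x) y = cinner x (blinfun_apply C y)"
  then show "C = B" using assms by (intro blinfun_eqI cinner_ext) simp
qed (use assms in blast)

lemma cinner_cadjoint:
  assumes "clinear_op A"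
  shows "cinner (blinfun_apply A x) y = cinner x (blinfun_apply (cadjoint A) y)"
proof -
  obtain B where B: "\<And>x y. cinner (blinfun_apply A x) y = cinner x (blinfun_apply B y)"
    using adjoint_exists[OF assms] by blast
  then have "cadjoint A = B" by (rule cadjoint_eqI)
  then show ?thesis by (simp add: B)
qed

section \<open>Words and convolution\<close>

text \<open>
  The product of formal power series in noncommuting variables: a word is split in all
  possible ways into a prefix and a suffix.
\<close>

definition conv :: "('a list \<Rightarrow> complex) \<Rightarrow> ('a list \<Rightarrow> complex) \<Rightarrow> 'a list \<Rightarrow> complex" where
  "conv F G w = (\<Sum>i\<le>length w. F (take i w) * G (drop i w))"

definition word_delta :: "'a list \<Rightarrow> 'a list \<Rightarrow> complex" where
  "word_delta \<alpha> w = (if w = \<alpha> then 1 else 0)"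

lemma conv_Nil [simp]: "conv F G [] = F [] * G []"
  by (simp add: conv_def)

text \<open>
  The recursion on the first letter that drives the inductive proofs below; its mirror image
  \<open>conv_snoc\<close> describes right translates of a product.
\<close>

lemma conv_Cons: "conv F G (a # w) = F [] * G (a # w) + conv (\<lambda>v. F (a # v)) G w"
  by (simp add: conv_def sum.atMost_Suc_shift del: sum.atMost_Suc)

lemma conv_snoc: "conv F G (w @ [k]) = conv F (\<lambda>v. G (v @ [k])) w + F (w @ [k]) * G []"
  by (simp add: conv_def)

lemma conv_add_left: "conv (\<lambda>v. F v + F' v) G w = conv F G w + conv F' G w"
  by (simp add: conv_def algebra_simps sum.distrib)

lemma conv_add_right: "conv F (\<lambda>v. G v + G' v) w = conv F G w + conv F G' w"
  by (simp add: conv_def algebra_simps sum.distrib)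

lemma conv_scale_left: "conv (\<lambda>v. c * F v) G w = c * conv F G w"
  by (simp add: conv_def sum_distrib_left mult_ac)

lemma conv_scale_right: "conv F (\<lambda>v. c * G v) w = c * conv F G w"
  by (simp add: conv_def sum_distrib_left mult_ac)

lemma conv_zero_left: "conv (\<lambda>v. 0) G w = 0"
  by (simp add: conv_def)

lemma conv_assoc: "conv (conv F G) H w = conv F (conv G H) w"
proof (induction w arbitrary: F)
  case (Cons a w)
  have "conv (conv F G) H (a # w)
      = F [] * G [] * H (a # w) + (F [] * conv (\<lambda>v. G (a # v)) H w + conv (conv (\<lambda>v. F (a # v)) G) H w)"
    by (simp add: conv_Cons conv_add_left conv_scale_left)
  also have "\<dots> = conv F (conv G H) (a # w)"
    by (simp add: conv_Cons Cons.IH algebra_simps)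
  finally show ?case .
qed simp

lemma conv_delta_Nil: "conv (word_delta []) G w = G w"
  by (cases w) (simp_all add: conv_Cons conv_zero_left word_delta_def)

lemma conv_delta_singleton_Cons: 
  "conv (word_delta [k]) G w = (case w of [] \<Rightarrow> 0 | a # v \<Rightarrow> if a = k then G v else 0)"
proof (cases w)
  case (Cons a v)
  have "(\<lambda>v. word_delta [k] (a # v)) = (\<lambda>v. (if a = k then 1 else 0) * word_delta [] v)"
    by (auto simp: word_delta_def fun_eq_iff)
  then show ?thesis
    by (simp add: Cons conv_Cons conv_scale_left conv_delta_Nil del: mult_if_delta)
      (simp add: word_delta_def)
qed (simp add: word_delta_def)

lemma conv_delta_delta: "conv (word_delta [k]) (word_delta \<alpha>) = word_delta (k # \<alpha>)"
  by (auto simp: conv_delta_singleton_Cons word_delta_def fun_eq_iff split: list.split)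

lemma conv_delta_right_append: "conv F (word_delta \<beta>) (\<alpha> @ \<beta>) = F \<alpha>"
proof -
  have "conv F (word_delta \<beta>) (\<alpha> @ \<beta>) = (\<Sum>i\<in>{length \<alpha>}. F \<alpha>)"
    unfolding conv_def
  proof (rule sum.mono_neutral_cong_right)
    show "\<forall>i\<in>{..length (\<alpha> @ \<beta>)} - {length \<alpha>}. F (take i (\<alpha> @ \<beta>)) * word_delta \<beta> (drop i (\<alpha> @ \<beta>)) = 0"
    proof
      fix i assume i: "i \<in> {..length (\<alpha> @ \<beta>)} - {length \<alpha>}"
      then have "length (drop i (\<alpha> @ \<beta>)) \<noteq> length \<beta>" by auto
      then have "drop i (\<alpha> @ \<beta>) \<noteq> \<beta>" by metis
      then show "F (take i (\<alpha> @ \<beta>)) * word_delta \<beta> (drop i (\<alpha> @ \<beta>)) = 0"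
        by (simp only: word_delta_def if_False mult_zero_right)
    qed
  qed (auto simp: word_delta_def)
  then show ?thesis by simp
qed

lemma conv_delta_right_Nil: "conv F (word_delta []) w = F w"
  using conv_delta_right_append[of F "[]" w] by simp

lemma conv_delta_right_not_suffix:
  assumes "w \<notin> range (\<lambda>\<alpha>. \<alpha> @ \<beta>)"
  shows "conv F (word_delta \<beta>) w = 0"
  unfolding conv_def
proof (rule sum.neutral, intro ballI)
  fix i
  have "drop i w \<noteq> \<beta>" using assms by (metis append_take_drop_id rangeI)
  then show "F (take i w) * word_delta \<beta> (drop i w) = 0" by (simp add: word_delta_def)
qed

lemma conv_homogeneous_left:
  "conv (\<lambda>\<alpha>. if length \<alpha> = m then F \<alpha> else 0) G w
    = (if m \<le> length w then F (take m w) * G (drop m w) else 0)"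
proof -
  have "conv (\<lambda>\<alpha>. if length \<alpha> = m then F \<alpha> else 0) G w
      = (\<Sum>i\<le>length w. if i = m then F (take i w) * G (drop i w) else 0)"
    unfolding conv_def by (intro sum.cong) auto
  then show ?thesis by simp
qed

section \<open>Sums over words, graded by length\<close>

lemma finite_words [simp]: "finite {\<alpha> :: 'd::finite list. length \<alpha> = m}"
  using finite_lists_length_eq[of "UNIV :: 'd set" m] by simp

lemma sum_words_Suc:
  "(\<Sum>\<alpha>\<in>{\<alpha> :: 'd::finite list. length \<alpha> = Suc m}. f \<alpha>)
    = (\<Sum>k\<in>UNIV. \<Sum>\<alpha>\<in>{\<alpha>. length \<alpha> = m}. f (k # \<alpha>))"
proof -
  have "bij_betw (\<lambda>(k, \<alpha>). k # \<alpha>) (UNIV \<times> {\<alpha> :: 'd list. length \<alpha> = m}) {\<alpha>. length \<alpha> = Suc m}"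
    by (rule bij_betw_byWitness[where f' = "\<lambda>\<alpha>. (hd \<alpha>, tl \<alpha>)"]) (auto simp: length_Suc_conv)
  from sum.reindex_bij_betw[OF this, of f] show ?thesis
    by (simp add: sum.cartesian_product case_prod_beta)
qed

lemma sum_words_add:
  "(\<Sum>\<alpha>\<in>{\<alpha> :: 'd::finite list. length \<alpha> = m + n}. f \<alpha>)
    = (\<Sum>\<alpha>\<in>{\<alpha>. length \<alpha> = m}. \<Sum>\<beta>\<in>{\<beta>. length \<beta> = n}. f (\<alpha> @ \<beta>))"
proof -
  have "bij_betw (\<lambda>(\<alpha>, \<beta>). \<alpha> @ \<beta>) ({\<alpha>. length \<alpha> = m} \<times> {\<beta> :: 'd list. length \<beta> = n}) {\<alpha>. length \<alpha> = m + n}"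
    by (rule bij_betw_byWitness[where f' = "\<lambda>\<alpha>. (take m \<alpha>, drop m \<alpha>)"]) auto
  from sum.reindex_bij_betw[OF this, of f] show ?thesis
    by (simp add: sum.cartesian_product case_prod_beta)
qed

lemma sums_by_length:
  fixes F :: "'d::finite list \<Rightarrow> 'b::real_normed_vector"
  assumes "(F has_sum S) UNIV"
  shows "(\<lambda>m. \<Sum>\<alpha>\<in>{\<alpha>. length \<alpha> = m}. F \<alpha>) sums S"
proof -
  have "bij_betw (\<lambda>(m, \<alpha>). \<alpha>) (Sigma UNIV (\<lambda>m. {\<alpha> :: 'd list. length \<alpha> = m})) UNIV"
    by (rule bij_betw_byWitness[where f' = "\<lambda>\<alpha>. (length \<alpha>, \<alpha>)"]) auto
  from has_sum_reindex_bij_betw[OF this, of F S] assms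
  have "((\<lambda>(m, \<alpha>). F \<alpha>) has_sum S) (Sigma UNIV (\<lambda>m. {\<alpha>. length \<alpha> = m}))"
    by (simp add: case_prod_unfold)
  then have "((\<lambda>m. \<Sum>\<alpha>\<in>{\<alpha>. length \<alpha> = m}. F \<alpha>) has_sum S) UNIV"
    by (rule has_sum_SigmaD) (auto intro!: has_sum_finiteI)
  then show ?thesis by (rule has_sum_imp_sums)
qed

section \<open>The multiplier algebra acts by convolution\<close>

lemma coeff_vacuum: "coeff vacuum = word_delta []"
  by (auto simp: vacuum_def word_delta_def fun_eq_iff)

lemma coeff_lshift: "coeff (blinfun_apply (lshift k) x) w = (case w of [] \<Rightarrow> 0 | a # v \<Rightarrow> if a = k then coeff x v else 0)"
  by (simp add: lshift.rep_eq lshift_fun.rep_eq)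

text \<open>
  The operators that act by convolution with their symbol form a unital algebra
  containing the creation operators. It is closed in the weak operator topology because the
  condition equates two finite combinations of matrix entries, which are continuous functions of the
  operator. So it contains the smallest such algebra.
\<close>

lemma Hinf_apply:
  fixes F :: "'d fock_op"
  assumes "F \<in> Hinf"
  shows "coeff (blinfun_apply F x) = conv (coeff (symbol F)) (coeff x)"
proof -
  define \<A> :: "'d fock_op set" where "\<A> = {A. \<forall>x w. coeff (blinfun_apply A x) w
    = conv (coeff (blinfun_apply A vacuum)) (coeff x) w}"
  have AI: "A \<in> \<A>" if "\<And>x w. coeff (blinfun_apply A x) w = conv f (coeff x) w" for A f
  proof -
    have "coeff (blinfun_apply A vacuum) = f"
      by (rule ext) (simp add: that coeff_vacuum conv_delta_right_Nil)
    then show ?thesis by (simp add: \<A>_def that)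
  qed
  have AD: "\<exists>f. \<forall>x. coeff (blinfun_apply A x) = conv f (coeff x)" if "A \<in> \<A>" for A
    using that unfolding \<A>_def fun_eq_iff by blast
  have "unital_op_algebra \<A>"
    unfolding unital_op_algebra_def
  proof (intro conjI allI ballI)
    show "id_blinfun \<in> \<A>" by (rule AI[where f = "word_delta []"]) (simp add: conv_delta_Nil)
    fix A assume "A \<in> \<A>"
    then obtain f where f: "\<And>x. coeff (blinfun_apply A x) = conv f (coeff x)" using AD by blast
    show "cscale c o\<^sub>L A \<in> \<A>" for c
      by (rule AI[where f = "\<lambda>w. c * f w"]) (simp add: f conv_scale_left)
    fix B assume "B \<in> \<A>"
    then obtain g where g: "\<And>x. coeff (blinfun_apply B x) = conv g (coeff x)" using AD by blast
    show "A + B \<in> \<A>"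
      by (rule AI[where f = "\<lambda>w. f w + g w"]) (simp add: f g conv_add_left blinfun.add_left)
    show "A o\<^sub>L B \<in> \<A>"
      by (rule AI[where f = "conv f g"]) (simp add: f g conv_assoc)
  qed
  moreover have "closedin weak_operator_topology \<A>"
  proof -
    define \<phi> :: "'d fock_op \<Rightarrow> 'd fock \<times> 'd fock \<Rightarrow> complex"
      where "\<phi> = (\<lambda>A (y, x). cinner y (blinfun_apply A x))"
    define C :: "('d fock \<times> 'd fock \<Rightarrow> complex) set" where
      "C = {h. \<forall>x w. h (unit_ell2 w, x)
        = (\<Sum>i\<le>length w. h (unit_ell2 (take i w), vacuum) * coeff x (drop i w))}"
    have "closed C"
      unfolding C_def
      by (intro closed_Collect_all closed_Collect_eq continuous_intros continuous_on_product_coordinates)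
    moreover have "continuous_map weak_operator_topology euclidean \<phi>"
      using continuous_map_pullback[of euclidean euclidean id UNIV \<phi>]
      by (simp add: weak_operator_topology_def \<phi>_def)
    moreover have "\<A> = {A \<in> topspace weak_operator_topology. \<phi> A \<in> C}"
      by (simp add: \<A>_def C_def \<phi>_def cinner_unit conv_def weak_operator_topology_def
        topspace_pullback_topology)
    ultimately show ?thesis
      using closedin_continuous_map_preimage[of weak_operator_topology euclidean \<phi> C]
      by (simp only: closed_closedin[symmetric])
  qed
  moreover have "range lshift \<subseteq> \<A>"
  proof (rule image_subsetI)
    show "lshift k \<in> \<A>" for k
      by (rule AI[where f = "word_delta [k]"]) (simp add: coeff_lshift conv_delta_singleton_Cons)
  qed
  ultimately have "Hinf \<subseteq> \<A>" unfolding Hinf_def by (intro hull_minimal) auto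
  with assms have "F \<in> \<A>" by blast
  then show ?thesis unfolding \<A>_def symbol_def fun_eq_iff by blast
qed

section \<open>Square-summable kernels on words\<close>

lemma has_sum_finite_sum:
  fixes f :: "'a \<Rightarrow> 'b \<Rightarrow> 'c::topological_comm_monoid_add"
  assumes "\<And>a. a \<in> A \<Longrightarrow> (f a has_sum s a) B"
  shows "((\<lambda>x. \<Sum>a\<in>A. f a x) has_sum (\<Sum>a\<in>A. s a)) B"
  using assms by (induction A rule: infinite_finite_induct) (auto intro!: has_sum_add has_sum_0)

text \<open>
  One contraction step multiplies the total energy of an orbit by at most \<open>c\<close>; the bound
  for words of length \<open>m\<close> iterates it, peeling off the first letter.
\<close>

lemma word_orbit_bound:
  fixes T :: "'d::finite \<Rightarrow> 'v \<Rightarrow> 'v" and N :: "'v \<Rightarrow> real"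
  assumes "\<And>y. (\<Sum>j\<in>UNIV. N (T j y)) \<le> c * N y" "0 \<le> c"
  shows "(\<Sum>\<alpha>\<in>{\<alpha>. length \<alpha> = m}. N (fold T \<alpha> y)) \<le> c ^ m * N y"
proof (induction m arbitrary: y)
  case (Suc m)
  have "(\<Sum>\<alpha>\<in>{\<alpha>. length \<alpha> = Suc m}. N (fold T \<alpha> y))
      = (\<Sum>j\<in>UNIV. \<Sum>\<alpha>\<in>{\<alpha>. length \<alpha> = m}. N (fold T \<alpha> (T j y)))"
    by (simp add: sum_words_Suc)
  also have "\<dots> \<le> (\<Sum>j\<in>UNIV. c ^ m * N (T j y))" by (intro sum_mono Suc.IH)
  also have "\<dots> = c ^ m * (\<Sum>j\<in>UNIV. N (T j y))" by (simp add: sum_distrib_left)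
  also have "\<dots> \<le> c ^ m * (c * N y)" by (intro mult_left_mono assms zero_le_power)
  finally show ?case by (simp add: mult_ac)
qed (simp add: length_0_conv[abs_def])

lemma square_summable_words:
  fixes K :: "'d::finite list \<Rightarrow> complex"
  assumes K: "\<And>m. (\<Sum>\<alpha>\<in>{\<alpha>. length \<alpha> = m}. (cmod (K \<alpha>))\<^sup>2) \<le> C * q ^ m"
    and q: "0 \<le> q" "q < 1" and C: "0 \<le> C"
  shows "(\<lambda>\<alpha>. (cmod (K \<alpha>))\<^sup>2) summable_on UNIV"
proof (rule square_summableI)
  fix F :: "'d list set" assume F: "finite F"
  have sm: "summable (\<lambda>m. C * q ^ m)" using q by (intro summable_mult summable_geometric) simp
  have "(\<Sum>\<alpha>\<in>F. (cmod (K \<alpha>))\<^sup>2) = (\<Sum>m\<in>length ` F. \<Sum>\<alpha>\<in>{\<alpha>\<in>F. length \<alpha> = m}. (cmod (K \<alpha>))\<^sup>2)"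
    using sum.group[OF F finite_imageI[OF F, of length] order_refl, of "\<lambda>\<alpha>. (cmod (K \<alpha>))\<^sup>2"] by simp
  also have "\<dots> \<le> (\<Sum>m\<in>length ` F. C * q ^ m)"
  proof (rule sum_mono)
    fix m
    have "(\<Sum>\<alpha>\<in>{\<alpha>\<in>F. length \<alpha> = m}. (cmod (K \<alpha>))\<^sup>2) \<le> (\<Sum>\<alpha>\<in>{\<alpha>. length \<alpha> = m}. (cmod (K \<alpha>))\<^sup>2)"
      by (intro sum_mono2) auto
    also note K
    finally show "(\<Sum>\<alpha>\<in>{\<alpha>\<in>F. length \<alpha> = m}. (cmod (K \<alpha>))\<^sup>2) \<le> C * q ^ m" .
  qed
  also have "\<dots> \<le> (\<Sum>m. C * q ^ m)"
    using F q C by (intro sum_le_suminf sm) auto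
  finally show "(\<Sum>\<alpha>\<in>F. (cmod (K \<alpha>))\<^sup>2) \<le> (\<Sum>m. C * q ^ m)" .
qed

lemma kernel_pairing_has_sum:
  assumes "(\<lambda>\<alpha>. (cmod (K \<alpha>))\<^sup>2) summable_on UNIV"
  shows "((\<lambda>\<alpha>. K \<alpha> * coeff h \<alpha>) has_sum cinner (Abs_ell2 (\<lambda>\<alpha>. cnj (K \<alpha>))) h) UNIV"
  using has_sum_infsum[OF cinner_summable[of "Abs_ell2 (\<lambda>\<alpha>. cnj (K \<alpha>))" h]] assms
  by (simp add: cinner_def Abs_ell2_inverse)

text \<open>
  The pairing with \<open>K\<close> is a continuous functional, and the hypothesis says that it
  vanishes on \<open>\<Theta>\<close> applied to each word \<open>\<beta>\<close>: the coefficient of \<open>\<theta> z\<^sup>\<beta>\<close> at \<open>\<alpha> \<beta>\<close> is \<open>\<theta>\<^sub>\<alpha>\<close>, and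
  words not ending in \<open>\<beta>\<close> do not occur.
\<close>

lemma kernel_annihilates_range:
  assumes \<Theta>: "\<And>x. coeff (blinfun_apply \<Theta> x) = conv \<theta> (coeff x)"
    and K: "(\<lambda>\<alpha>. (cmod (K \<alpha>))\<^sup>2) summable_on UNIV"
    and zero: "\<And>\<beta>. ((\<lambda>\<alpha>. K (\<alpha> @ \<beta>) * \<theta> \<alpha>) has_sum 0) UNIV"
  shows "((\<lambda>\<alpha>. K \<alpha> * coeff (blinfun_apply \<Theta> g) \<alpha>) has_sum 0) UNIV"
proof -
  let ?k = "Abs_ell2 (\<lambda>\<alpha>. cnj (K \<alpha>))"
  have "cinner ?k (blinfun_apply \<Theta> g) = 0"
  proof (rule bounded_linear_eq_0_if_units[where \<phi> = "\<lambda>g. cinner ?k (blinfun_apply \<Theta> g)"])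
    show "bounded_linear (\<lambda>g. cinner ?k (blinfun_apply \<Theta> g))"
      by (intro bounded_linear_compose[OF bounded_linear_cinner] blinfun.bounded_linear_right)
    fix c \<beta>
    let ?u = "blinfun_apply \<Theta> (blinfun_apply (cscale c) (unit_ell2 \<beta>))"
    have u: "coeff ?u w = c * conv \<theta> (word_delta \<beta>) w" for w
    proof -
      have "coeff (blinfun_apply (cscale c) (unit_ell2 \<beta>)) = (\<lambda>v. c * word_delta \<beta> v)"
        by (auto simp: fun_eq_iff word_delta_def)
      then show ?thesis by (simp only: \<Theta> conv_scale_right)
    qed
    have inj: "inj (\<lambda>\<alpha>. \<alpha> @ \<beta>)" by (simp add: inj_def)
    have "((\<lambda>\<alpha>. c * (K (\<alpha> @ \<beta>) * \<theta> \<alpha>)) has_sum 0) UNIV"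
      using has_sum_cmult_right[OF zero[of \<beta>], of c] by (simp only: mult_zero_right)
    also have "(\<lambda>\<alpha>. c * (K (\<alpha> @ \<beta>) * \<theta> \<alpha>)) = (\<lambda>w. K w * coeff ?u w) \<circ> (\<lambda>\<alpha>. \<alpha> @ \<beta>)"
      by (simp add: fun_eq_iff u conv_delta_right_append)
    finally have "((\<lambda>w. K w * coeff ?u w) has_sum 0) (range (\<lambda>\<alpha>. \<alpha> @ \<beta>))"
      by (rule has_sum_reindex[OF inj, THEN iffD2])
    then have "((\<lambda>w. K w * coeff ?u w) has_sum 0) UNIV"
      by (rule has_sum_cong_neutral[THEN iffD1, rotated -1]) (auto simp: u conv_delta_right_not_suffix)
    then show "cinner ?k ?u = 0" using kernel_pairing_has_sum[OF K, of ?u] has_sum_unique by blast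
  qed
  then show ?thesis using kernel_pairing_has_sum[OF K, of "blinfun_apply \<Theta> g"] by simp
qed

section \<open>Evaluation at operator row contractions\<close>

text \<open>
  The row \<open>(Z\<^sub>1, \<dots>, Z\<^sub>d)\<close> has norm at most \<open>\<surd>c\<close>, expressed through the adjoint column.
\<close>

definition row_bounded :: "real \<Rightarrow> ('d::finite \<Rightarrow> 'i ell2 \<Rightarrow>\<^sub>L 'i ell2) \<Rightarrow> bool" where
  "row_bounded c Z \<longleftrightarrow> 0 \<le> c \<and> (\<forall>j. clinear_op (Z j)) \<and>
     (\<forall>y. (\<Sum>j\<in>UNIV. (norm (blinfun_apply (cadjoint (Z j)) y))\<^sup>2) \<le> c * (norm y)\<^sup>2)"

abbreviation adjoint_orbit :: "('d \<Rightarrow> 'i ell2 \<Rightarrow>\<^sub>L 'i ell2) \<Rightarrow> 'd list \<Rightarrow> 'i ell2 \<Rightarrow> 'i ell2" where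
  "adjoint_orbit Z \<equiv> fold (\<lambda>j. blinfun_apply (cadjoint (Z j)))"

definition hom_part :: "('d::finite list \<Rightarrow> complex) \<Rightarrow> ('d \<Rightarrow> 'i ell2 \<Rightarrow>\<^sub>L 'i ell2) \<Rightarrow> nat \<Rightarrow> 'i ell2 \<Rightarrow>\<^sub>L 'i ell2" where
  "hom_part f Z m = (\<Sum>\<alpha>\<in>{\<alpha>. length \<alpha> = m}. cscale (f \<alpha>) o\<^sub>L op_word Z \<alpha>)"

text \<open>
  The Fock norm of the homogeneous part of degree \<open>m\<close> of \<open>f\<close>.
\<close>

definition hom_norm :: "('d::finite list \<Rightarrow> complex) \<Rightarrow> nat \<Rightarrow> real" where
  "hom_norm f m = L2_set (\<lambda>\<alpha>. cmod (f \<alpha>)) {\<alpha>. length \<alpha> = m}"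

lemma hom_norm_le_norm: "hom_norm (coeff h) m \<le> norm h"
  unfolding hom_norm_def L2_set_def
  by (rule real_le_lsqrt) (auto intro!: sum_coeff_le_norm_squared)

lemma row_bounded_if_norm_row:
  assumes Z: "\<And>j. clinear_op (Z j)" and c: "0 \<le> c"
    and P: "\<And>y. norm (blinfun_apply (\<Sum>j\<in>UNIV. Z j o\<^sub>L cadjoint (Z j)) y) \<le> c * norm y"
  shows "row_bounded c Z"
  unfolding row_bounded_def
proof (intro conjI allI Z c)
  let ?P = "\<Sum>j\<in>UNIV. Z j o\<^sub>L cadjoint (Z j)"
  fix y
  have "complex_of_real (\<Sum>j\<in>UNIV. (norm (blinfun_apply (cadjoint (Z j)) y))\<^sup>2)
      = (\<Sum>j\<in>UNIV. cinner y (blinfun_apply (Z j) (blinfun_apply (cadjoint (Z j)) y)))"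
    unfolding of_real_sum
  proof (rule sum.cong[OF refl])
    fix j
    have "cinner (blinfun_apply (Z j) (blinfun_apply (cadjoint (Z j)) y)) y
      = complex_of_real ((norm (blinfun_apply (cadjoint (Z j)) y))\<^sup>2)"
      by (simp only: cinner_cadjoint[OF Z] cinner_self)
    then show "complex_of_real ((norm (blinfun_apply (cadjoint (Z j)) y))\<^sup>2)
      = cinner y (blinfun_apply (Z j) (blinfun_apply (cadjoint (Z j)) y))"
      by (simp only: cinner_commute[of y "blinfun_apply (Z j) _"] complex_cnj_complex_of_real)
  qed
  also have "\<dots> = cinner y (blinfun_apply ?P y)"
    by (simp add: blinfun.sum_left linear_sum[OF bounded_linear.linear[OF bounded_linear_cinner]])
  finally have "\<bar>\<Sum>j\<in>UNIV. (norm (blinfun_apply (cadjoint (Z j)) y))\<^sup>2\<bar> = cmod (cinner y (blinfun_apply ?P y))"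
    by (simp only: norm_of_real[symmetric, where 'a = complex])
  also have "\<dots> \<le> norm y * norm (blinfun_apply ?P y)" by (rule cinner_Cauchy_Schwarz)
  also have "\<dots> \<le> norm y * (c * norm y)" by (intro mult_left_mono P) auto
  finally show "(\<Sum>j\<in>UNIV. (norm (blinfun_apply (cadjoint (Z j)) y))\<^sup>2) \<le> c * (norm y)\<^sup>2"
    by (simp add: power2_eq_square mult_ac)
qed

lemma row_ball_inf_row_bounded:
  assumes "Z \<in> row_ball_inf"
  obtains c where "row_bounded c Z" "c < 1"
proof (rule that)
  let ?P = "\<Sum>j\<in>UNIV. Z j o\<^sub>L cadjoint (Z j)"
  show "norm ?P < 1" using assms by (simp add: row_ball_inf_def)
  show "row_bounded (norm ?P) Z"
    using assms by (intro row_bounded_if_norm_row norm_blinfun norm_ge_zero) (simp add: row_ball_inf_def)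
qed

lemma op_word_Nil [simp]: "op_word Z [] = id_blinfun"
  by (simp add: op_word_def)

lemma op_word_Cons [simp]: "op_word Z (j # \<alpha>) = Z j o\<^sub>L op_word Z \<alpha>"
  by (simp add: op_word_def)

lemma op_word_append: "blinfun_apply (op_word Z (\<alpha> @ \<beta>)) x = blinfun_apply (op_word Z \<alpha>) (blinfun_apply (op_word Z \<beta>) x)"
  by (induction \<alpha>) simp_all

text \<open>
  Moving \<open>Z\<^sup>\<alpha>\<close> to the other side reverses the order of composition, which is why the
  orbit applies the adjoints from the first letter of \<open>\<alpha>\<close> to the last.
\<close>

lemma cinner_op_word:
  assumes "\<And>j. clinear_op (Z j)"
  shows "cinner y (blinfun_apply (op_word Z \<alpha>) x) = cinner (adjoint_orbit Z \<alpha> y) x"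
proof (induction \<alpha> arbitrary: y)
  case (Cons j \<alpha>)
  have "cinner y (blinfun_apply (Z j) v) = cinner (blinfun_apply (cadjoint (Z j)) y) v" for v
    by (simp only: cinner_commute[of y "blinfun_apply (Z j) v"] cinner_commute[of _ v] cinner_cadjoint[OF assms])
  then show ?case by (simp add: Cons.IH)
qed simp

lemma cinner_hom_part: "cinner y (blinfun_apply (hom_part f Z m) x)
    = (\<Sum>\<alpha>\<in>{\<alpha>. length \<alpha> = m}. cinner y (blinfun_apply (op_word Z \<alpha>) x) * f \<alpha>)"
  by (simp add: hom_part_def blinfun.sum_left linear_sum[OF bounded_linear.linear[OF bounded_linear_cinner]]
      cinner_cscale_right mult.commute)

lemma orbit_L2_bound:
  assumes "row_bounded c Z"
  shows "(\<Sum>\<alpha>\<in>{\<alpha>. length \<alpha> = m}. (cmod (cinner y (blinfun_apply (op_word Z \<alpha>) x)))\<^sup>2)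
    \<le> ((norm y)\<^sup>2 * (norm x)\<^sup>2) * c ^ m"
proof -
  from assms have Z: "\<And>j. clinear_op (Z j)" by (simp add: row_bounded_def)
  have "(\<Sum>\<alpha>\<in>{\<alpha>. length \<alpha> = m}. (cmod (cinner y (blinfun_apply (op_word Z \<alpha>) x)))\<^sup>2)
      \<le> (\<Sum>\<alpha>\<in>{\<alpha>. length \<alpha> = m}. (norm (adjoint_orbit Z \<alpha> y))\<^sup>2 * (norm x)\<^sup>2)"
  proof (rule sum_mono)
    fix \<alpha>
    have "(cmod (cinner (adjoint_orbit Z \<alpha> y) x))\<^sup>2 \<le> (norm (adjoint_orbit Z \<alpha> y) * norm x)\<^sup>2"
      by (intro power_mono cinner_Cauchy_Schwarz) auto
    then show "(cmod (cinner y (blinfun_apply (op_word Z \<alpha>) x)))\<^sup>2 \<le> (norm (adjoint_orbit Z \<alpha> y))\<^sup>2 * (norm x)\<^sup>2"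
      by (simp only: cinner_op_word[OF Z] power_mult_distrib)
  qed
  also have "\<dots> = (\<Sum>\<alpha>\<in>{\<alpha>. length \<alpha> = m}. (norm (adjoint_orbit Z \<alpha> y))\<^sup>2) * (norm x)\<^sup>2"
    by (simp add: sum_distrib_right)
  also have "\<dots> \<le> (c ^ m * (norm y)\<^sup>2) * (norm x)\<^sup>2"
    using assms by (intro mult_right_mono word_orbit_bound[where N = "\<lambda>y. (norm y)\<^sup>2"]) (auto simp: row_bounded_def)
  finally show ?thesis by (simp add: mult_ac)
qed

text \<open>
  The column of all \<open>(Z\<^sup>\<alpha>)\<^sup>*\<close> with \<open>\<alpha>\<close> of length \<open>m\<close> has norm at most \<open>\<surd>c\<^sup>m\<close>, so
  Cauchy-Schwarz over the words of length \<open>m\<close> bounds the homogeneous part. For the creation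
  operators, where \<open>c = 1\<close>, the operator norm is thus bounded by the Fock norm of the symbol.
\<close>

lemma norm_hom_part:
  assumes "row_bounded c Z"
  shows "norm (hom_part f Z m) \<le> hom_norm f m * sqrt c ^ m"
proof (rule norm_blinfun_bound)
  from assms have c: "c \<ge> 0" by (simp add: row_bounded_def)
  then show "0 \<le> hom_norm f m * sqrt c ^ m" by (simp add: hom_norm_def)
  fix x
  define v where "v = blinfun_apply (hom_part f Z m) x"
  let ?W = "{\<alpha>. length \<alpha> = m}"
  let ?k = "\<lambda>\<alpha>. cmod (cinner v (blinfun_apply (op_word Z \<alpha>) x))"
  have "L2_set ?k ?W \<le> sqrt (((norm v)\<^sup>2 * (norm x)\<^sup>2) * c ^ m)"
    unfolding L2_set_def by (intro real_sqrt_le_mono orbit_L2_bound assms)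
  also have "\<dots> = norm v * norm x * sqrt c ^ m"
    by (simp add: real_sqrt_mult real_sqrt_power)
  finally have k: "L2_set ?k ?W \<le> norm v * norm x * sqrt c ^ m" .
  have "(norm v)\<^sup>2 = cmod (cinner v v)" by (simp only: cinner_self norm_of_real abs_power2)
  also have "\<dots> \<le> (\<Sum>\<alpha>\<in>?W. \<bar>?k \<alpha>\<bar> * \<bar>cmod (f \<alpha>)\<bar>)"
    unfolding v_def[THEN arg_cong, of "cinner v"] cinner_hom_part
    by (rule order_trans[OF norm_sum]) (simp add: norm_mult)
  also have "\<dots> \<le> L2_set ?k ?W * hom_norm f m"
    unfolding hom_norm_def by (rule L2_set_mult_ineq)
  also have "\<dots> \<le> (norm v * norm x * sqrt c ^ m) * hom_norm f m"
    by (intro mult_right_mono k) (simp add: hom_norm_def)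
  finally have "norm v * norm v \<le> norm v * (hom_norm f m * sqrt c ^ m * norm x)"
    by (simp add: power2_eq_square mult_ac)
  moreover have "0 \<le> hom_norm f m * sqrt c ^ m * norm x" using c by (simp add: hom_norm_def)
  ultimately have "norm v \<le> hom_norm f m * sqrt c ^ m * norm x"
    by (cases "v = 0") (simp_all add: mult_le_cancel_left_pos)
  then show "norm (blinfun_apply (hom_part f Z m) x) \<le> hom_norm f m * sqrt c ^ m * norm x"
    by (simp add: v_def)
qed

lemma summable_norm_hom_part:
  assumes "row_bounded c Z" "c < 1"
  shows "summable (\<lambda>m. norm (hom_part (coeff h) Z m))"
proof (rule summable_comparison_test')
  from assms have c: "0 \<le> c" by (simp add: row_bounded_def)
  then show "summable (\<lambda>m. norm h * sqrt c ^ m)"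
    using assms(2) by (intro summable_mult summable_geometric) simp
  show "norm (norm (hom_part (coeff h) Z m)) \<le> norm h * sqrt c ^ m" for m
    using norm_hom_part[OF assms(1), of "coeff h" m] mult_right_mono[OF hom_norm_le_norm[of h m], of "sqrt c ^ m"] c
    by simp
qed

lemma hom_part_sums:
  assumes "row_bounded c Z" "c < 1"
  shows "hom_part (coeff h) Z sums series_eval_inf (coeff h) Z"
  using summable_sums[OF summable_norm_cancel[OF summable_norm_hom_part[OF assms, of h]]]
  unfolding series_eval_inf_def hom_part_def[symmetric] by this

text \<open>
  The norm-convergent sum of homogeneous parts becomes, after pairing with vectors, an
  absolutely convergent sum over all words; its partial sums by length are the homogeneous parts.
\<close>

lemma series_eval_inf_pairing:
  assumes Z: "row_bounded c Z" "c < 1"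
  shows "((\<lambda>\<alpha>. cinner y (blinfun_apply (op_word Z \<alpha>) x) * coeff h \<alpha>)
    has_sum cinner y (blinfun_apply (series_eval_inf (coeff h) Z) x)) UNIV"
    and "(\<lambda>\<alpha>. (cmod (cinner y (blinfun_apply (op_word Z \<alpha>) x)))\<^sup>2) summable_on UNIV"
proof -
  from Z have c: "0 \<le> c" by (simp add: row_bounded_def)
  show K: "(\<lambda>\<alpha>. (cmod (cinner y (blinfun_apply (op_word Z \<alpha>) x)))\<^sup>2) summable_on UNIV"
    by (rule square_summable_words[OF orbit_L2_bound[OF Z(1)] c Z(2)]) simp
  have "(\<lambda>m. \<Sum>\<alpha>\<in>{\<alpha>. length \<alpha> = m}. cinner y (blinfun_apply (op_word Z \<alpha>) x) * coeff h \<alpha>)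
      sums cinner y (blinfun_apply (series_eval_inf (coeff h) Z) x)"
    unfolding cinner_hom_part[symmetric]
    by (intro bounded_linear.sums[OF bounded_linear_cinner]
      bounded_linear.sums[OF blinfun.bounded_linear_left] hom_part_sums[OF Z])
  from sums_unique2[OF sums_by_length[OF kernel_pairing_has_sum[OF K, of h]] this] kernel_pairing_has_sum[OF K, of h]
  show "((\<lambda>\<alpha>. cinner y (blinfun_apply (op_word Z \<alpha>) x) * coeff h \<alpha>)
    has_sum cinner y (blinfun_apply (series_eval_inf (coeff h) Z) x)) UNIV"
    by (simp only:)
qed

lemma left_null_inf_range:
  assumes \<Theta>: "\<And>x. coeff (blinfun_apply \<Theta> x) = conv (coeff \<theta>) (coeff x)"
    and Z: "Z \<in> row_ball_inf" and y: "left_null_inf y (series_eval_inf (coeff \<theta>) Z)"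
  shows "left_null_inf y (series_eval_inf (coeff (blinfun_apply \<Theta> g)) Z)"
  unfolding left_null_inf_def
proof
  fix x
  obtain c where c: "row_bounded c Z" "c < 1" using row_ball_inf_row_bounded[OF Z] .
  let ?K = "\<lambda>\<alpha>. cinner y (blinfun_apply (op_word Z \<alpha>) x)"
  have "((\<lambda>\<alpha>. ?K (\<alpha> @ \<beta>) * coeff \<theta> \<alpha>) has_sum 0) UNIV" for \<beta>
    using series_eval_inf_pairing(1)[OF c, of y "blinfun_apply (op_word Z \<beta>) x" \<theta>] y
    by (simp add: op_word_append left_null_inf_def)
  from kernel_annihilates_range[OF \<Theta> series_eval_inf_pairing(2)[OF c, of y x] this]
  show "cinner y (blinfun_apply (series_eval_inf (coeff (blinfun_apply \<Theta> g)) Z) x) = 0"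
    by (rule has_sum_unique[OF series_eval_inf_pairing(1)[OF c, of y x]])
qed

section \<open>Evaluation at matrix row contractions\<close>

lemma mult_mat_vec_entry:
  "A \<in> carrier_mat m n \<Longrightarrow> v \<in> carrier_vec n \<Longrightarrow> i < m \<Longrightarrow>
    vec_index (A *\<^sub>v v) i = (\<Sum>k<n. A $$ (i, k) * vec_index v k)"
  by (auto simp: scalar_prod_def atLeast0LessThan intro!: sum.cong)

lemma mult_mat_entry:
  "A \<in> carrier_mat m n \<Longrightarrow> B \<in> carrier_mat n p \<Longrightarrow> i < m \<Longrightarrow> l < p \<Longrightarrow>
    (A * B) $$ (i, l) = (\<Sum>k<n. A $$ (i, k) * B $$ (k, l))"
  by (auto simp: scalar_prod_def atLeast0LessThan intro!: sum.cong)

lemma cvec_norm_nonneg: "0 \<le> cvec_norm v"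
  by (simp add: cvec_norm_def)

lemma cmod_entry_le_cvec_norm: "i < dim_vec v \<Longrightarrow> cmod (vec_index v i) \<le> cvec_norm v"
  unfolding cvec_norm_def by (rule member_le_L2_set) auto

lemma cvec_norm_image_bounded:
  assumes A: "A \<in> carrier_mat m n" and v: "v \<in> carrier_vec n" "cvec_norm v \<le> 1"
  shows "cvec_norm (A *\<^sub>v v) \<le> (\<Sum>i<m. \<Sum>k<n. cmod (A $$ (i, k)))"
proof -
  have "cvec_norm (A *\<^sub>v v) \<le> (\<Sum>i<m. cmod (vec_index (A *\<^sub>v v) i))"
    using L2_set_le_sum[of "{..<m}" "\<lambda>i. cmod (vec_index (A *\<^sub>v v) i)"] A by (simp add: cvec_norm_def)
  also have "\<dots> \<le> (\<Sum>i<m. \<Sum>k<n. cmod (A $$ (i, k)))"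
  proof (rule sum_mono)
    fix i assume "i \<in> {..<m}"
    then have "cmod (vec_index (A *\<^sub>v v) i) = cmod (\<Sum>k<n. A $$ (i, k) * vec_index v k)"
      by (simp only: mult_mat_vec_entry[OF A v(1)] lessThan_iff)
    also have "\<dots> \<le> (\<Sum>k<n. cmod (A $$ (i, k)))"
    proof (rule order_trans[OF norm_sum sum_mono])
      fix k assume "k \<in> {..<n}"
      then have "cmod (vec_index v k) \<le> 1" using cmod_entry_le_cvec_norm[of k v] v by auto
      then show "cmod (A $$ (i, k) * vec_index v k) \<le> cmod (A $$ (i, k))"
        by (simp add: norm_mult mult_left_le)
    qed
    finally show "cmod (vec_index (A *\<^sub>v v) i) \<le> (\<Sum>k<n. cmod (A $$ (i, k)))" .
  qed
  finally show ?thesis .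
qed

text \<open>
  The norm of a matrix is a supremum over the unit ball; it is finite by
  \<open>cvec_norm_image_bounded\<close>, and rescaling \<open>v\<close> to length one brings it into the ball.
\<close>

lemma cvec_norm_mult_mat_vec:
  assumes A: "A \<in> carrier_mat m n" and v: "v \<in> carrier_vec n"
  shows "cvec_norm (A *\<^sub>v v) \<le> mat_norm A * cvec_norm v"
proof (cases "cvec_norm v = 0")
  case True
  then have "vec_index v k = 0" if "k < n" for k
    using cmod_entry_le_cvec_norm[of k v] that v by auto
  then have "vec_index (A *\<^sub>v v) i = 0" if "i < m" for i
    by (simp add: mult_mat_vec_entry[OF A v that])
  then have "cvec_norm (A *\<^sub>v v) = 0"
    unfolding cvec_norm_def using A by (intro L2_set_0') auto
  then show ?thesis by (simp add: True)
next
  case False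
  define c where "c = cvec_norm v"
  have c: "c > 0" using False cvec_norm_nonneg[of v] by (simp add: c_def)
  define w where "w = vec n (\<lambda>k. complex_of_real (1 / c) * vec_index v k)"
  have w: "w \<in> carrier_vec n" by (simp add: w_def)
  have scale: "L2_set (\<lambda>i. cmod (complex_of_real (1 / c) * f i)) S = L2_set (\<lambda>i. cmod (f i)) S / c"
    for f :: "nat \<Rightarrow> complex" and S
    using L2_set_right_distrib[of "1 / c" "\<lambda>i. cmod (f i)" S] c by (simp add: norm_mult norm_divide)
  have "cvec_norm w = L2_set (\<lambda>k. cmod (complex_of_real (1 / c) * vec_index v k)) {..<n}"
    unfolding cvec_norm_def by (rule L2_set_cong) (auto simp: w_def)
  also have "\<dots> = 1" unfolding scale using c v by (simp add: c_def cvec_norm_def)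
  finally have w1: "cvec_norm w = 1" .
  have Aw: "vec_index (A *\<^sub>v w) i = complex_of_real (1 / c) * vec_index (A *\<^sub>v v) i" if "i < m" for i
    unfolding mult_mat_vec_entry[OF A w that] mult_mat_vec_entry[OF A v that]
    by (simp add: w_def sum_distrib_left mult_ac)
  have "cvec_norm (A *\<^sub>v w) = L2_set (\<lambda>i. cmod (complex_of_real (1 / c) * vec_index (A *\<^sub>v v) i)) {..<m}"
    unfolding cvec_norm_def using A by (intro L2_set_cong) (auto simp only: dim_mult_mat_vec carrier_matD Aw lessThan_iff)
  also have "\<dots> = cvec_norm (A *\<^sub>v v) / c" unfolding scale using A by (simp add: cvec_norm_def)
  finally have "cvec_norm (A *\<^sub>v v) / c = cvec_norm (A *\<^sub>v w)" by simp
  also have "\<dots> \<le> mat_norm A"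
    unfolding mat_norm_def
  proof (rule cSUP_upper)
    show "w \<in> {v \<in> carrier_vec (dim_col A). cvec_norm v \<le> 1}" using A w w1 by simp
    show "bdd_above ((\<lambda>v. cvec_norm (A *\<^sub>v v)) ` {v \<in> carrier_vec (dim_col A). cvec_norm v \<le> 1})"
      using A by (intro bdd_aboveI[of _ "\<Sum>i<m. \<Sum>k<n. cmod (A $$ (i, k))"])
        (auto intro!: cvec_norm_image_bounded)
  qed
  finally show ?thesis using c by (simp add: field_simps c_def)
qed

lemma mat_norm_le:
  assumes A: "A \<in> carrier_mat m n"
    and bound: "\<And>v. v \<in> carrier_vec n \<Longrightarrow> cvec_norm v \<le> 1 \<Longrightarrow> cvec_norm (A *\<^sub>v v) \<le> C"
  shows "mat_norm A \<le> C"
  unfolding mat_norm_def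
proof (rule cSUP_least)
  have "0\<^sub>v (dim_col A) \<in> {v \<in> carrier_vec (dim_col A). cvec_norm v \<le> 1}"
    by (simp add: cvec_norm_def L2_set_def)
  then show "{v \<in> carrier_vec (dim_col A). cvec_norm v \<le> 1} \<noteq> {}" by blast
qed (use A bound in auto)

text \<open>
  The vector \<open>X\<^sub>j\<^sup>* y\<close>, with vectors as functions on the indices below \<open>n\<close>: then
  \<open>word_orbit_bound\<close> applies without dimension side conditions.
\<close>

definition adj_apply :: "nat \<Rightarrow> ('d \<Rightarrow> complex mat) \<Rightarrow> 'd \<Rightarrow> (nat \<Rightarrow> complex) \<Rightarrow> nat \<Rightarrow> complex" where
  "adj_apply n X j y k = (\<Sum>i<n. cnj (X j $$ (i, k)) * y i)"

definition sq_norm :: "nat \<Rightarrow> (nat \<Rightarrow> complex) \<Rightarrow> real" where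
  "sq_norm n y = (\<Sum>i<n. (cmod (y i))\<^sup>2)"

text \<open>
  The energies of the \<open>X\<^sub>j\<^sup>* y\<close> add up to \<open>y\<^sup>* M y\<close> with \<open>M = \<Sum>\<^sub>j X\<^sub>j X\<^sub>j\<^sup>*\<close>, which is
  at most \<open>\<parallel>M\<parallel> \<parallel>y\<parallel>\<^sup>2\<close>.
\<close>

lemma row_ball_adj_contraction:
  fixes X :: "'d::finite \<Rightarrow> complex mat"
  assumes "X \<in> row_ball n"
  obtains c where "0 \<le> c" "c < 1" "\<And>y. (\<Sum>j\<in>UNIV. sq_norm n (adj_apply n X j y)) \<le> c * sq_norm n y"
proof -
  define M where "M = mat n n (\<lambda>ik. \<Sum>j\<in>UNIV. (X j * mat_adjoint (X j)) $$ ik)"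
  have M: "M \<in> carrier_mat n n" by (simp add: M_def)
  from assms have X: "\<And>j. X j \<in> carrier_mat n n" and c: "mat_norm M < 1"
    by (auto simp: row_ball_def mat_tuples_def M_def)
  have Mentry: "M $$ (i, i') = (\<Sum>j\<in>UNIV. \<Sum>k<n. X j $$ (i, k) * cnj (X j $$ (i', k)))"
    if "i < n" "i' < n" for i i'
  proof -
    have "(X j * mat_adjoint (X j)) $$ (i, i') = (\<Sum>k<n. X j $$ (i, k) * cnj (X j $$ (i', k)))" for j
    proof -
      have d: "dim_row (X j) = n" "dim_col (X j) = n" using X[of j] by auto
      have adj: "mat_adjoint (X j) \<in> carrier_mat n n"
        using mat_of_rows_carrier(1)[of "dim_row (X j)" "map conjugate (cols (X j))"]
        unfolding mat_adjoint_def by (simp only: length_map cols_length d)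
      have "mat_adjoint (X j) $$ (k, i') = cnj (X j $$ (i', k))" if "k < n" for k
        using that \<open>i' < n\<close> by (simp add: mat_adjoint_def mat_of_rows_def d)
      then show ?thesis by (simp add: mult_mat_entry[OF X adj \<open>i < n\<close> \<open>i' < n\<close>])
    qed
    then show ?thesis using that by (simp add: M_def)
  qed
  have "(\<Sum>j\<in>UNIV. sq_norm n (adj_apply n X j y)) \<le> mat_norm M * sq_norm n y" for y
  proof -
    define v where "v = vec n y"
    have v: "v \<in> carrier_vec n" by (simp add: v_def)
    have nv: "(cvec_norm v)\<^sup>2 = sq_norm n y"
      by (simp add: cvec_norm_def L2_set_def v_def sq_norm_def sum_nonneg)
    have vi: "i < n \<Longrightarrow> vec_index v i = y i" for i by (simp add: v_def)
    let ?t = "\<lambda>j k i i'. (cnj (y i) * X j $$ (i, k)) * (cnj (X j $$ (i', k)) * y i')"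
    have "complex_of_real (\<Sum>j\<in>UNIV. sq_norm n (adj_apply n X j y))
        = (\<Sum>j\<in>UNIV. \<Sum>k<n. cnj (adj_apply n X j y k) * adj_apply n X j y k)"
      by (simp add: sq_norm_def complex_norm_square mult.commute del: of_real_power)
    also have "\<dots> = (\<Sum>j\<in>UNIV. \<Sum>k<n. \<Sum>i<n. \<Sum>i'<n. ?t j k i i')"
      by (simp add: adj_apply_def sum_product mult.commute[of "cnj (y _)"])
    also have "\<dots> = (\<Sum>j\<in>UNIV. \<Sum>i<n. \<Sum>k<n. \<Sum>i'<n. ?t j k i i')"
      by (intro sum.cong refl sum.swap)
    also have "\<dots> = (\<Sum>i<n. \<Sum>j\<in>UNIV. \<Sum>k<n. \<Sum>i'<n. ?t j k i i')"
      by (rule sum.swap)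
    also have "\<dots> = (\<Sum>i<n. \<Sum>j\<in>UNIV. \<Sum>i'<n. \<Sum>k<n. ?t j k i i')"
      by (intro sum.cong refl sum.swap)
    also have "\<dots> = (\<Sum>i<n. \<Sum>i'<n. \<Sum>j\<in>UNIV. \<Sum>k<n. ?t j k i i')"
      by (intro sum.cong refl sum.swap)
    also have "\<dots> = (\<Sum>i<n. cnj (y i) * vec_index (M *\<^sub>v v) i)"
      by (intro sum.cong refl)
        (simp add: mult_mat_vec_entry[OF M v] Mentry vi sum_distrib_left sum_distrib_right mult_ac)
    finally have "\<bar>\<Sum>j\<in>UNIV. sq_norm n (adj_apply n X j y)\<bar> = cmod (\<Sum>i<n. cnj (y i) * vec_index (M *\<^sub>v v) i)"
      by (metis norm_of_real real_norm_def)
    also have "\<dots> \<le> (\<Sum>i<n. \<bar>cmod (vec_index v i)\<bar> * \<bar>cmod (vec_index (M *\<^sub>v v) i)\<bar>)"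
      by (rule order_trans[OF norm_sum]) (simp add: norm_mult v_def)
    also have "\<dots> \<le> cvec_norm v * cvec_norm (M *\<^sub>v v)"
      using L2_set_mult_ineq[of "\<lambda>i. cmod (vec_index v i)" "\<lambda>i. cmod (vec_index (M *\<^sub>v v) i)" "{..<n}"] M v
      by (simp add: cvec_norm_def)
    also have "\<dots> \<le> cvec_norm v * (mat_norm M * cvec_norm v)"
      by (intro mult_left_mono cvec_norm_mult_mat_vec[OF M v] cvec_norm_nonneg)
    finally show ?thesis by (simp add: nv[symmetric] power2_eq_square mult_ac)
  qed
  moreover have "0 \<le> sq_norm n y" for y by (simp add: sq_norm_def sum_nonneg)
  ultimately have "(\<Sum>j\<in>UNIV. sq_norm n (adj_apply n X j y)) \<le> max 0 (mat_norm M) * sq_norm n y" for y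
    by (meson max.cobounded2 mult_right_mono order_trans)
  \<comment> \<open>the maximum with \<open>0\<close> supplies the lower bound demanded of \<open>c\<close>\<close>
  with c show thesis by (intro that[of "max 0 (mat_norm M)"]) auto
qed

lemma mat_word_carrier: "X \<in> mat_tuples n \<Longrightarrow> mat_word n X \<alpha> \<in> carrier_mat n n"
  unfolding mat_word_def by (induction \<alpha>) (auto simp: mat_tuples_def intro!: mult_carrier_mat[of _ n n])

lemma mat_word_Cons: "mat_word n X (j # \<alpha>) = X j * mat_word n X \<alpha>"
  by (simp add: mat_word_def)

lemma mat_word_append:
  assumes X: "X \<in> mat_tuples n"
  shows "mat_word n X (\<alpha> @ \<beta>) = mat_word n X \<alpha> * mat_word n X \<beta>"
proof (induction \<alpha>)
  case Nil
  then show ?case using mat_word_carrier[OF X, of \<beta>] by (simp add: mat_word_def)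
next
  case (Cons j \<alpha>)
  have "X j \<in> carrier_mat n n" using X by (auto simp: mat_tuples_def)
  from assoc_mult_mat[OF this mat_word_carrier[OF X, of \<alpha>] mat_word_carrier[OF X, of \<beta>]]
  show ?case by (simp add: Cons.IH mat_word_Cons)
qed

lemma row_functional_mat_word:
  assumes X: "X \<in> mat_tuples n" and l: "l < n"
  shows "(\<Sum>i<n. cnj (y i) * mat_word n X \<alpha> $$ (i, l)) = cnj (fold (adj_apply n X) \<alpha> y l)"
proof (induction \<alpha> arbitrary: y)
  case Nil
  have "(\<Sum>i<n. cnj (y i) * (1\<^sub>m n $$ (i, l) :: complex)) = (\<Sum>i<n. if i = l then cnj (y i) else 0)"
    using l by (intro sum.cong) auto
  then show ?case using l by (simp add: mat_word_def)
next
  case (Cons j \<alpha>)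
  have Xj: "X j \<in> carrier_mat n n" using X by (auto simp: mat_tuples_def)
  have "(\<Sum>i<n. cnj (y i) * mat_word n X (j # \<alpha>) $$ (i, l))
      = (\<Sum>i<n. \<Sum>k<n. cnj (y i) * (X j $$ (i, k) * mat_word n X \<alpha> $$ (k, l)))"
    by (intro sum.cong refl)
      (simp add: mat_word_Cons mult_mat_entry[OF Xj mat_word_carrier[OF X] _ l] sum_distrib_left)
  also have "\<dots> = (\<Sum>k<n. \<Sum>i<n. cnj (y i) * (X j $$ (i, k) * mat_word n X \<alpha> $$ (k, l)))"
    by (rule sum.swap)
  also have "\<dots> = (\<Sum>k<n. cnj (adj_apply n X j y k) * mat_word n X \<alpha> $$ (k, l))"
    by (simp add: adj_apply_def sum_distrib_left sum_distrib_right mult_ac)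
  finally show ?case by (simp add: Cons.IH)
qed

lemma row_functional_square_summable:
  assumes X: "X \<in> row_ball n" and l: "l < n"
  shows "(\<lambda>\<alpha>. (cmod (\<Sum>i<n. cnj (y i) * mat_word n X \<alpha> $$ (i, l)))\<^sup>2) summable_on UNIV"
proof -
  from X have X': "X \<in> mat_tuples n" by (simp add: row_ball_def)
  obtain c where c: "0 \<le> c" "c < 1"
    and contr: "\<And>y. (\<Sum>j\<in>UNIV. sq_norm n (adj_apply n X j y)) \<le> c * sq_norm n y"
    using row_ball_adj_contraction[OF X] by metis
  show ?thesis
  proof (rule square_summable_words[where C = "sq_norm n y", OF _ c])
    fix m
    have "(\<Sum>\<alpha>\<in>{\<alpha>. length \<alpha> = m}. (cmod (\<Sum>i<n. cnj (y i) * mat_word n X \<alpha> $$ (i, l)))\<^sup>2)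
        \<le> (\<Sum>\<alpha>\<in>{\<alpha>. length \<alpha> = m}. sq_norm n (fold (adj_apply n X) \<alpha> y))"
      unfolding row_functional_mat_word[OF X' l] complex_mod_cnj sq_norm_def
      using l by (intro sum_mono member_le_sum) auto
    also have "\<dots> \<le> c ^ m * sq_norm n y" 
      by (rule word_orbit_bound[where T = "adj_apply n X" and N = "sq_norm n", OF contr c(1)])
    finally show "(\<Sum>\<alpha>\<in>{\<alpha>. length \<alpha> = m}. (cmod (\<Sum>i<n. cnj (y i) * mat_word n X \<alpha> $$ (i, l)))\<^sup>2)
        \<le> sq_norm n y * c ^ m" by (simp add: mult.commute)
  qed (simp add: sq_norm_def sum_nonneg)
qed

lemma series_eval_pairing:
  assumes X: "X \<in> row_ball n" and l: "l < n"
  shows "((\<lambda>\<alpha>. (\<Sum>i<n. cnj (y i) * mat_word n X \<alpha> $$ (i, l)) * coeff h \<alpha>)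
    has_sum (\<Sum>i<n. cnj (y i) * series_eval n (coeff h) X $$ (i, l))) UNIV"
proof -
  have entry: "((\<lambda>\<alpha>. mat_word n X \<alpha> $$ (i, l) * coeff h \<alpha>) has_sum series_eval n (coeff h) X $$ (i, l)) UNIV"
    if i: "i < n" for i
  proof -
    have e: "(\<Sum>i'<n. cnj (if i' = i then 1 else 0) * mat_word n X \<alpha> $$ (i', l)) = mat_word n X \<alpha> $$ (i, l)" for \<alpha>
    proof -
      have "(\<Sum>i'<n. cnj (if i' = i then 1 else 0) * mat_word n X \<alpha> $$ (i', l))
          = (\<Sum>i'<n. if i' = i then mat_word n X \<alpha> $$ (i', l) else 0)"
        by (intro sum.cong) auto
      then show ?thesis using i by simp
    qed
    note sm = row_functional_square_summable[OF X l, of "\<lambda>i'. if i' = i then 1 else 0", unfolded e]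
    note hs = kernel_pairing_has_sum[OF sm, of h]
    from sums_by_length[OF hs] have "(\<lambda>m. hom_eval n (coeff h) X m $$ (i, l)) sums
        cinner (Abs_ell2 (\<lambda>\<alpha>. cnj (mat_word n X \<alpha> $$ (i, l)))) h"
      using i l by (simp add: hom_eval_def mult.commute)
    with hs show ?thesis using i l by (simp add: series_eval_def sums_iff)
  qed
  have "((\<lambda>\<alpha>. \<Sum>i<n. cnj (y i) * (mat_word n X \<alpha> $$ (i, l) * coeff h \<alpha>))
    has_sum (\<Sum>i<n. cnj (y i) * series_eval n (coeff h) X $$ (i, l))) UNIV"
    by (intro has_sum_finite_sum has_sum_cmult_right entry) auto
  then show ?thesis by (simp add: sum_distrib_right mult.assoc)
qed

lemma left_null_iff:
  assumes "y \<in> carrier_vec n" "A \<in> carrier_mat n n"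
  shows "left_null y A \<longleftrightarrow> (\<forall>l<n. (\<Sum>i<n. cnj (vec_index y i) * A $$ (i, l)) = 0)"
proof -
  have r: "mat_of_row (conjugate y) \<in> carrier_mat 1 n" using assms by auto
  have e: "(mat_of_row (conjugate y) * A) $$ (0, l) = (\<Sum>i<n. cnj (vec_index y i) * A $$ (i, l))" if "l < n" for l
    using assms(1) by (subst mult_mat_entry[OF r assms(2) _ that]) (auto intro!: sum.cong simp: mat_of_row_def)
  show ?thesis
    unfolding left_null_def
  proof
    assume "mat_of_row (conjugate y) * A = 0\<^sub>m 1 (dim_col A)"
    then show "\<forall>l<n. (\<Sum>i<n. cnj (vec_index y i) * A $$ (i, l)) = 0"
      using assms by (simp add: e[symmetric])
  next
    assume "\<forall>l<n. (\<Sum>i<n. cnj (vec_index y i) * A $$ (i, l)) = 0"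
    then show "mat_of_row (conjugate y) * A = 0\<^sub>m 1 (dim_col A)"
      using assms by (intro eq_matI) (auto simp: e simp del: index_mult_mat(1))
  qed
qed

text \<open>
  Same argument as at the infinite level: the row vector \<open>y\<^sup>* X\<^sup>\<alpha> X\<^sup>\<beta>\<close> is a combination of
  the entries of \<open>y\<^sup>* X\<^sup>\<alpha>\<close>, so its kernels inherit the vanishing of \<open>y\<^sup>* \<theta>(X)\<close>.
\<close>

lemma left_null_range:
  assumes \<Theta>: "\<And>x. coeff (blinfun_apply \<Theta> x) = conv (coeff \<theta>) (coeff x)"
    and X: "X \<in> row_ball n" and y: "y \<in> carrier_vec n" "left_null y (series_eval n (coeff \<theta>) X)"
  shows "left_null y (series_eval n (coeff (blinfun_apply \<Theta> g)) X)"
proof -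
  from X have X': "X \<in> mat_tuples n" by (simp add: row_ball_def)
  have S: "series_eval n f X \<in> carrier_mat n n" for f by (simp add: series_eval_def)
  let ?K = "\<lambda>l \<alpha>. \<Sum>i<n. cnj (vec_index y i) * mat_word n X \<alpha> $$ (i, l)"
  have "(\<Sum>i<n. cnj (vec_index y i) * series_eval n (coeff (blinfun_apply \<Theta> g)) X $$ (i, l)) = 0"
    if l: "l < n" for l
  proof -
    have "((\<lambda>\<alpha>. ?K l (\<alpha> @ \<beta>) * coeff \<theta> \<alpha>) has_sum 0) UNIV" for \<beta>
    proof -
      let ?b = "\<lambda>k. mat_word n X \<beta> $$ (k, l)"
      have K: "?K l (\<alpha> @ \<beta>) = (\<Sum>k<n. ?b k * ?K k \<alpha>)" for \<alpha>
      proof -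
        have "?K l (\<alpha> @ \<beta>) = (\<Sum>i<n. \<Sum>k<n. cnj (vec_index y i) * (mat_word n X \<alpha> $$ (i, k) * ?b k))"
          by (intro sum.cong refl) (simp add: mat_word_append[OF X']
            mult_mat_entry[OF mat_word_carrier[OF X'] mat_word_carrier[OF X'] _ l] sum_distrib_left)
        also have "\<dots> = (\<Sum>k<n. \<Sum>i<n. cnj (vec_index y i) * (mat_word n X \<alpha> $$ (i, k) * ?b k))"
          by (rule sum.swap)
        finally show ?thesis by (simp add: sum_distrib_left mult_ac)
      qed
      have "((\<lambda>\<alpha>. \<Sum>k<n. ?b k * (?K k \<alpha> * coeff \<theta> \<alpha>)) has_sum (\<Sum>k<n. ?b k * 0)) UNIV"
      proof (intro has_sum_finite_sum has_sum_cmult_right)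
        fix k assume "k \<in> {..<n}"
        then show "((\<lambda>\<alpha>. ?K k \<alpha> * coeff \<theta> \<alpha>) has_sum 0) UNIV"
          using series_eval_pairing[OF X, of k "vec_index y" \<theta>] y left_null_iff[OF y(1) S] by auto
      qed
      then show ?thesis by (simp add: K sum_distrib_right mult.assoc)
    qed
    from kernel_annihilates_range[OF \<Theta> row_functional_square_summable[OF X l, of "vec_index y"] this]
    show ?thesis using series_eval_pairing[OF X l, of "vec_index y"] has_sum_unique by blast
  qed
  then show ?thesis by (simp add: left_null_iff[OF y(1) S])
qed

section \<open>Rational series have finite rank\<close>

interpretation fun_space: vector_space "\<lambda>(c::complex) (f :: 'a \<Rightarrow> complex) x. c * f x"
  by unfold_locales (simp_all add: fun_eq_iff algebra_simps)

lemma fun_span_image: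
  fixes T :: "('a \<Rightarrow> complex) \<Rightarrow> ('b \<Rightarrow> complex)"
  assumes f: "f \<in> fun_space.span B"
    and add: "\<And>g h. T (\<lambda>x. g x + h x) = (\<lambda>x. T g x + T h x)"
    and scale: "\<And>c g. T (\<lambda>x. c * g x) = (\<lambda>x. c * T g x)"
    and B: "\<And>g. g \<in> B \<Longrightarrow> T g \<in> fun_space.span B'"
  shows "T f \<in> fun_space.span B'"
  using f
proof (induction rule: fun_space.span_induct_alt)
  case base
  have "T 0 = 0" using scale[of 0 "\<lambda>x. 0"] by (simp add: zero_fun_def)
  then show ?case by (simp only: fun_space.span_zero)
next
  case (step c g h)
  have "T ((\<lambda>x. c * g x) + h) = (\<lambda>x. c * T g x) + T h"
    by (simp add: plus_fun_def add scale)
  also have "\<dots> \<in> fun_space.span B'"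
    by (intro fun_space.span_add fun_space.span_scale B step)
  finally show ?case .
qed

definition shift_right :: "'a list \<Rightarrow> ('a list \<Rightarrow> complex) \<Rightarrow> 'a list \<Rightarrow> complex" where
  "shift_right \<gamma> F = (\<lambda>w. F (w @ \<gamma>))"

text \<open>
  Equivalently, the Hankel matrix \<open>(F(\<alpha> \<gamma>))\<^sub>\<alpha>\<^sub>,\<^sub>\<gamma>\<close> has finite rank. A finite set whose span
  contains \<open>F\<close> and is translation-invariant is what the closure properties produce directly.
\<close>

definition finite_rank :: "('a list \<Rightarrow> complex) \<Rightarrow> bool" where
  "finite_rank F \<longleftrightarrow> (\<exists>B. finite B \<and> F \<in> fun_space.span B \<and>
     (\<forall>g\<in>B. \<forall>k. shift_right [k] g \<in> fun_space.span B))"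

lemma finite_rankI:
  "finite B \<Longrightarrow> F \<in> fun_space.span B \<Longrightarrow>
    (\<And>g k. g \<in> B \<Longrightarrow> shift_right [k] g \<in> fun_space.span B) \<Longrightarrow> finite_rank F"
  unfolding finite_rank_def by blast

lemma shift_right_span:
  assumes "\<And>g k. g \<in> B \<Longrightarrow> shift_right [k] g \<in> fun_space.span B'" "f \<in> fun_space.span B"
  shows "shift_right [k] f \<in> fun_space.span B'"
  by (rule fun_span_image[where T = "shift_right [k]", OF assms(2)])
    (simp_all add: assms(1), simp_all add: shift_right_def)

lemma shift_right_word_span:
  assumes "\<And>g k. g \<in> B \<Longrightarrow> shift_right [k] g \<in> fun_space.span B" "f \<in> fun_space.span B"
  shows "shift_right \<gamma> f \<in> fun_space.span B"
  using assms(2)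
proof (induction \<gamma> arbitrary: f rule: rev_induct)
  case (snoc k \<gamma>)
  have "shift_right (\<gamma> @ [k]) f = shift_right \<gamma> (shift_right [k] f)"
    by (simp add: shift_right_def)
  also have "\<dots> \<in> fun_space.span B"
    by (rule snoc.IH[OF shift_right_span[OF assms(1) snoc.prems]])
  finally show ?case .
next
  case Nil
  then show ?case by (simp add: shift_right_def)
qed

lemma finite_rank_const: "finite_rank (\<lambda>w. c * word_delta [] w)"
proof (rule finite_rankI)
  show "(\<lambda>w. c * word_delta [] w) \<in> fun_space.span {word_delta []}"
    by (intro fun_space.span_scale fun_space.span_base) simp
  have "shift_right [k] (word_delta []) = 0" for k :: 'a
    by (simp add: shift_right_def word_delta_def fun_eq_iff)
  then show "shift_right [k] g \<in> fun_space.span {word_delta []}" if "g \<in> {word_delta []}" for g and k :: 'a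
    using that by (simp add: fun_space.span_zero)
qed simp

lemma finite_rank_letter: "finite_rank (word_delta [j])"
proof (rule finite_rankI)
  let ?B = "{word_delta [j], word_delta []}"
  show "word_delta [j] \<in> fun_space.span ?B" by (intro fun_space.span_base) simp
  have a: "shift_right [k] (word_delta []) = 0" for k :: 'a
    by (simp add: shift_right_def word_delta_def fun_eq_iff)
  have b: "shift_right [k] (word_delta [j]) = (\<lambda>w. (if k = j then 1 else 0) * word_delta [] w)" for k
    by (auto simp: shift_right_def word_delta_def fun_eq_iff)
  show "shift_right [k] g \<in> fun_space.span ?B" if "g \<in> ?B" for g k
  proof (cases "g = word_delta []")
    case True
    then show ?thesis by (simp only: a fun_space.span_zero)
  next
    case False
    with that have "g = word_delta [j]" by blast
    then show ?thesis unfolding b by (simp only: b) (intro fun_space.span_scale fun_space.span_base, simp)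
  qed
qed simp

lemma finite_rank_add:
  assumes "finite_rank F" "finite_rank G"
  shows "finite_rank (\<lambda>w. F w + G w)"
proof -
  obtain B where B: "finite B" "F \<in> fun_space.span B" "\<And>g k. g \<in> B \<Longrightarrow> shift_right [k] g \<in> fun_space.span B"
    using assms(1) unfolding finite_rank_def by blast
  obtain C where C: "finite C" "G \<in> fun_space.span C" "\<And>g k. g \<in> C \<Longrightarrow> shift_right [k] g \<in> fun_space.span C"
    using assms(2) unfolding finite_rank_def by blast
  have sub: "fun_space.span B \<subseteq> fun_space.span (B \<union> C)" "fun_space.span C \<subseteq> fun_space.span (B \<union> C)"
    by (intro fun_space.span_mono; blast)+
  show ?thesis
  proof (rule finite_rankI)
    show "finite (B \<union> C)" using B C by simp
    have "F + G \<in> fun_space.span (B \<union> C)" using B C sub by (intro fun_space.span_add) auto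
    then show "(\<lambda>w. F w + G w) \<in> fun_space.span (B \<union> C)" by (simp add: plus_fun_def)
    show "shift_right [k] g \<in> fun_space.span (B \<union> C)" if "g \<in> B \<union> C" for g k
      using that B(3) C(3) sub by blast
  qed
qed

lemma conv_span:
  assumes "g \<in> fun_space.span B" "conv F ` B \<subseteq> B'"
  shows "conv F g \<in> fun_space.span B'"
  using assms(1)
proof (rule fun_span_image)
  show "conv F h \<in> fun_space.span B'" if "h \<in> B" for h
    using assms(2) that by (intro fun_space.span_base) blast
qed (simp_all add: fun_eq_iff conv_add_right conv_scale_right)

lemma shift_right_conv:
  "shift_right [k] (conv F g) = conv F (shift_right [k] g) + (\<lambda>w. g [] * shift_right [k] F w)"
  by (simp add: shift_right_def conv_snoc fun_eq_iff mult.commute)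

text \<open>
  A right translate of \<open>F * g\<close> is \<open>F\<close> times a translate of \<open>g\<close>, plus a multiple of a
  translate of \<open>F\<close>. Hence the products \<open>F * g\<close> together with a space for \<open>F\<close> are invariant.
\<close>

lemma finite_rank_conv:
  assumes "finite_rank F" "finite_rank G"
  shows "finite_rank (conv F G)"
proof -
  obtain B where B: "finite B" "F \<in> fun_space.span B" "\<And>g k. g \<in> B \<Longrightarrow> shift_right [k] g \<in> fun_space.span B"
    using assms(1) unfolding finite_rank_def by blast
  obtain C where C: "finite C" "G \<in> fun_space.span C" "\<And>g k. g \<in> C \<Longrightarrow> shift_right [k] g \<in> fun_space.span C"
    using assms(2) unfolding finite_rank_def by blast
  let ?D = "conv F ` C \<union> B"
  have sub: "fun_space.span B \<subseteq> fun_space.span ?D" by (intro fun_space.span_mono) blast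
  show ?thesis
  proof (rule finite_rankI)
    show "finite ?D" using B C by simp
    show "conv F G \<in> fun_space.span ?D" by (rule conv_span[OF C(2)]) blast
    fix g k assume g: "g \<in> ?D"
    show "shift_right [k] g \<in> fun_space.span ?D"
    proof (cases "g \<in> B")
      case True
      then show ?thesis using B(3) sub by blast
    next
      case False
      then obtain h where h: "h \<in> C" "g = conv F h" using g by blast
      have "shift_right [k] F \<in> fun_space.span ?D"
        using shift_right_span[OF B(3) B(2)] sub by blast
      then show ?thesis
        unfolding h(2) shift_right_conv
        by (intro fun_space.span_add fun_space.span_scale conv_span[OF C(3)[OF h(1)]]) auto
    qed
  qed
qed

text \<open>
  The formal inverse, computed by solving \<open>F\<^sup>-\<^sup>1 * F = 1\<close> one length at a time. Since \<open>1 / 0 = 0\<close>,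
  it is the zero series when \<open>F\<close> has no constant term, so the translation formula below holds for every \<open>F\<close>.
\<close>

function conv_inv :: "('a list \<Rightarrow> complex) \<Rightarrow> 'a list \<Rightarrow> complex" where
  "conv_inv F w = (if w = [] then 1 / F []
     else - (1 / F []) * (\<Sum>i<length w. conv_inv F (take i w) * F (drop i w)))"
  by auto
termination by (relation "Wellfounded.measure (length \<circ> snd)") auto

declare conv_inv.simps [simp del]

lemma conv_inv_Nil: "conv_inv F [] = 1 / F []"
  by (simp add: conv_inv.simps)

lemma conv_inv_left:
  assumes "F [] \<noteq> 0"
  shows "conv (conv_inv F) F = word_delta []"
proof
  fix w
  show "conv (conv_inv F) F w = word_delta [] w"
  proof (cases "w = []")
    case False
    have "conv (conv_inv F) F w = (\<Sum>i<length w. conv_inv F (take i w) * F (drop i w)) + conv_inv F w * F []"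
      by (simp add: conv_def lessThan_Suc_atMost[symmetric])
    also have "\<dots> = 0" using assms False by (subst (2) conv_inv.simps) simp
    finally show ?thesis using False by (simp add: word_delta_def)
  qed (use assms in \<open>simp add: conv_inv_Nil word_delta_def\<close>)
qed

lemma shift_right_conv_inv:
  "shift_right [k] (conv_inv F) = (\<lambda>w. (- conv_inv F []) * conv (conv_inv F) (shift_right [k] F) w)"
proof
  fix w
  have "(\<Sum>i<length (w @ [k]). conv_inv F (take i (w @ [k])) * F (drop i (w @ [k])))
      = (\<Sum>i\<le>length w. conv_inv F (take i w) * F (drop i w @ [k]))"
    by (intro sum.cong) (auto simp: lessThan_Suc_atMost)
  then show "shift_right [k] (conv_inv F) w = (- conv_inv F []) * conv (conv_inv F) (shift_right [k] F) w"
    unfolding shift_right_def by (subst conv_inv.simps) (simp add: conv_inv_Nil conv_def)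
qed

text \<open>
  A translate of \<open>G = F\<^sup>-\<^sup>1\<close> is a multiple of \<open>G\<close> times a translate of \<open>F\<close>, so adjoining
  \<open>G\<close> to the products \<open>G * g\<close>, with \<open>g\<close> from a space for \<open>F\<close>, gives an invariant span.
\<close>

lemma finite_rank_conv_inv:
  assumes "finite_rank F"
  shows "finite_rank (conv_inv F)"
proof -
  obtain B where B: "finite B" "F \<in> fun_space.span B" "\<And>g k. g \<in> B \<Longrightarrow> shift_right [k] g \<in> fun_space.span B"
    using assms unfolding finite_rank_def by blast
  let ?G = "conv_inv F"
  let ?D = "insert ?G (conv ?G ` B)"
  have G: "shift_right [k] ?G \<in> fun_space.span ?D" for k
    unfolding shift_right_conv_inv
    by (intro fun_space.span_scale conv_span[OF shift_right_span[OF B(3) B(2)]]) auto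
  show ?thesis
  proof (rule finite_rankI)
    show "finite ?D" using B by simp
    show "?G \<in> fun_space.span ?D" by (intro fun_space.span_base) simp
    fix g k assume g: "g \<in> ?D"
    show "shift_right [k] g \<in> fun_space.span ?D"
    proof (cases "g = ?G")
      case False
      then obtain h where h: "h \<in> B" "g = conv ?G h" using g by blast
      show ?thesis
        unfolding h(2) shift_right_conv
        by (intro fun_space.span_add fun_space.span_scale G conv_span[OF B(3)[OF h(1)]]) auto
    qed (use G in simp)
  qed
qed

section \<open>Power series of rational expressions\<close>

primrec expr_series :: "'d nc_expr \<Rightarrow> 'd list \<Rightarrow> complex" where
  "expr_series (Var j) = word_delta [j]"
| "expr_series (Const c) = (\<lambda>w. c * word_delta [] w)"
| "expr_series (Add r s) = (\<lambda>w. expr_series r w + expr_series s w)"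
| "expr_series (Mult r s) = conv (expr_series r) (expr_series s)"
| "expr_series (Inv r) = conv_inv (expr_series r)"

lemma finite_rank_expr_series: "finite_rank (expr_series r)"
  by (induction r) (simp_all add: finite_rank_letter finite_rank_const finite_rank_add
      finite_rank_conv finite_rank_conv_inv)

text \<open>
  The value of the series \<open>F\<close> at the nilpotent tuple that walks along the word \<open>w\<close>: letter
  \<open>w ! i\<close> moves from vertex \<open>i\<close> to vertex \<open>i + 1\<close> with weight \<open>t\<close>. The entry \<open>(i, l)\<close> collects the
  only path from \<open>i\<close> to \<open>l\<close>, the subword of \<open>w\<close> between them, so the corner entry reads off \<open>F w\<close>.
\<close>

definition path_mat :: "'d list \<Rightarrow> complex \<Rightarrow> ('d list \<Rightarrow> complex) \<Rightarrow> complex mat" where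
  "path_mat w t F = mat (Suc (length w)) (Suc (length w))
     (\<lambda>(i, l). if i \<le> l then t ^ (l - i) * F (take (l - i) (drop i w)) else 0)"

lemma path_mat_carrier: "path_mat w t F \<in> carrier_mat (Suc (length w)) (Suc (length w))"
  by (simp add: path_mat_def)

lemma path_mat_entry: "i \<le> length w \<Longrightarrow> l \<le> length w \<Longrightarrow>
    path_mat w t F $$ (i, l) = (if i \<le> l then t ^ (l - i) * F (take (l - i) (drop i w)) else 0)"
  by (simp add: path_mat_def)

lemma path_mat_delta_Nil: "path_mat w t (word_delta []) = 1\<^sub>m (Suc (length w))"
  by (rule eq_matI) (auto simp: path_mat_def word_delta_def)

text \<open>
  Splitting a path at an intermediate vertex is splitting a word into prefix and suffix.
\<close>

lemma path_mat_mult: "path_mat w t F * path_mat w t G = path_mat w t (conv F G)"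
proof (rule eq_matI)
  fix i l assume "i < dim_row (path_mat w t (conv F G))" "l < dim_col (path_mat w t (conv F G))"
  then have il: "i < Suc (length w)" "l < Suc (length w)" by (simp_all add: path_mat_def)
  have "(path_mat w t F * path_mat w t G) $$ (i, l)
      = (\<Sum>k<Suc (length w). path_mat w t F $$ (i, k) * path_mat w t G $$ (k, l))"
    by (rule mult_mat_entry[OF path_mat_carrier path_mat_carrier il])
  also have "\<dots> = (\<Sum>k\<in>{k. i \<le> k \<and> k \<le> l}. t ^ (l - i) *
      (F (take (k - i) (drop i w)) * G (take (l - k) (drop k w))))"
    (is "_ = sum ?h _")
  proof (rule sum.mono_neutral_cong_right)
    fix k assume "k \<in> {k. i \<le> k \<and> k \<le> l}"
    moreover from this have "t ^ (l - i) = t ^ (k - i) * t ^ (l - k)" by (simp flip: power_add)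
    ultimately show "path_mat w t F $$ (i, k) * path_mat w t G $$ (k, l) = ?h k"
      using il by (simp add: path_mat_entry)
  qed (use il in \<open>auto simp: path_mat_entry\<close>)
  also have "\<dots> = path_mat w t (conv F G) $$ (i, l)"
  proof (cases "i \<le> l")
    case True
    let ?u = "take (l - i) (drop i w)"
    have u: "length ?u = l - i" using il True by simp
    have "(\<Sum>k\<in>{k. i \<le> k \<and> k \<le> l}. ?h k) = (\<Sum>p\<le>l - i. t ^ (l - i) * (F (take p ?u) * G (drop p ?u)))"
    proof (rule sum.reindex_bij_witness[where i = "\<lambda>p. p + i" and j = "\<lambda>k. k - i"])
      fix k assume k: "k \<in> {k. i \<le> k \<and> k \<le> l}"
      then have "take (k - i) ?u = take (k - i) (drop i w)" "drop (k - i) ?u = take (l - k) (drop k w)"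
        by (auto simp: drop_take min_def)
      then show "t ^ (l - i) * (F (take (k - i) ?u) * G (drop (k - i) ?u)) = ?h k" by simp
    qed (use True in auto)
    then show ?thesis using il True u by (simp add: path_mat_entry conv_def sum_distrib_left)
  next
    case False
    then have "{k. i \<le> k \<and> k \<le> l} = {}" by auto
    then show ?thesis using il False by (simp add: path_mat_entry)
  qed
  finally show "(path_mat w t F * path_mat w t G) $$ (i, l) = path_mat w t (conv F G) $$ (i, l)" .
qed (simp_all add: path_mat_def)

text \<open>
  At path matrices evaluation is exact with no convergence involved. For an inverse, the matrix
  is upper triangular with the constant term on the diagonal, so invertibility forces a nonzero
  constant term and the formal inverse supplies the inverse matrix.
\<close>

lemma nc_eval_path_mat:
  assumes "nc_eval (Suc (length w)) (\<lambda>j. path_mat w t (word_delta [j])) r = Some A"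
  shows "A = path_mat w t (expr_series r)"
  using assms
proof (induction r arbitrary: A)
  case (Const c)
  then show ?case by (auto intro!: eq_matI simp: path_mat_def word_delta_def)
next
  case (Add r s)
  then obtain B C where "A = B + C" "B = path_mat w t (expr_series r)" "C = path_mat w t (expr_series s)"
    by (auto split: Option.bind_splits)
  then show ?case by (auto intro!: eq_matI simp: path_mat_def algebra_simps)
next
  case (Mult r s)
  then obtain B C where "A = B * C" "B = path_mat w t (expr_series r)" "C = path_mat w t (expr_series s)"
    by (auto split: Option.bind_splits)
  then show ?case by (simp add: path_mat_mult)
next
  case (Inv r)
  let ?F = "expr_series r" and ?n = "Suc (length w)"
  let ?P = "path_mat w t ?F"
  from Inv have "mat_inverse ?P = Some A" by (auto split: Option.bind_splits)
  from mat_inverse(2)[OF path_mat_carrier this]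
  have A: "?P * A = 1\<^sub>m ?n" "A * ?P = 1\<^sub>m ?n" "A \<in> carrier_mat ?n ?n" by auto
  have "?F [] \<noteq> 0"
  proof
    assume zero: "?F [] = 0"
    \<comment> \<open>the last row of the triangular matrix has only its diagonal entry\<close>
    have "(?P * A) $$ (length w, length w) = (\<Sum>k<?n. ?P $$ (length w, k) * A $$ (k, length w))"
      by (rule mult_mat_entry[OF path_mat_carrier A(3)]) auto
    also have "\<dots> = 0" using zero by (intro sum.neutral) (auto simp: path_mat_entry)
    finally show False by (simp add: A(1))
  qed
  then have G: "path_mat w t (conv_inv ?F) * ?P = 1\<^sub>m ?n"
    by (simp add: path_mat_mult conv_inv_left path_mat_delta_Nil)
  have "A = path_mat w t (conv_inv ?F) * ?P * A" using A(3) by (simp add: G)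
  also have "\<dots> = path_mat w t (conv_inv ?F) * (?P * A)"
    by (rule assoc_mult_mat[OF path_mat_carrier path_mat_carrier A(3)])
  also have "\<dots> = path_mat w t (conv_inv ?F)" using path_mat_carrier[of w t "conv_inv ?F"] by (simp add: A(1))
  finally show ?case by simp
qed simp

lemma mat_word_path_mat:
  "mat_word (Suc (length w)) (\<lambda>j. path_mat w t (word_delta [j])) \<alpha> = path_mat w t (word_delta \<alpha>)"
  by (induction \<alpha>) (simp_all add: mat_word_Cons path_mat_mult conv_delta_delta,
     simp add: mat_word_def path_mat_delta_Nil)

lemma mat_norm_path_mat_letter:
  "mat_norm (path_mat w t (word_delta [j])) \<le> (real (Suc (length w)))\<^sup>2 * cmod t"
proof (rule mat_norm_le[OF path_mat_carrier])
  let ?n = "Suc (length w)" and ?A = "path_mat w t (word_delta [j])"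
  fix v assume "v \<in> carrier_vec ?n" "cvec_norm v \<le> 1"
  then have "cvec_norm (?A *\<^sub>v v) \<le> (\<Sum>i<?n. \<Sum>k<?n. cmod (?A $$ (i, k)))"
    by (rule cvec_norm_image_bounded[OF path_mat_carrier])
  also have "\<dots> \<le> (\<Sum>i<?n. \<Sum>k<?n. cmod t)"
  proof (intro sum_mono)
    fix i k assume ik: "i \<in> {..<?n}" "k \<in> {..<?n}"
    have "k - i = 1" if "i \<le> k" "take (k - i) (drop i w) = [j]"
      using ik arg_cong[OF that(2), of length] that(1) by (simp add: min_def split: if_splits)
    then show "cmod (?A $$ (i, k)) \<le> cmod t"
      using ik by (auto simp: path_mat_entry word_delta_def)
  qed
  also have "\<dots> = (real ?n)\<^sup>2 * cmod t" by (simp add: power2_eq_square)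
  finally show "cvec_norm (?A *\<^sub>v v) \<le> (real ?n)\<^sup>2 * cmod t" .
qed

text \<open>
  A scaled path tuple lies in any neighbourhood of \<open>0\<close>, and there the expression and
  the convergent expansion have the same corner entry, which is the coefficient at \<open>w\<close> up to a
  nonzero power of the scale.
\<close>

lemma nc_power_series_eq_expr_series:
  fixes f :: "'d::finite list \<Rightarrow> complex"
  assumes "nc_power_series r f"
  shows "f = expr_series r"
proof
  fix w :: "'d list"
  let ?n = "Suc (length w)"
  obtain \<epsilon> where \<epsilon>: "\<epsilon> > 0" and ser: "\<And>X. X \<in> mat_tuples ?n \<Longrightarrow> (\<forall>j. mat_norm (X j) < \<epsilon>) \<Longrightarrow>
        (\<exists>A. nc_eval ?n X r = Some A \<and>
          (\<forall>i<?n. \<forall>k<?n. (\<lambda>m. hom_eval ?n f X m $$ (i, k)) sums (A $$ (i, k))))"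
    using assms[unfolded nc_power_series_def, THEN spec, of ?n, THEN mp] by auto
  \<comment> \<open>small enough for the crude bound in \<open>mat_norm_path_mat_letter\<close> to stay below \<open>\<epsilon>\<close>\<close>
  define t where "t = complex_of_real (\<epsilon> / (2 * (real ?n)\<^sup>2))"
  have t0: "t \<noteq> 0" using \<epsilon> by (simp only: t_def of_real_eq_0_iff) simp
  define X where "X = (\<lambda>j. path_mat w t (word_delta [j]))"
  have "mat_norm (X j) < \<epsilon>" for j
  proof -
    have "mat_norm (X j) \<le> (real ?n)\<^sup>2 * cmod t" unfolding X_def by (rule mat_norm_path_mat_letter)
    also have "cmod t = \<epsilon> / (2 * (real ?n)\<^sup>2)" using \<epsilon> by (simp only: t_def norm_of_real) simp
    also have "(real ?n)\<^sup>2 * (\<epsilon> / (2 * (real ?n)\<^sup>2)) = \<epsilon> / 2" by simp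
    finally show ?thesis using \<epsilon> by simp
  qed
  moreover have "X \<in> mat_tuples ?n" by (simp add: mat_tuples_def X_def path_mat_carrier)
  ultimately obtain A where A: "nc_eval ?n X r = Some A"
      and sums: "\<And>i k. i < ?n \<Longrightarrow> k < ?n \<Longrightarrow> (\<lambda>m. hom_eval ?n f X m $$ (i, k)) sums (A $$ (i, k))"
    using ser[of X] by blast
  have "hom_eval ?n f X m $$ (0, length w) = (if m = length w then t ^ length w * f w else 0)" for m
  proof -
    have "hom_eval ?n f X m $$ (0, length w) = (\<Sum>\<alpha>\<in>{\<alpha>. length \<alpha> = m}. f \<alpha> * path_mat w t (word_delta \<alpha>) $$ (0, length w))"
      by (simp add: hom_eval_def X_def mat_word_path_mat)
    also have "\<dots> = (\<Sum>\<alpha>\<in>{\<alpha>. length \<alpha> = m}. if \<alpha> = w then t ^ length w * f w else 0)"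
      by (intro sum.cong refl) (auto simp: path_mat_entry word_delta_def)
    finally show ?thesis by (auto simp: sum.delta')
  qed
  with sums[of 0 "length w"] have "(\<lambda>m. if m = length w then t ^ length w * f w else 0) sums (A $$ (0, length w))"
    by simp
  then have "t ^ length w * f w = A $$ (0, length w)"
    using sums_single[of "length w" "\<lambda>_. t ^ length w * f w"] sums_unique2 by blast
  also have "A = path_mat w t (expr_series r)" using nc_eval_path_mat A unfolding X_def by blast
  also have "\<dots> $$ (0, length w) = t ^ length w * expr_series r w" by (simp add: path_mat_entry)
  finally show "f w = expr_series r w" using t0 by simp
qed

lemma nc_rational_finite_rank:
  assumes "nc_rational f"
  shows "finite_rank f"
proof -
  obtain r where "nc_power_series r f" using assms unfolding nc_rational_def by blast
  then show ?thesis using nc_power_series_eq_expr_series finite_rank_expr_series by metis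
qed

section \<open>Finite rank and square-summability force geometric decay\<close>

lift_definition back_shift :: "'d list \<Rightarrow> 'd fock \<Rightarrow> 'd fock" is "\<lambda>\<gamma> x w. x (w @ \<gamma>)"
proof -
  fix \<gamma> :: "'d list" and x :: "'d list \<Rightarrow> complex"
  assume x: "(\<lambda>w. (cmod (x w))\<^sup>2) summable_on UNIV"
  have "inj (\<lambda>w. w @ \<gamma>)" by (simp add: inj_def)
  from summable_on_reindex[OF this, of "\<lambda>w. (cmod (x w))\<^sup>2"]
    summable_on_subset_banach[OF x subset_UNIV, of "range (\<lambda>w. w @ \<gamma>)"]
  show "(\<lambda>w. (cmod (x (w @ \<gamma>)))\<^sup>2) summable_on UNIV" by (simp add: o_def)
qed

lemma back_shift_back_shift: "back_shift \<beta> (back_shift \<gamma> x) = back_shift (\<beta> @ \<gamma>) x"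
  by transfer (simp add: fun_eq_iff)

lemma linear_back_shift: "linear (back_shift \<gamma>)"
  by (rule linearI; transfer) simp_all

text \<open>
  The energy of \<open>x\<close> in degrees at least \<open>m\<close> (see \<open>tail_energy_sums\<close>), written through
  translates so that it iterates (see \<open>tail_energy_add\<close>).
\<close>

definition tail_energy :: "nat \<Rightarrow> 'd::finite fock \<Rightarrow> real" where
  "tail_energy m x = (\<Sum>\<gamma>\<in>{\<gamma>. length \<gamma> = m}. (norm (back_shift \<gamma> x))\<^sup>2)"

lemma hom_norm_squared: "(hom_norm f m)\<^sup>2 = (\<Sum>\<alpha>\<in>{\<alpha>. length \<alpha> = m}. (cmod (f \<alpha>))\<^sup>2)"
  by (simp add: hom_norm_def L2_set_def sum_nonneg)

lemma hom_norm_squared_sums: "(\<lambda>m. (hom_norm (coeff x) m)\<^sup>2) sums (norm x)\<^sup>2"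
  unfolding hom_norm_squared norm_ell2_squared
  by (intro sums_by_length has_sum_infsum coeff_square_summable)

lemma tail_energy_sums: "(\<lambda>j. (hom_norm (coeff x) (j + m))\<^sup>2) sums tail_energy m x"
proof -
  have "(\<lambda>j. \<Sum>\<gamma>\<in>{\<gamma>. length \<gamma> = m}. (hom_norm (coeff (back_shift \<gamma> x)) j)\<^sup>2) sums tail_energy m x"
    unfolding tail_energy_def by (intro sums_sum hom_norm_squared_sums)
  also have "(\<lambda>j. \<Sum>\<gamma>\<in>{\<gamma>. length \<gamma> = m}. (hom_norm (coeff (back_shift \<gamma> x)) j)\<^sup>2)
      = (\<lambda>j. (hom_norm (coeff x) (j + m))\<^sup>2)"
    unfolding hom_norm_squared sum_words_add back_shift.rep_eq by (rule ext) (rule sum.swap)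
  finally show ?thesis .
qed

lemma tail_energy_tendsto_0: "(\<lambda>m. tail_energy m x) \<longlonglongrightarrow> 0"
proof -
  let ?c = "\<lambda>m. (hom_norm (coeff x) m)\<^sup>2"
  have c: "summable ?c" using hom_norm_squared_sums by (rule sums_summable)
  have "tail_energy m x = suminf ?c - sum ?c {..<m}" for m
    using suminf_minus_initial_segment[OF c, of m] sums_unique[OF tail_energy_sums[of x m]] by simp
  moreover have "(\<lambda>m. suminf ?c - sum ?c {..<m}) \<longlonglongrightarrow> suminf ?c - suminf ?c"
    by (intro tendsto_diff tendsto_const summable_LIMSEQ c)
  ultimately show ?thesis by simp
qed

lemma tail_energy_add:
  "tail_energy (m + n) x = (\<Sum>\<gamma>\<in>{\<gamma>. length \<gamma> = n}. tail_energy m (back_shift \<gamma> x))"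
  unfolding tail_energy_def sum_words_add back_shift_back_shift by (rule sum.swap)

text \<open>
  Each basis vector loses its tail as \<open>m\<close> grows. On a finite-dimensional space the
  coefficients in an orthogonal basis are controlled by the norm, so the decay is uniform.
\<close>

lemma uniform_tail_decay:
  fixes S :: "'d::finite fock set"
  assumes "finite S"
  obtains m where "m > 0" "\<And>g. g \<in> real_vector.span S \<Longrightarrow> tail_energy m g \<le> (1/4) * (norm g)\<^sup>2"
proof -
  obtain E where E: "finite E" "real_vector.span E = real_vector.span S" "pairwise (\<lambda>a b. inner a b = 0) E"
    using basis_orthogonal[OF assms] unfolding real_inner_class.orthogonal_def by blast
  define B where "B = E - {0}"
  have B: "finite B" "pairwise (\<lambda>a b. inner a b = 0) B" "\<And>e. e \<in> B \<Longrightarrow> norm e > 0"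
    using E by (auto simp: B_def pairwise_def)
  have span_B: "real_vector.span B = real_vector.span S"
    unfolding B_def E(2)[symmetric] by (rule real_vector.span_delete_0)
  \<comment> \<open>the factor \<open>card B\<close> comes from squaring a sum over the basis\<close>
  define \<delta> where "\<delta> m = (\<Sum>e\<in>B. tail_energy m e / (norm e)\<^sup>2) * card B" for m
  have "\<delta> \<longlonglongrightarrow> (\<Sum>e\<in>B. 0 / (norm e)\<^sup>2) * card B"
    unfolding \<delta>_def by (intro tendsto_intros tail_energy_tendsto_0) (use B(3) in force)
  then have "eventually (\<lambda>m. \<delta> m < 1/4) sequentially"
    by (intro order_tendstoD(2)) (auto simp: sum.neutral)
  then obtain M where M: "\<And>m. m \<ge> M \<Longrightarrow> \<delta> m < 1/4"
    unfolding eventually_sequentially by blast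
  show thesis
  proof (rule that[of "Suc M"])
    fix g assume "g \<in> real_vector.span S"
    then have "g \<in> range (\<lambda>u. \<Sum>e\<in>B. u e *\<^sub>R e)"
      unfolding span_B[symmetric] real_vector.span_finite[OF B(1)] .
    then obtain u where u: "g = (\<Sum>e\<in>B. u e *\<^sub>R e)" by blast
    have coef: "(u e)\<^sup>2 \<le> (norm g)\<^sup>2 / (norm e)\<^sup>2" if e: "e \<in> B" for e
    proof -
      have "inner g e = (\<Sum>e'\<in>B. u e' * inner e' e)" by (simp add: u inner_sum_left)
      also have "\<dots> = (\<Sum>e'\<in>B. if e' = e then u e * inner e e else 0)"
        using B(2) e by (intro sum.cong) (auto simp: pairwise_def)
      also have "\<dots> = u e * (norm e)\<^sup>2" using e B(1) by (simp add: power2_norm_eq_inner)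
      finally have "\<bar>u e\<bar> * (norm e)\<^sup>2 = \<bar>inner g e\<bar>" by (simp add: abs_mult)
      also have "\<dots> \<le> norm g * norm e" by (rule Cauchy_Schwarz_ineq2)
      finally have "\<bar>u e\<bar> * norm e \<le> norm g" using B(3)[OF e] by (simp add: power2_eq_square)
      then have "(\<bar>u e\<bar> * norm e)\<^sup>2 \<le> (norm g)\<^sup>2" by (intro power_mono) auto
      then show ?thesis using B(3)[OF e] by (simp add: power_mult_distrib field_simps)
    qed
    have "tail_energy m g \<le> \<delta> m * (norm g)\<^sup>2" for m
    proof -
      have "(norm (back_shift \<gamma> g))\<^sup>2 \<le> (\<Sum>e\<in>B. (u e)\<^sup>2 * (norm (back_shift \<gamma> e))\<^sup>2) * card B" for \<gamma>
      proof -
        have "norm (back_shift \<gamma> g) \<le> (\<Sum>e\<in>B. norm (u e *\<^sub>R back_shift \<gamma> e))"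
          unfolding u linear_sum[OF linear_back_shift] linear_scale[OF linear_back_shift] by (rule norm_sum)
        then have "(norm (back_shift \<gamma> g))\<^sup>2 \<le> (\<Sum>e\<in>B. norm (u e *\<^sub>R back_shift \<gamma> e))\<^sup>2"
          by (intro power_mono) auto
        also note sum_squared_le_sum_of_squares
        finally show ?thesis by (simp add: power_mult_distrib)
      qed
      then have "tail_energy m g \<le> (\<Sum>\<gamma>\<in>{\<gamma>. length \<gamma> = m}. (\<Sum>e\<in>B. (u e)\<^sup>2 * (norm (back_shift \<gamma> e))\<^sup>2) * card B)"
        unfolding tail_energy_def by (intro sum_mono)
      also have "\<dots> = (\<Sum>\<gamma>\<in>{\<gamma>. length \<gamma> = m}. \<Sum>e\<in>B. (u e)\<^sup>2 * (norm (back_shift \<gamma> e))\<^sup>2) * card B"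
        by (simp add: sum_distrib_right)
      also have "(\<Sum>\<gamma>\<in>{\<gamma>. length \<gamma> = m}. \<Sum>e\<in>B. (u e)\<^sup>2 * (norm (back_shift \<gamma> e))\<^sup>2)
          = (\<Sum>e\<in>B. \<Sum>\<gamma>\<in>{\<gamma>. length \<gamma> = m}. (u e)\<^sup>2 * (norm (back_shift \<gamma> e))\<^sup>2)"
        by (rule sum.swap)
      also have "\<dots> = (\<Sum>e\<in>B. (u e)\<^sup>2 * tail_energy m e)"
        by (simp add: tail_energy_def sum_distrib_left)
      also have "\<dots> * card B \<le> (\<Sum>e\<in>B. (norm g)\<^sup>2 / (norm e)\<^sup>2 * tail_energy m e) * card B"
        by (intro mult_right_mono sum_mono coef) (auto simp: tail_energy_def sum_nonneg)
      also have "\<dots> = \<delta> m * (norm g)\<^sup>2"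
        by (simp add: \<delta>_def sum_distrib_left sum_distrib_right mult_ac)
      finally show ?thesis .
    qed
    then have "tail_energy (Suc M) g \<le> \<delta> (Suc M) * (norm g)\<^sup>2" .
    also have "\<dots> \<le> (1/4) * (norm g)\<^sup>2" using M[of "Suc M"] by (intro mult_right_mono) auto
    finally show "tail_energy (Suc M) g \<le> (1/4) * (norm g)\<^sup>2" .
  qed simp
qed

lemma sum_fun_apply: "(\<Sum>a\<in>A. f a) x = (\<Sum>a\<in>A. f a x)"
  for f :: "'a \<Rightarrow> 'b \<Rightarrow> 'c::comm_monoid_add"
  by (induction A rule: infinite_finite_induct) (simp_all add: zero_fun_def plus_fun_def)

text \<open>
  The invariant space of a finite-rank series need not consist of square-summable
  families, but the translates of \<open>x\<close> do; a maximal independent set of translates is finite, since it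
  lies in a finite-dimensional space, and spans all translates. Complex combinations become real ones
  after adding the multiples by \<open>\<i>\<close>.
\<close>

lemma finite_rank_back_shift_span:
  fixes x :: "'d fock"
  assumes "finite_rank (coeff x)"
  obtains S :: "'d fock set" where "finite S" "\<And>\<gamma>. back_shift \<gamma> x \<in> real_vector.span S"
proof -
  obtain B where B: "finite B" "coeff x \<in> fun_space.span B"
      "\<And>g k. g \<in> B \<Longrightarrow> shift_right [k] g \<in> fun_space.span B"
    using assms unfolding finite_rank_def by blast
  define T where "T = coeff ` range (\<lambda>\<gamma>. back_shift \<gamma> x)"
  have "T \<subseteq> fun_space.span B"
  proof -
    have "coeff (back_shift \<gamma> x) = shift_right \<gamma> (coeff x)" for \<gamma>
      by (simp add: back_shift.rep_eq shift_right_def)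
    then show ?thesis using shift_right_word_span[OF B(3) B(2)] by (auto simp: T_def)
  qed
  moreover obtain C where C: "C \<subseteq> T" "fun_space.independent C" "T \<subseteq> fun_space.span C"
    by (rule fun_space.maximal_independent_subset)
  ultimately have "finite C" using fun_space.independent_span_bound[OF B(1) C(2)] by blast
  have inj: "inj_on coeff A" for A :: "'d fock set" by (simp add: inj_on_def coeff_inject)
  define D where "D = coeff -` C"
  have "C \<subseteq> range coeff" using C(1) unfolding T_def by blast
  then have D: "finite D" "C = coeff ` D"
    unfolding D_def image_vimage_eq
    by (intro finite_vimageI \<open>finite C\<close> inj, simp only: Int_absorb2)
  let ?S = "(\<lambda>y. blinfun_apply (cscale 1) y) ` D \<union> (\<lambda>y. blinfun_apply (cscale \<i>) y) ` D"
  show thesis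
  proof (rule that[of ?S])
    show "finite ?S" using D by simp
    fix \<gamma>
    have "coeff (back_shift \<gamma> x) \<in> fun_space.span C" using C(3) by (auto simp: T_def)
    then obtain u where u: "coeff (back_shift \<gamma> x) = (\<Sum>g\<in>C. (\<lambda>w. u g * g w))"
      unfolding fun_space.span_finite[OF \<open>finite C\<close>] by blast
    have "back_shift \<gamma> x = (\<Sum>y\<in>D. blinfun_apply (cscale (u (coeff y))) y)"
      by (rule ell2_eqI) (simp add: u sum_fun_apply D(2) sum.reindex[OF inj])
    also have "\<dots> \<in> real_vector.span ?S"
    proof (rule real_vector.span_sum)
      fix y assume y: "y \<in> D"
      have S: "blinfun_apply (cscale 1) y \<in> ?S" "blinfun_apply (cscale \<i>) y \<in> ?S" using y by blast+
      have "blinfun_apply (cscale c) y = Re c *\<^sub>R blinfun_apply (cscale 1) y + Im c *\<^sub>R blinfun_apply (cscale \<i>) y" for c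
        by (rule ell2_eqI) (simp add: complex_eq_iff algebra_simps)
      then show "blinfun_apply (cscale (u (coeff y))) y \<in> real_vector.span ?S"
        by (rule ssubst) (intro real_vector.span_add real_vector.span_scale real_vector.span_base S)
    qed
    finally show "back_shift \<gamma> x \<in> real_vector.span ?S" .
  qed
qed

lemma summable_power_div:
  assumes "m > 0"
  shows "summable (\<lambda>n. (1/2 :: real) ^ (n div m))"
proof -
  \<comment> \<open>then \<open>(1/2)\<close> to the power \<open>n div m\<close> is at most \<open>2 q\<^sup>n\<close>, because \<open>n - m * (n div m) < m\<close>\<close>
  define q where "q = root m (1/2)"
  have q: "q ^ m = 1/2" "0 < q" "q < 1" using assms by (auto simp: q_def)
  show ?thesis
  proof (rule summable_comparison_test')
    show "summable (\<lambda>n. 2 * q ^ n)" using q by (intro summable_mult summable_geometric) simp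
    fix n
    have "(1/2 :: real) ^ (n div m) * q ^ (n mod m) = q ^ n"
      unfolding q(1)[symmetric] power_mult[symmetric] power_add[symmetric] by simp
    moreover have "1/2 \<le> q ^ (n mod m)"
      unfolding q(1)[symmetric] using q assms by (intro power_decreasing) auto
    ultimately have "(1/2 :: real) ^ (n div m) * (1/2) \<le> q ^ n"
      by (metis mult_left_mono zero_le_power zero_le_divide_1_iff zero_le_numeral)
    then show "norm ((1/2 :: real) ^ (n div m)) \<le> 2 * q ^ n" by simp
  qed
qed

text \<open>
  By \<open>uniform_tail_decay\<close> the tail energy of every translate drops by a factor of four
  over \<open>m\<close> degrees, and \<open>tail_energy_add\<close> turns this into geometric decay for \<open>x\<close> itself.
\<close>

lemma finite_rank_summable_hom_norm:
  fixes x :: "'d::finite fock"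
  assumes "finite_rank (coeff x)"
  shows "summable (hom_norm (coeff x))"
proof -
  obtain S :: "'d fock set" where S: "finite S" "\<And>\<gamma>. back_shift \<gamma> x \<in> real_vector.span S"
    using finite_rank_back_shift_span[OF assms] by metis
  obtain m where m: "m > 0"
      "\<And>g. g \<in> real_vector.span S \<Longrightarrow> tail_energy m g \<le> (1/4) * (norm g)\<^sup>2"
    using uniform_tail_decay[OF S(1)] by metis
  have decay: "tail_energy (m * k) x \<le> (1/4) ^ k * (norm x)\<^sup>2" for k
  proof (induction k)
    case 0
    have "back_shift [] x = x" by transfer simp
    then show ?case by (simp add: tail_energy_def)
  next
    case (Suc k)
    have "tail_energy (m * Suc k) x = (\<Sum>\<gamma>\<in>{\<gamma>. length \<gamma> = m * k}. tail_energy m (back_shift \<gamma> x))"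
      using tail_energy_add[of m "m * k" x] by simp
    also have "\<dots> \<le> (\<Sum>\<gamma>\<in>{\<gamma>. length \<gamma> = m * k}. (1/4) * (norm (back_shift \<gamma> x))\<^sup>2)"
      by (intro sum_mono m(2) S(2))
    also have "\<dots> = (1/4) * tail_energy (m * k) x" by (simp add: tail_energy_def sum_distrib_left)
    also have "\<dots> \<le> (1/4) * ((1/4) ^ k * (norm x)\<^sup>2)" by (intro mult_left_mono Suc.IH) simp
    finally show ?case by simp
  qed
  show ?thesis
  proof (rule summable_comparison_test')
    show "summable (\<lambda>n. norm x * (1/2) ^ (n div m))" by (intro summable_mult summable_power_div m(1))
    fix n
    let ?k = "n div m"
    have "(hom_norm (coeff x) n)\<^sup>2 = (\<Sum>j\<in>{n mod m}. (hom_norm (coeff x) (j + m * ?k))\<^sup>2)" by simp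
    also have "\<dots> \<le> tail_energy (m * ?k) x"
      using sum_le_suminf[OF sums_summable[OF tail_energy_sums[of x "m * ?k"]], of "{n mod m}"]
      by (simp add: sums_unique[OF tail_energy_sums[of x "m * ?k"]])
    also have "\<dots> \<le> (1/4) ^ ?k * (norm x)\<^sup>2" by (rule decay)
    also have "\<dots> = (norm x * (1/2) ^ ?k)\<^sup>2"
      by (simp add: power_mult_distrib power2_eq_square flip: power_mult_distrib)
    finally have "hom_norm (coeff x) n \<le> norm x * (1/2) ^ ?k"
      by (rule power2_le_imp_le) simp
    then show "norm (hom_norm (coeff x) n) \<le> norm x * (1/2) ^ ?k" by (simp add: hom_norm_def)
  qed
qed

section \<open>Dilated creation operators\<close>

lemma op_word_lshift: "coeff (blinfun_apply (op_word lshift \<alpha>) x) = conv (word_delta \<alpha>) (coeff x)"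
proof (induction \<alpha>)
  case Nil
  show ?case by (rule ext) (simp add: conv_delta_Nil)
next
  case (Cons k \<alpha>)
  have "coeff (blinfun_apply (op_word lshift (k # \<alpha>)) x) w
      = conv (word_delta [k]) (conv (word_delta \<alpha>) (coeff x)) w" for w
    by (simp add: coeff_lshift conv_delta_singleton_Cons Cons.IH split: list.split)
  then show ?case by (simp add: fun_eq_iff conv_assoc[symmetric] conv_delta_delta)
qed

lemma hom_part_lshift:
  "coeff (blinfun_apply (hom_part f lshift m) x) w
    = (if m \<le> length w then f (take m w) * coeff x (drop m w) else 0)"
proof -
  have "coeff (blinfun_apply (hom_part f lshift m) x) w
      = (\<Sum>\<alpha>\<in>{\<alpha>. length \<alpha> = m}. f \<alpha> * conv (word_delta \<alpha>) (coeff x) w)"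
    by (simp add: hom_part_def blinfun.sum_left op_word_lshift)
  also have "\<dots> = conv (\<lambda>v. \<Sum>\<alpha>\<in>{\<alpha>. length \<alpha> = m}. f \<alpha> * word_delta \<alpha> v) (coeff x) w"
    unfolding conv_def by (simp add: sum_distrib_left sum_distrib_right mult.assoc) (rule sum.swap)
  also have "(\<lambda>v. \<Sum>\<alpha>\<in>{\<alpha>. length \<alpha> = m}. f \<alpha> * word_delta \<alpha> v) = (\<lambda>v. if length v = m then f v else 0)"
  proof
    fix v
    have "(\<Sum>\<alpha>\<in>{\<alpha>. length \<alpha> = m}. f \<alpha> * word_delta \<alpha> v) = (\<Sum>\<alpha>\<in>{\<alpha>. length \<alpha> = m}. if \<alpha> = v then f v else 0)"
      by (intro sum.cong refl) (auto simp: word_delta_def)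
    then show "(\<Sum>\<alpha>\<in>{\<alpha>. length \<alpha> = m}. f \<alpha> * word_delta \<alpha> v) = (if length v = m then f v else 0)"
      by (auto simp: sum.delta')
  qed
  finally show ?thesis by (simp only: conv_homogeneous_left)
qed

lemma clinear_lshift: "clinear_op (lshift k)"
  unfolding clinear_op_def
  by (intro allI blinfun_eqI ell2_eqI) (auto simp: coeff_lshift split: list.split)

text \<open>
  The adjoint of a creation operator removes the first letter.
\<close>

lemma coeff_cadjoint_lshift: "coeff (blinfun_apply (cadjoint (lshift k)) y) w = coeff y (k # w)"
proof -
  have "blinfun_apply (lshift k) (unit_ell2 w) = unit_ell2 (k # w)"
    by (rule ell2_eqI) (auto simp: coeff_lshift split: list.split)
  then show ?thesis
    using cinner_cadjoint[OF clinear_lshift, of k "unit_ell2 w" y] by (simp add: cinner_unit)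
qed

text \<open>
  The projection \<open>\<Sum>\<^sub>k L\<^sub>k L\<^sub>k\<^sup>*\<close> onto the complement of the vacuum.
\<close>

definition range_proj :: "'d::finite fock_op" where
  "range_proj = (\<Sum>k\<in>UNIV. lshift k o\<^sub>L cadjoint (lshift k))"

lemma coeff_range_proj: "coeff (blinfun_apply range_proj y) w = (if w = [] then 0 else coeff y w)"
  by (cases w) (simp_all add: range_proj_def blinfun.sum_left coeff_lshift coeff_cadjoint_lshift)

lemma norm_range_proj:
  fixes y :: "'d::finite fock"
  shows "norm (blinfun_apply range_proj y) \<le> norm y"
proof (rule norm_ell2_leI)
  fix F :: "'d list set" assume F: "finite F"
  have "(\<Sum>w\<in>F. (cmod (coeff (blinfun_apply range_proj y) w))\<^sup>2) \<le> (\<Sum>w\<in>F. (cmod (coeff y w))\<^sup>2)"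
    by (intro sum_mono) (simp add: coeff_range_proj)
  also have "\<dots> \<le> (norm y)\<^sup>2" by (rule sum_coeff_le_norm_squared[OF F])
  finally show "(\<Sum>w\<in>F. (cmod (coeff (blinfun_apply range_proj y) w))\<^sup>2) \<le> (norm y)\<^sup>2" .
qed simp

definition dilated_shift :: "real \<Rightarrow> 'd \<Rightarrow> 'd fock_op" where
  "dilated_shift r k = r *\<^sub>R lshift k"

lemma clinear_dilated_shift: "clinear_op (dilated_shift r k)"
  unfolding clinear_op_def dilated_shift_def
  by (intro allI blinfun_eqI ell2_eqI) (auto simp: coeff_lshift blinfun.scaleR_left split: list.split)

lemma cinner_scaleR_right: "cinner x (r *\<^sub>R y) = complex_of_real r * cinner x y"
  by (simp add: scaleR_eq_cscale cinner_cscale_right)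

lemma cinner_scaleR_left: "cinner (r *\<^sub>R x) y = complex_of_real r * cinner x y"
  by (simp add: scaleR_eq_cscale cinner_cscale_left)

lemma cadjoint_dilated_shift: "cadjoint (dilated_shift r k) = r *\<^sub>R cadjoint (lshift k)"
  by (rule cadjoint_eqI)
    (simp add: dilated_shift_def blinfun.scaleR_left cinner_scaleR_left cinner_scaleR_right
      cinner_cadjoint[OF clinear_lshift])

lemma dilated_row: "(\<Sum>k\<in>UNIV. dilated_shift r k o\<^sub>L cadjoint (dilated_shift r k)) = r\<^sup>2 *\<^sub>R range_proj"
  unfolding cadjoint_dilated_shift range_proj_def scaleR_sum_right
  by (intro sum.cong refl blinfun_eqI)
    (simp add: dilated_shift_def blinfun.scaleR_left blinfun.scaleR_right power2_eq_square)

lemma row_bounded_dilated_shift: "row_bounded (r\<^sup>2) (dilated_shift r)"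
proof (rule row_bounded_if_norm_row[OF clinear_dilated_shift])
  show "norm (blinfun_apply (\<Sum>k\<in>UNIV. dilated_shift r k o\<^sub>L cadjoint (dilated_shift r k)) y) \<le> r\<^sup>2 * norm y"
    for y :: "'a fock"
    unfolding dilated_row by (simp add: blinfun.scaleR_left mult_left_mono norm_range_proj)
qed simp

lemma row_bounded_lshift: "row_bounded 1 lshift"
  using row_bounded_dilated_shift[of 1] by (simp add: dilated_shift_def[abs_def])

lemma hom_part_dilated_shift: "hom_part f (dilated_shift r) m = r ^ m *\<^sub>R hom_part f lshift m"
proof -
  have w: "op_word (dilated_shift r) \<alpha> = r ^ length \<alpha> *\<^sub>R op_word lshift \<alpha>" for \<alpha> :: "'a list"
    by (induction \<alpha>) (auto intro!: blinfun_eqI simp: dilated_shift_def blinfun.scaleR_left blinfun.scaleR_right)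
  show ?thesis
    unfolding hom_part_def scaleR_sum_right
    by (intro sum.cong refl blinfun_eqI) (simp add: w blinfun.scaleR_left blinfun.scaleR_right)
qed

lemma dilation_series_eval:
  assumes r: "0 \<le> r" "r < 1"
  shows "(\<lambda>m. r ^ m *\<^sub>R hom_part (coeff h) lshift m) sums series_eval_inf (coeff h) (dilated_shift r)"
proof -
  have "r\<^sup>2 < 1" using r by (simp add: power_less_one_iff)
  then show ?thesis
    unfolding hom_part_dilated_shift[symmetric] by (rule hom_part_sums[OF row_bounded_dilated_shift])
qed

lemma summable_dilation_defect:
  fixes c :: "nat \<Rightarrow> real"
  assumes "summable c" "\<And>m. 0 \<le> c m" "0 \<le> r" "r \<le> 1"
  shows "summable (\<lambda>m. (1 - r ^ m) * c m)"
  by (rule summable_comparison_test'[OF assms(1)])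
    (use assms in \<open>auto simp: abs_mult power_le_one intro!: mult_left_le_one_le\<close>)

text \<open>
  Finitely many terms tend to zero with \<open>1 - r\<^sup>m\<close>; the others are bounded by a tail of the
  convergent series \<open>\<Sum> c\<^sub>m\<close>.
\<close>

lemma dilation_defect_small:
  fixes c :: "nat \<Rightarrow> real"
  assumes c: "summable c" "\<And>m. 0 \<le> c m" and e: "e > 0"
  shows "\<forall>\<^sub>F r in at_left 1. (\<Sum>m. (1 - r ^ m) * c m) < e"
proof -
  obtain N where N: "norm (\<Sum>i. c (i + N)) < e / 2"
    using suminf_exist_split[OF _ c(1), of "e/2"] e by auto
  have "((\<lambda>r. \<Sum>m<N. (1 - r ^ m) * c m) \<longlongrightarrow> (\<Sum>m<N. (1 - 1 ^ m) * c m)) (at_left 1)"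
    by (intro tendsto_intros)
  then have "\<forall>\<^sub>F r in at_left 1. (\<Sum>m<N. (1 - r ^ m) * c m) < e / 2"
    by (rule order_tendstoD(2)) (use e in simp)
  moreover have "\<forall>\<^sub>F r::real in at_left 1. 0 < r \<and> r < 1"
    unfolding eventually_at_left_field by (intro exI[of _ 0]) auto
  ultimately show ?thesis
  proof eventually_elim
    fix r :: real
    assume small: "(\<Sum>m<N. (1 - r ^ m) * c m) < e / 2" and r: "0 < r \<and> r < 1"
    have s: "summable (\<lambda>m. (1 - r ^ m) * c m)" using r by (intro summable_dilation_defect c) auto
    have "(\<Sum>m. (1 - r ^ (m + N)) * c (m + N)) \<le> (\<Sum>m. c (m + N))"
    proof (rule suminf_le)
      show "(1 - r ^ (m + N)) * c (m + N) \<le> c (m + N)" for m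
        using r c(2)[of "m + N"] by (intro mult_left_le_one_le) (auto simp: power_le_one)
      show "summable (\<lambda>m. (1 - r ^ (m + N)) * c (m + N))"
        using summable_ignore_initial_segment[OF s, of N] by simp
      show "summable (\<lambda>m. c (m + N))" by (rule summable_ignore_initial_segment[OF c(1)])
    qed
    also have "\<dots> < e / 2" using N by simp
    finally show "(\<Sum>m. (1 - r ^ m) * c m) < e"
      using small suminf_split_initial_segment[OF s, of N] by simp
  qed
qed

text \<open>
  With summable norms, the homogeneous parts of \<open>\<theta>(L)\<close> converge in norm, and their sum has
  the coefficients of \<open>\<Theta>\<close>. Subtracting the series for \<open>\<theta>(r L)\<close> term by term gives the bound.
\<close>

lemma norm_dilation_defect_op:
  assumes \<Theta>: "\<And>x. coeff (blinfun_apply \<Theta> x) = conv (coeff \<theta>) (coeff x)"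
    and sm: "summable (hom_norm (coeff \<theta>))" and r: "0 \<le> r" "r < 1"
  shows "norm (\<Theta> - series_eval_inf (coeff \<theta>) (dilated_shift r)) \<le> (\<Sum>m. (1 - r ^ m) * hom_norm (coeff \<theta>) m)"
proof -
  let ?D = "hom_part (coeff \<theta>) lshift"
  have nD: "norm (?D m) \<le> hom_norm (coeff \<theta>) m" for m
    using norm_hom_part[OF row_bounded_lshift, of "coeff \<theta>" m] by simp
  have "summable ?D" by (rule summable_norm_comparison_test[OF _ sm, THEN summable_norm_cancel]) (use nD in auto)
  then have D: "?D sums suminf ?D" by (rule summable_sums)
  have "suminf ?D = \<Theta>"
  proof (intro blinfun_eqI ell2_eqI)
    fix x w
    have "(\<lambda>m. coeff (blinfun_apply (?D m) x) w) sums coeff (blinfun_apply (suminf ?D) x) w"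
      by (intro bounded_linear.sums[OF bounded_linear_coeff] bounded_linear.sums[OF blinfun.bounded_linear_left] D)
    moreover have "(\<lambda>m. coeff (blinfun_apply (?D m) x) w) sums coeff (blinfun_apply \<Theta> x) w"
      using sums_If_finite_set[of "{..length w}" "\<lambda>m. coeff \<theta> (take m w) * coeff x (drop m w)"]
      by (simp add: hom_part_lshift \<Theta> conv_def)
    ultimately show "coeff (blinfun_apply (suminf ?D) x) w = coeff (blinfun_apply \<Theta> x) w"
      by (rule sums_unique2)
  qed
  with D have "(\<lambda>m. ?D m - r ^ m *\<^sub>R ?D m) sums (\<Theta> - series_eval_inf (coeff \<theta>) (dilated_shift r))"
    by (intro sums_diff dilation_series_eval r) simp
  also have "(\<lambda>m. ?D m - r ^ m *\<^sub>R ?D m) = (\<lambda>m. (1 - r ^ m) *\<^sub>R ?D m)"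
    by (simp add: scaleR_left_diff_distrib)
  finally have "\<Theta> - series_eval_inf (coeff \<theta>) (dilated_shift r) = (\<Sum>m. (1 - r ^ m) *\<^sub>R ?D m)"
    by (rule sums_unique)
  also have "norm \<dots> \<le> (\<Sum>m. (1 - r ^ m) * hom_norm (coeff \<theta>) m)"
  proof (rule norm_suminf_le)
    show "norm ((1 - r ^ m) *\<^sub>R ?D m) \<le> (1 - r ^ m) * hom_norm (coeff \<theta>) m" for m
      using r by (auto simp: power_le_one intro!: mult_mono nD)
    show "summable (\<lambda>m. (1 - r ^ m) * hom_norm (coeff \<theta>) m)"
      using r by (intro summable_dilation_defect sm) (auto simp: hom_norm_def)
  qed
  finally show ?thesis .
qed

lemma coeff_dilation_vacuum:
  assumes r: "0 \<le> r" "r < 1"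
  shows "coeff (blinfun_apply (series_eval_inf (coeff h) (dilated_shift r)) vacuum) w
    = complex_of_real (r ^ length w) * coeff h w"
proof -
  have "(\<lambda>m. coeff (blinfun_apply (r ^ m *\<^sub>R hom_part (coeff h) lshift m) vacuum) w)
      sums coeff (blinfun_apply (series_eval_inf (coeff h) (dilated_shift r)) vacuum) w"
    by (intro bounded_linear.sums[OF bounded_linear_coeff] bounded_linear.sums[OF blinfun.bounded_linear_left]
      dilation_series_eval r)
  also have "(\<lambda>m. coeff (blinfun_apply (r ^ m *\<^sub>R hom_part (coeff h) lshift m) vacuum) w)
      = (\<lambda>m. if m = length w then complex_of_real (r ^ m) * coeff h w else 0)"
    by (auto simp: fun_eq_iff blinfun.scaleR_left hom_part_lshift coeff_vacuum word_delta_def)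
  finally show ?thesis
    using sums_unique2[OF _ sums_single[of "length w" "\<lambda>m. complex_of_real (r ^ m) * coeff h w"]] by simp
qed

text \<open>
  Degree \<open>m\<close> of \<open>h - h\<^sub>r\<close> carries the factor \<open>1 - r\<^sup>m\<close>, whose square is at most itself.
\<close>

lemma norm_dilation_defect_vec:
  assumes r: "0 \<le> r" "r < 1"
  shows "(norm (h - blinfun_apply (series_eval_inf (coeff h) (dilated_shift r)) vacuum))\<^sup>2
    \<le> (\<Sum>m. (1 - r ^ m) * (hom_norm (coeff h) m)\<^sup>2)"
proof -
  let ?d = "h - blinfun_apply (series_eval_inf (coeff h) (dilated_shift r)) vacuum"
  have d: "coeff ?d w = complex_of_real (1 - r ^ length w) * coeff h w" for w
    by (simp add: coeff_dilation_vacuum[OF r] algebra_simps)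
  have hd: "(hom_norm (coeff ?d) m)\<^sup>2 = (1 - r ^ m)\<^sup>2 * (hom_norm (coeff h) m)\<^sup>2" for m
    unfolding hom_norm_squared sum_distrib_left
    by (intro sum.cong refl) (simp add: d norm_mult power_mult_distrib del: of_real_diff minus_ell2.rep_eq)
  have "(norm ?d)\<^sup>2 = (\<Sum>m. (hom_norm (coeff ?d) m)\<^sup>2)"
    by (rule sums_unique[OF hom_norm_squared_sums])
  also have "\<dots> \<le> (\<Sum>m. (1 - r ^ m) * (hom_norm (coeff h) m)\<^sup>2)"
  proof (rule suminf_le)
    show "(hom_norm (coeff ?d) m)\<^sup>2 \<le> (1 - r ^ m) * (hom_norm (coeff h) m)\<^sup>2" for m
      unfolding hd power2_eq_square[of "1 - r ^ m"]
      using r by (intro mult_right_mono mult_left_le_one_le) (auto simp: power_le_one)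
    show "summable (\<lambda>m. (hom_norm (coeff ?d) m)\<^sup>2)" by (rule sums_summable[OF hom_norm_squared_sums])
    show "summable (\<lambda>m. (1 - r ^ m) * (hom_norm (coeff h) m)\<^sup>2)"
      using r by (intro summable_dilation_defect sums_summable[OF hom_norm_squared_sums]) auto
  qed
  finally show ?thesis .
qed

lemma series_eval_inf_cscale:
  assumes "row_bounded c Z" "c < 1"
  shows "blinfun_apply (series_eval_inf (coeff h) Z) (blinfun_apply (cscale k) x)
    = blinfun_apply (cscale k) (blinfun_apply (series_eval_inf (coeff h) Z) x)"
proof (rule cinner_ext)
  fix y
  from assms have Z: "\<And>j. clinear_op (Z j)" by (simp add: row_bounded_def)
  have "((\<lambda>\<alpha>. k * (cinner y (blinfun_apply (op_word Z \<alpha>) x) * coeff h \<alpha>))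
      has_sum k * cinner y (blinfun_apply (series_eval_inf (coeff h) Z) x)) UNIV"
    by (intro has_sum_cmult_right series_eval_inf_pairing(1)[OF assms])
  moreover have "((\<lambda>\<alpha>. k * (cinner y (blinfun_apply (op_word Z \<alpha>) x) * coeff h \<alpha>))
      has_sum cinner y (blinfun_apply (series_eval_inf (coeff h) Z) (blinfun_apply (cscale k) x))) UNIV"
    using series_eval_inf_pairing(1)[OF assms, of y "blinfun_apply (cscale k) x" h]
    by (simp add: cinner_op_word[OF Z] cinner_cscale_right mult.assoc)
  ultimately show "cinner y (blinfun_apply (series_eval_inf (coeff h) Z) (blinfun_apply (cscale k) x))
      = cinner y (blinfun_apply (cscale k) (blinfun_apply (series_eval_inf (coeff h) Z) x))"
    unfolding cinner_cscale_right using has_sum_unique by blast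
qed

section \<open>Transport along a bijection of index sets\<close>

text \<open>
  The value \<open>0\<close> for a map \<open>e\<close> that is not bijective keeps the result square-summable
  for every \<open>e\<close>, so that \<open>relabel\<close> is a total function into bounded operators.
\<close>

lift_definition relabel_fun :: "('a \<Rightarrow> 'b) \<Rightarrow> 'b ell2 \<Rightarrow> 'a ell2" is
  "\<lambda>e x i. if bij e then x (e i) else 0"
proof -
  fix e :: "'a \<Rightarrow> 'b" and x :: "'b \<Rightarrow> complex"
  assume x: "(\<lambda>i. (cmod (x i))\<^sup>2) summable_on UNIV"
  show "(\<lambda>i. (cmod (if bij e then x (e i) else 0))\<^sup>2) summable_on UNIV"
    using summable_on_reindex_bij_betw[of e UNIV UNIV "\<lambda>i. (cmod (x i))\<^sup>2"] x
    by (cases "bij e") simp_all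
qed

lemma norm_relabel_fun: "bij e \<Longrightarrow> norm (relabel_fun e x) = norm x"
  using infsum_reindex_bij_betw[of e UNIV UNIV "\<lambda>i. (cmod (coeff x i))\<^sup>2"]
  by (simp add: norm_ell2_def relabel_fun.rep_eq)

lift_definition relabel :: "('a \<Rightarrow> 'b) \<Rightarrow> 'b ell2 \<Rightarrow>\<^sub>L 'a ell2" is relabel_fun
proof -
  fix e :: "'a \<Rightarrow> 'b"
  show "bounded_linear (relabel_fun e)"
  proof (rule bounded_linear_intro[where K = 1])
    show "norm (relabel_fun e x) \<le> norm x * 1" for x
      by (cases "bij e") (simp add: norm_relabel_fun, simp add: norm_ell2_def relabel_fun.rep_eq infsum_nonneg)
  qed (transfer, simp add: fun_eq_iff)+
qed

text \<open>
  The infinite level of the singularity space lives on \<open>nat ell2\<close>, while the creation operators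
  act on the Fock space; a bijection between numbers and words carries the latter to the former. The
  inverse map \<open>e'\<close> is a parameter of its own, so that both directions are computed by rewriting.
\<close>

context
  fixes e :: "'a \<Rightarrow> 'b" and e' :: "'b \<Rightarrow> 'a"
  assumes e: "\<And>i. e' (e i) = i" "\<And>j. e (e' j) = j"
begin

lemma bij_e: "bij e" and bij_e': "bij e'"
  using e by (metis bijI')+

lemma coeff_relabel: "coeff (blinfun_apply (relabel e) x) i = coeff x (e i)"
  using bij_e by (simp add: relabel.rep_eq relabel_fun.rep_eq)

lemma norm_relabel: "norm (blinfun_apply (relabel e) x) = norm x"
  using bij_e by (simp add: relabel.rep_eq norm_relabel_fun)

lemma coeff_relabel_inv: "coeff (blinfun_apply (relabel e') y) j = coeff y (e' j)"
  using bij_e' by (simp add: relabel.rep_eq relabel_fun.rep_eq)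

lemma norm_relabel_inv: "norm (blinfun_apply (relabel e') x) = norm x"
  using bij_e' by (simp add: relabel.rep_eq norm_relabel_fun)

lemma relabel_inverses:
  "blinfun_apply (relabel e') (blinfun_apply (relabel e) x) = x"
  "blinfun_apply (relabel e) (blinfun_apply (relabel e') y) = y"
  by (auto intro!: ell2_eqI simp: coeff_relabel coeff_relabel_inv e)

lemma cinner_relabel: "cinner (blinfun_apply (relabel e) x) y = cinner x (blinfun_apply (relabel e') y)"
proof -
  have "cinner x (blinfun_apply (relabel e') y)
      = (\<Sum>\<^sub>\<infinity>i. cnj (coeff x (e i)) * coeff (blinfun_apply (relabel e') y) (e i))"
    unfolding cinner_def by (rule infsum_reindex_bij_betw[symmetric]) (rule bij_e)
  then show ?thesis
    by (simp add: cinner_def coeff_relabel coeff_relabel_inv e)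
qed

definition transport :: "('b ell2 \<Rightarrow>\<^sub>L 'b ell2) \<Rightarrow> 'a ell2 \<Rightarrow>\<^sub>L 'a ell2" where
  "transport A = relabel e o\<^sub>L A o\<^sub>L relabel e'"

lemma transport_apply:
  "blinfun_apply (transport A) y = blinfun_apply (relabel e) (blinfun_apply A (blinfun_apply (relabel e') y))"
  by (simp add: transport_def)

lemma bounded_linear_transport: "bounded_linear transport"
  unfolding transport_def
  by (intro bounded_linear_intros) 

lemma clinear_transport: "clinear_op A \<Longrightarrow> clinear_op (transport A)"
proof -
  assume A: "clinear_op A"
  have 1: "blinfun_apply (relabel e') (blinfun_apply (cscale c) x)
      = blinfun_apply (cscale c) (blinfun_apply (relabel e') x)" for c x
    by (rule ell2_eqI) (simp add: coeff_relabel_inv)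
  have 2: "blinfun_apply (relabel e) (blinfun_apply (cscale c) x)
      = blinfun_apply (cscale c) (blinfun_apply (relabel e) x)" for c x
    by (rule ell2_eqI) (simp add: coeff_relabel)
  show ?thesis
    unfolding clinear_op_def
    by (intro allI blinfun_eqI) (simp add: transport_apply 1 2 clinear_op_apply[OF A])
qed

lemma cadjoint_transport:
  assumes A: "clinear_op A"
  shows "cadjoint (transport A) = transport (cadjoint A)"
proof (rule cadjoint_eqI)
  fix x y
  have "cinner (blinfun_apply (transport A) x) y
      = cinner (blinfun_apply (relabel e') x) (blinfun_apply (cadjoint A) (blinfun_apply (relabel e') y))"
    by (simp add: transport_apply cinner_relabel cinner_cadjoint[OF A])
  also have "\<dots> = cinner x (blinfun_apply (transport (cadjoint A)) y)"
    using cinner_relabel[of "blinfun_apply (relabel e') x"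
      "blinfun_apply (transport (cadjoint A)) y"]
    by (simp add: transport_apply relabel_inverses)
  finally show "cinner (blinfun_apply (transport A) x) y = cinner x (blinfun_apply (transport (cadjoint A)) y)" .
qed

lemma transport_compose: "transport A o\<^sub>L transport B = transport (A o\<^sub>L B)"
  by (rule blinfun_eqI) (simp add: transport_apply relabel_inverses)

lemma op_word_transport: "op_word (\<lambda>j. transport (Z j)) \<alpha> = transport (op_word Z \<alpha>)"
proof (induction \<alpha>)
  case Nil
  show ?case by (rule blinfun_eqI) (simp add: transport_apply relabel_inverses)
qed (simp add: transport_compose)

lemma hom_part_transport: "hom_part f (\<lambda>j. transport (Z j)) m = transport (hom_part f Z m)"
proof -
  have "cscale c o\<^sub>L transport A = transport (cscale c o\<^sub>L A)" for c A
    by (intro blinfun_eqI ell2_eqI) (simp add: transport_apply coeff_relabel)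
  then show ?thesis
    by (simp add: hom_part_def op_word_transport linear_sum[OF bounded_linear.linear[OF bounded_linear_transport]])
qed

lemma series_eval_inf_transport:
  assumes "row_bounded c Z" "c < 1"
  shows "series_eval_inf (coeff h) (\<lambda>j. transport (Z j)) = transport (series_eval_inf (coeff h) Z)"
proof -
  have "(\<lambda>m. transport (hom_part (coeff h) Z m)) sums transport (series_eval_inf (coeff h) Z)"
    by (intro bounded_linear.sums[OF bounded_linear_transport] hom_part_sums[OF assms])
  then show ?thesis
    unfolding hom_part_transport[symmetric]
    by (simp add: series_eval_inf_def hom_part_def[symmetric] sums_iff)
qed

end

section \<open>Singular points determine the range\<close>

lemma subspace_closure:
  fixes S :: "'a::real_normed_vector set"
  assumes S: "real_vector.subspace S"
  shows "real_vector.subspace (closure S)"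
  unfolding real_vector.subspace_def
proof (intro conjI ballI allI)
  show "0 \<in> closure S" using real_vector.subspace_0[OF S] closure_subset by blast
  fix x assume "x \<in> closure S"
  then obtain X where X: "\<And>n. X n \<in> S" "X \<longlonglongrightarrow> x" unfolding closure_sequential by blast
  show "c *\<^sub>R x \<in> closure S" for c
    unfolding closure_sequential
    using X by (intro exI[of _ "\<lambda>n. c *\<^sub>R X n"]) (auto intro!: tendsto_intros real_vector.subspace_scale[OF S])
  fix y assume "y \<in> closure S"
  then obtain Y where Y: "\<And>n. Y n \<in> S" "Y \<longlonglongrightarrow> y" unfolding closure_sequential by blast
  show "x + y \<in> closure S"
    unfolding closure_sequential
    using X Y by (intro exI[of _ "\<lambda>n. X n + Y n"]) (auto intro!: tendsto_intros real_vector.subspace_add[OF S])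
qed

lemma subspace_range_blinfun: "real_vector.subspace (range (blinfun_apply A))"
  unfolding real_vector.subspace_def
proof (intro conjI ballI allI)
  show "0 \<in> range (blinfun_apply A)" by (rule range_eqI[of _ _ 0]) simp
  fix x assume "x \<in> range (blinfun_apply A)"
  then obtain u where u: "x = blinfun_apply A u" by blast
  show "c *\<^sub>R x \<in> range (blinfun_apply A)" for c
    by (rule range_eqI[of _ _ "c *\<^sub>R u"]) (simp add: u blinfun.scaleR_right)
  fix y assume "y \<in> range (blinfun_apply A)"
  then obtain v where v: "y = blinfun_apply A v" by blast
  show "x + y \<in> range (blinfun_apply A)"
    by (rule range_eqI[of _ _ "u + v"]) (simp add: u v blinfun.add_right)
qed

text \<open>
  A vector that separates \<open>h\<^sub>r\<close> from the range of \<open>\<theta>(r L)\<close> would, together with the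
  transported tuple \<open>r L\<close>, be a singular point of \<open>\<theta>\<close> at which \<open>h\<close> does not vanish.
\<close>

lemma dilation_in_closure_range:
  fixes h \<theta> :: "'d::finite fock"
  assumes r: "0 \<le> r" "r < 1"
    and Sing: "\<And>Z y. (Z, y) \<in> Sing_inf \<theta> \<Longrightarrow> left_null_inf y (series_eval_inf (coeff h) Z)"
  shows "blinfun_apply (series_eval_inf (coeff h) (dilated_shift r)) vacuum
    \<in> closure (range (blinfun_apply (series_eval_inf (coeff \<theta>) (dilated_shift r))))"
proof (rule ccontr)
  let ?A = "\<lambda>f. series_eval_inf (coeff f) (dilated_shift r)"
  let ?v = "blinfun_apply (?A h) vacuum" and ?R = "range (blinfun_apply (?A \<theta>))"
  have r2: "r\<^sup>2 < 1" using r by (simp add: power_less_one_iff)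
  note rb = row_bounded_dilated_shift[of r]
  assume "?v \<notin> closure ?R"
  then obtain y where orth: "\<And>s. s \<in> closure ?R \<Longrightarrow> inner y s = 0" and nz: "inner y ?v \<noteq> 0"
    using orthogonal_separation[OF subspace_closure[OF subspace_range_blinfun] closed_closure] by metis
  have zero: "cinner y (blinfun_apply (?A \<theta>) x) = 0" for x
  proof -
    have re: "Re (cinner y (blinfun_apply (?A \<theta>) x)) = 0" for x
      using orth[OF subsetD[OF closure_subset rangeI], of x] by (simp only: inner_ell2_def)
    \<comment> \<open>orthogonality is real; the range is invariant under \<open>\<i>\<close>, which gives the imaginary part\<close>
    from re[of "blinfun_apply (cscale \<i>) x"] have "Im (cinner y (blinfun_apply (?A \<theta>) x)) = 0"
      by (simp add: series_eval_inf_cscale[OF rb r2] cinner_cscale_right)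
    with re show ?thesis by (simp add: complex_eq_iff)
  qed
  define e :: "nat \<Rightarrow> 'd list" where "e = from_nat_into UNIV"
  define e' where "e' = inv_into UNIV e"
  have "bij e"
    unfolding e_def by (rule bij_betw_from_nat_into) (auto simp: infinite_UNIV_listI)
  then have e: "e' (e i) = i" "e (e' j) = j" for i j
    by (simp_all add: e'_def bij_is_inj bij_is_surj surj_f_inv_f)
  let ?V = "relabel e" and ?T = "transport e e'"
  let ?Z = "\<lambda>k. ?T (dilated_shift r k)"
  have eval: "series_eval_inf (coeff f) ?Z = ?T (?A f)" for f
    by (rule series_eval_inf_transport[OF e rb r2])
  have pair: "cinner (blinfun_apply ?V y) (blinfun_apply (?T B) x) = cinner y (blinfun_apply B (blinfun_apply (relabel e') x))"
    for B x
    by (simp add: transport_apply[OF e] cinner_relabel[OF e] relabel_inverses[OF e])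
  have "?Z \<in> row_ball_inf"
    unfolding row_ball_inf_def
  proof (intro CollectI conjI allI)
    show "clinear_op (?Z k)" for k by (rule clinear_transport[OF e clinear_dilated_shift])
    have "(\<Sum>k\<in>UNIV. ?Z k o\<^sub>L cadjoint (?Z k)) = ?T (r\<^sup>2 *\<^sub>R range_proj)"
      by (simp only: cadjoint_transport[OF e clinear_dilated_shift] transport_compose[OF e]
        linear_sum[OF bounded_linear.linear[OF bounded_linear_transport[OF e]], symmetric] dilated_row)
    also have "norm \<dots> \<le> r\<^sup>2"
    proof (rule norm_blinfun_bound)
      fix x
      have "norm (blinfun_apply (?T (r\<^sup>2 *\<^sub>R range_proj)) x)
          = r\<^sup>2 * norm (blinfun_apply range_proj (blinfun_apply (relabel e') x))"
        by (simp add: transport_apply[OF e] norm_relabel[OF e] blinfun.scaleR_left)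
      also have "\<dots> \<le> r\<^sup>2 * norm x"
        using norm_range_proj[of "blinfun_apply (relabel e') x"]
        by (intro mult_left_mono) (simp_all add: norm_relabel_inv[OF e])
      finally show "norm (blinfun_apply (?T (r\<^sup>2 *\<^sub>R range_proj)) x) \<le> r\<^sup>2 * norm x" .
    qed simp
    finally show "norm (\<Sum>k\<in>UNIV. ?Z k o\<^sub>L cadjoint (?Z k)) < 1" using r2 by simp
  qed
  moreover have "blinfun_apply ?V y \<noteq> 0"
    using nz norm_relabel[OF e, of y] by auto
  moreover have "left_null_inf (blinfun_apply ?V y) (series_eval_inf (coeff \<theta>) ?Z)"
    by (simp add: left_null_inf_def eval pair zero)
  ultimately have "(?Z, blinfun_apply ?V y) \<in> Sing_inf \<theta>" by (simp add: Sing_inf_def)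
  then have "left_null_inf (blinfun_apply ?V y) (?T (?A h))" using Sing eval by metis
  then have "cinner (blinfun_apply ?V y) (blinfun_apply (?T (?A h)) (blinfun_apply ?V vacuum)) = 0"
    unfolding left_null_inf_def by blast
  then have "cinner y ?v = 0" by (simp add: pair relabel_inverses[OF e])
  with nz show False by (simp add: inner_ell2_def)
qed

lemma closed_range_isometry:
  fixes A :: "'a::banach \<Rightarrow>\<^sub>L 'b::real_normed_vector"
  assumes "\<And>x. norm (blinfun_apply A x) = norm x"
  shows "closed (range (blinfun_apply A))"
  by (intro complete_imp_closed complete_isometric_image[of 1] real_vector.subspace_UNIV
      blinfun.bounded_linear_right complete_UNIV) (simp_all add: assms)

text \<open>
  The limit \<open>r \<rightarrow> 1\<close>: choose \<open>g\<close> with \<open>\<theta>(r L) g\<close> close to \<open>h\<^sub>r\<close>. As \<open>\<theta>(r L)\<close> is within \<open>1/2\<close> of the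
  isometry \<open>\<Theta>\<close>, \<open>g\<close> is bounded independently of \<open>r\<close>, and then \<open>\<Theta> g\<close> is close to \<open>h\<close>.
\<close>

lemma mem_range_if_Sing_inf:
  fixes \<Theta> :: "'d::finite fock_op"
  assumes \<Theta>: "\<And>x. coeff (blinfun_apply \<Theta> x) = conv (coeff \<theta>) (coeff x)"
    and iso: "\<And>x. norm (blinfun_apply \<Theta> x) = norm x"
    and sm: "summable (hom_norm (coeff \<theta>))"
    and Sing: "\<And>Z y. (Z, y) \<in> Sing_inf \<theta> \<Longrightarrow> left_null_inf y (series_eval_inf (coeff h) Z)"
  shows "h \<in> range (blinfun_apply \<Theta>)"
proof -
  have "h \<in> closure (range (blinfun_apply \<Theta>))"
    unfolding closure_approachable
  proof (intro allI impI)
    fix \<epsilon> :: real assume \<epsilon>: "\<epsilon> > 0"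
    \<comment> \<open>\<open>K\<close> bounds the approximate preimages \<open>g\<close>, since \<open>\<parallel>g\<parallel> \<le> \<kappa> \<parallel>g\<parallel> + 2 \<eta> + \<parallel>h\<parallel>\<close> with \<open>\<kappa> \<le> 1/2\<close> and \<open>\<eta> \<le> 1\<close>;
      each of the three final errors is then at most \<open>\<epsilon> / 3\<close>.\<close>
    define K where "K = 2 * (norm h + 2)"
    have K: "K > 0" by (simp add: K_def add_nonneg_pos)
    define \<eta> where "\<eta> = min 1 (\<epsilon> / 3)"
    define \<kappa> where "\<kappa> = min (1/2) (\<epsilon> / (3 * K))"
    have pos: "\<eta> > 0" "\<kappa> > 0" using \<epsilon> K by (simp_all add: \<eta>_def \<kappa>_def)
    have "\<forall>\<^sub>F r in at_left 1. (\<Sum>m. (1 - r ^ m) * hom_norm (coeff \<theta>) m) < \<kappa>"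
      by (rule dilation_defect_small[OF sm _ pos(2)]) (simp add: hom_norm_def)
    moreover have "\<forall>\<^sub>F r in at_left 1. (\<Sum>m. (1 - r ^ m) * (hom_norm (coeff h) m)\<^sup>2) < \<eta>\<^sup>2"
      by (rule dilation_defect_small[OF sums_summable[OF hom_norm_squared_sums]]) (use pos in auto)
    moreover have "\<forall>\<^sub>F r::real in at_left 1. 0 < r \<and> r < 1"
      unfolding eventually_at_left_field by (intro exI[of _ 0]) auto
    ultimately have "\<forall>\<^sub>F r in at_left 1. (\<Sum>m. (1 - r ^ m) * hom_norm (coeff \<theta>) m) < \<kappa> \<and>
        (\<Sum>m. (1 - r ^ m) * (hom_norm (coeff h) m)\<^sup>2) < \<eta>\<^sup>2 \<and> 0 < r \<and> r < 1"
      by eventually_elim simp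
    then have "\<exists>r::real. (\<Sum>m. (1 - r ^ m) * hom_norm (coeff \<theta>) m) < \<kappa> \<and>
        (\<Sum>m. (1 - r ^ m) * (hom_norm (coeff h) m)\<^sup>2) < \<eta>\<^sup>2 \<and> 0 < r \<and> r < 1"
      by (rule eventually_happens'[OF trivial_limit_at_left_real])
    then obtain r :: real where r: "(\<Sum>m. (1 - r ^ m) * hom_norm (coeff \<theta>) m) < \<kappa>"
        "(\<Sum>m. (1 - r ^ m) * (hom_norm (coeff h) m)\<^sup>2) < \<eta>\<^sup>2" "0 \<le> r" "r < 1"
      by (auto intro: less_imp_le)
    define T where "T = series_eval_inf (coeff \<theta>) (dilated_shift r)"
    define v where "v = blinfun_apply (series_eval_inf (coeff h) (dilated_shift r)) vacuum"
    have T: "norm (\<Theta> - T) < \<kappa>"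
      using norm_dilation_defect_op[OF \<Theta> sm r(3,4)] r(1) by (simp add: T_def)
    have "(norm (h - v))\<^sup>2 < \<eta>\<^sup>2"
      using norm_dilation_defect_vec[OF r(3,4), of h] r(2) by (simp add: v_def)
    then have hv: "norm (h - v) < \<eta>" by (rule power_less_imp_less_base) (use pos in simp)
    have "v \<in> closure (range (blinfun_apply T))"
      unfolding v_def T_def by (rule dilation_in_closure_range[OF r(3,4) Sing])
    then obtain g where g: "norm (v - blinfun_apply T g) < \<eta>"
      using pos(1) unfolding closure_approachable dist_norm by (auto simp: norm_minus_commute)
    have Tg: "norm (blinfun_apply \<Theta> g - blinfun_apply T g) \<le> \<kappa> * norm g"
    proof -
      have "norm (blinfun_apply (\<Theta> - T) g) \<le> norm (\<Theta> - T) * norm g" by (rule norm_blinfun)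
      also have "\<dots> \<le> \<kappa> * norm g" using T by (intro mult_right_mono) auto
      finally show ?thesis by (simp add: blinfun.diff_left)
    qed
    have "norm g \<le> K"
    proof -
      have "norm g = norm (blinfun_apply \<Theta> g)" by (simp add: iso)
      also have "\<dots> \<le> norm (blinfun_apply \<Theta> g - blinfun_apply T g) + norm (v - blinfun_apply T g)
          + norm (h - v) + norm h"
        by norm
      also have "\<dots> \<le> \<kappa> * norm g + \<eta> + \<eta> + norm h" using Tg g hv by linarith
      also have "\<dots> \<le> (1/2) * norm g + 1 + 1 + norm h"
        by (intro add_mono mult_right_mono) (auto simp: \<kappa>_def \<eta>_def)
      finally show ?thesis by (simp add: K_def)
    qed
    then have "\<kappa> * norm g \<le> (\<epsilon> / (3 * K)) * K" using K \<epsilon> by (intro mult_mono) (auto simp: \<kappa>_def)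
    also have "\<dots> = \<epsilon> / 3" using K by simp
    finally have Tg': "norm (blinfun_apply \<Theta> g - blinfun_apply T g) \<le> \<epsilon> / 3" using Tg by linarith
    have "norm (blinfun_apply \<Theta> g - h)
        \<le> norm (blinfun_apply \<Theta> g - blinfun_apply T g) + norm (v - blinfun_apply T g) + norm (h - v)"
      by norm
    also have "\<dots> < \<epsilon> / 3 + \<epsilon> / 3 + \<epsilon> / 3"
      using Tg' g hv by (auto simp: \<eta>_def)
    finally have "dist (blinfun_apply \<Theta> g) h < \<epsilon>" by (simp add: dist_norm)
    then show "\<exists>y\<in>range (blinfun_apply \<Theta>). dist y h < \<epsilon>" by blast
  qed
  then show ?thesis using closed_range_isometry[OF iso] by (simp add: closure_closed)
qed

theorem corollary5p3:
  fixes \<Theta> :: "'d::finite fock_op"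
  assumes "\<Theta> \<in> Hinf"
    and "nc_inner \<Theta>"
    and "nc_rational (coeff (symbol \<Theta>))"
  shows "nc_blaschke \<Theta>"
proof -
  let ?\<theta> = "symbol \<Theta>"
  note \<Theta> = Hinf_apply[OF assms(1)]
  have iso: "norm (blinfun_apply \<Theta> x) = norm x" for x using assms(2) by (simp add: nc_inner_def)
  have sm: "summable (hom_norm (coeff ?\<theta>))"
    by (intro finite_rank_summable_hom_norm nc_rational_finite_rank assms(3))
  have "range (blinfun_apply \<Theta>) =
    {h. (\<forall>n\<ge>1. \<forall>(Z, y)\<in>Sing n ?\<theta>. left_null y (series_eval n (coeff h) Z)) \<and>
        (\<forall>(Z, y)\<in>Sing_inf ?\<theta>. left_null_inf y (series_eval_inf (coeff h) Z))}" (is "_ = ?H")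
  proof
    show "range (blinfun_apply \<Theta>) \<subseteq> ?H"
    proof (intro image_subsetI CollectI conjI allI impI ballI)
      fix g n P assume P: "P \<in> Sing n ?\<theta>"
      obtain Z y where Zy: "P = (Z, y)" by (cases P)
      from P have "Z \<in> row_ball n" "y \<in> carrier_vec n" "left_null y (series_eval n (coeff ?\<theta>) Z)"
        by (simp_all add: Zy Sing_def)
      from left_null_range[OF \<Theta> this]
      show "case P of (Z, y) \<Rightarrow> left_null y (series_eval n (coeff (blinfun_apply \<Theta> g)) Z)"
        by (simp only: Zy prod.case)
    next
      fix g P assume P: "P \<in> Sing_inf ?\<theta>"
      obtain Z y where Zy: "P = (Z, y)" by (cases P)
      from P have "Z \<in> row_ball_inf" "left_null_inf y (series_eval_inf (coeff ?\<theta>) Z)"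
        by (simp_all add: Zy Sing_inf_def)
      from left_null_inf_range[OF \<Theta> this]
      show "case P of (Z, y) \<Rightarrow> left_null_inf y (series_eval_inf (coeff (blinfun_apply \<Theta> g)) Z)"
        by (simp only: Zy prod.case)
    qed
    show "?H \<subseteq> range (blinfun_apply \<Theta>)"
    proof
      fix h assume "h \<in> ?H"
      then have "left_null_inf y (series_eval_inf (coeff h) Z)" if "(Z, y) \<in> Sing_inf ?\<theta>" for Z y
        using that by blast
      then show "h \<in> range (blinfun_apply \<Theta>)" by (rule mem_range_if_Sing_inf[OF \<Theta> iso sm])
    qed
  qed
  with assms(2) show ?thesis by (simp add: nc_blaschke_def)
qed

end
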